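(* Let $c_2 = \sqrt[64]{21\,\theta(64)}$, where $\theta(64) = 39911512393313043466768$ (so $c_2 = 2.364\ldots$). Then for all positive integers $n \geq 36$, \[ \theta(n) \leq \frac{c_2^n}{21}. \]
   Context: For a positive integer $n$, let $[n]=\{1,2,\ldots,n\}$. A permutation $(a_1,a_2,\ldots,a_n)$ of $[n]$ is called 3-free if there do not exist indices $i<j<k$ with $a_i + a_k = 2a_j$, i.e., it contains no 3-term arithmetic progression as a subsequence. $\theta(n)$ denotes the number of 3-free permutations of $[n]$. *)

theory Defs
  imports Complex_Main "HOL-Combinatorics.Multiset_Permutations"
begin

text \<open>
  A permutation \<open>(a\<^sub>1, \<dots>, a\<^sub>n)\<close> of \<open>{1..n}\<close> is represented by the list of its values, so list
  position \<open>i\<close> holds \<open>a\<^sub>i\<^sub>+\<^sub>1\<close>. The shift is harmless, as only the order of positions matters.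
\<close>

definition three_free :: "nat list \<Rightarrow> bool" where
  "three_free xs \<longleftrightarrow>
     \<not> (\<exists>i j k. i < j \<and> j < k \<and> k < length xs \<and> xs ! i + xs ! k = 2 * xs ! j)"

definition theta :: "nat \<Rightarrow> nat" where
  "theta n = card {xs \<in> permutations_of_set {1..n}. three_free xs}"

definition c2 :: real where
  "c2 = root 64 (21 * real (theta 64))"

end

theory Submission
  imports Defs "HOL-Library.Code_Binary_Nat"
begin

text \<open>
  Up to reversal, 1 precedes 2 in a 3-free permutation of \<open>{1..n}\<close>. The orientations of the progressions
  with a common middle element alternate with the parity of the difference, so that an even \<open>y\<close> can then
  precede an odd \<open>x\<close> only if \<open>x\<close> and \<open>y\<close> are far apart. Hence the permutation consists of a 3-free
  arrangement of the odd elements followed by one of the even elements, except that a final run of the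
  former may be shuffled with an initial run of the latter. A run stays on one side of its outermost
  element, and the number of shuffles depends only on that element and on the lengths of the runs. The
  distribution of these data over all 3-free permutations is therefore computed recursively, which yields
  \<open>theta 36\<close> to \<open>theta 71\<close>.

  At most half of the pairs of arrangements admit more than one shuffle, and none admits more than 20, so
  \<open>theta n \<le> 21 * theta \<lceil>n/2\<rceil> * theta \<lfloor>n/2\<rfloor>\<close>. Thus \<open>21 * theta n \<le> c\<^sup>n\<close> is passed on from the range 36 to
  71 to all larger \<open>n\<close>, and in that range \<open>c\<close> is determined by \<open>n = 64\<close>.
\<close>

text \<open>The shuffles are governed by the end of the odd arrangement and the start of the even
  one, while the permutation they produce shows the two other ends. Hence the types of both ends
  have to be tabulated jointly. A run can be measured without knowing the partner: a prefix confined
  to the lower half of the interval cannot exceed its first element, since reflecting that element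
  in the largest element of the prefix would give a still larger one in the prefix. At small lengths
  a shuffle may even lengthen an outer run, namely if this run and the shuffled block make up a
  whole parity class. From length 9 on every recorded run is shorter than half the permutation, so
  this stops. Runs then no longer grow: the bound 20, checked at lengths 9 to 18, persists, and the
  distribution at one end is enough to continue. Joint tables up to length 18 thus yield initial
  types up to length 36 and \<open>theta\<close> up to 71, and both halves of any n \<ge> 72 are at
  least 36. The number 2.364 is a rational lower bound of \<open>c2\<close> that is large enough for
  all lengths from 36 to 71 other than 64.\<close>

section \<open>Order of values in a list, 3-free permutations and their symmetries\<close>

fun prec :: "'a list \<Rightarrow> 'a \<Rightarrow> 'a \<Rightarrow> bool" where
  "prec [] x y \<longleftrightarrow> False"
| "prec (a # xs) x y \<longleftrightarrow> x = a \<and> y \<in> set xs \<or> prec xs x y"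

lemma prec_in_set: "prec xs x y \<Longrightarrow> x \<in> set xs \<and> y \<in> set xs"
  by (induction xs) auto

lemma prec_append: "prec (xs @ ys) x y \<longleftrightarrow> prec xs x y \<or> x \<in> set xs \<and> y \<in> set ys \<or> prec ys x y"
  by (induction xs) auto

lemma prec_total: "x \<in> set xs \<Longrightarrow> y \<in> set xs \<Longrightarrow> x \<noteq> y \<Longrightarrow> prec xs x y \<or> prec xs y x"
  by (induction xs) auto

lemma prec_asym: "distinct xs \<Longrightarrow> prec xs x y \<Longrightarrow> \<not> prec xs y x"
  by (induction xs) (auto dest: prec_in_set)

lemma prec_trans: "distinct xs \<Longrightarrow> prec xs x y \<Longrightarrow> prec xs y z \<Longrightarrow> prec xs x z"
  by (induction xs) (auto dest: prec_in_set)

lemma prec_not: "distinct xs \<Longrightarrow> x \<in> set xs \<Longrightarrow> y \<in> set xs \<Longrightarrow> x \<noteq> y \<Longrightarrow> \<not> prec xs x y \<longleftrightarrow> prec xs y x"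
  using prec_total prec_asym by metis

lemma prec_rev: "prec (rev xs) x y \<longleftrightarrow> prec xs y x"
  by (induction xs) (auto simp: prec_append)

lemma prec_filter: "prec (filter P xs) x y \<longleftrightarrow> P x \<and> P y \<and> prec xs x y"
  by (induction xs) auto

lemma prec_map: "inj_on f (set xs) \<Longrightarrow> x \<in> set xs \<Longrightarrow> y \<in> set xs \<Longrightarrow> prec (map f xs) (f x) (f y) \<longleftrightarrow> prec xs x y"
proof (induction xs)
  case (Cons a xs)
  have *: "f u = f v \<longleftrightarrow> u = v" if "u \<in> set (a # xs)" "v \<in> set (a # xs)" for u v
    using Cons.prems(1) that by (meson inj_onD)
  have m: "f y \<in> f ` set xs \<longleftrightarrow> y \<in> set xs"
    using * Cons.prems by (auto simp: image_iff)
  show ?case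
  proof (cases "x \<in> set xs \<and> y \<in> set xs")
    case True
    then show ?thesis using Cons.IH Cons.prems(1) * m by (auto simp: inj_on_insert)
  next
    case False
    have "prec (map f xs) (f x) (f y) \<Longrightarrow> x \<in> set xs \<and> y \<in> set xs"
      using prec_in_set[of "map f xs" "f x" "f y"] * Cons.prems by (auto simp: image_iff)
    then show ?thesis using False * m Cons.prems by (auto dest: prec_in_set)
  qed
qed simp

lemma prec_conv_nth: "prec xs x y \<longleftrightarrow> (\<exists>i j. i < j \<and> j < length xs \<and> xs ! i = x \<and> xs ! j = y)"
proof (induction xs)
  case (Cons a xs)
  show ?case (is "?L \<longleftrightarrow> ?R")
  proof
    assume ?L
    then show ?R
    proof (cases "x = a \<and> y \<in> set xs")
      case True
      then obtain j where "j < length xs" "xs ! j = y" by (auto simp: in_set_conv_nth)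
      then show ?thesis using True by (intro exI[of _ 0] exI[of _ "Suc j"]) auto
    next
      case False
      then obtain i j where "i < j" "j < length xs" "xs ! i = x" "xs ! j = y"
        using \<open>?L\<close> Cons.IH by auto
      then show ?thesis by (intro exI[of _ "Suc i"] exI[of _ "Suc j"]) auto
    qed
  next
    assume ?R
    then obtain i j where ij: "i < j" "j < Suc (length xs)" "(a # xs) ! i = x" "(a # xs) ! j = y" by auto
    then obtain j' where j': "j = Suc j'" by (cases j) auto
    show ?L
    proof (cases i)
      case 0
      then show ?thesis using ij j' by auto
    next
      case (Suc i')
      then show ?thesis using ij j' Cons.IH by auto
    qed
  qed
qed simp

text \<open>Passes from positions to the order of values. Distinctness is what identifies the
  position of the middle value in its two comparisons.\<close>

lemma three_free_iff:
  assumes "distinct xs"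
  shows "three_free xs \<longleftrightarrow> (\<forall>x y z. x + z = 2 * y \<longrightarrow> prec xs x y \<longrightarrow> \<not> prec xs y z)"
proof
  assume tf: "three_free xs"
  show "\<forall>x y z. x + z = 2 * y \<longrightarrow> prec xs x y \<longrightarrow> \<not> prec xs y z"
  proof (intro allI impI notI)
    fix x y z assume *: "x + z = 2 * y" "prec xs x y" "prec xs y z"
    then obtain i j j' k where "i < j" "j < length xs" "xs ! i = x" "xs ! j = y"
        "j' < k" "k < length xs" "xs ! j' = y" "xs ! k = z"
      unfolding prec_conv_nth by metis
    moreover from this have "j = j'" using assms by (auto simp: nth_eq_iff_index_eq)
    ultimately show False using tf *(1) unfolding three_free_def by blast
  qed
next
  assume *: "\<forall>x y z. x + z = 2 * y \<longrightarrow> prec xs x y \<longrightarrow> \<not> prec xs y z"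
  show "three_free xs"
    unfolding three_free_def
  proof (intro notI, elim exE conjE)
    fix i j k assume h: "i < j" "j < k" "k < length xs" "xs ! i + xs ! k = 2 * xs ! j"
    then have "prec xs (xs ! i) (xs ! j)" "prec xs (xs ! j) (xs ! k)"
      unfolding prec_conv_nth by (blast intro: less_trans)+
    then show False using * h(4) by blast
  qed
qed

definition free_perms :: "nat \<Rightarrow> nat list set" where
  "free_perms n = {xs \<in> permutations_of_set {1..n}. three_free xs}"

lemma theta_card: "theta n = card (free_perms n)"
  by (simp add: theta_def free_perms_def)

lemma finite_free_perms [simp]: "finite (free_perms n)"
  by (simp add: free_perms_def)

lemma free_perms_iff: "xs \<in> free_perms n \<longleftrightarrow> set xs = {1..n} \<and> distinct xs \<and> three_free xs"
  by (simp add: free_perms_def permutations_of_set_def)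

lemma free_permsD:
  assumes "xs \<in> free_perms n"
  shows "set xs = {1..n}" "distinct xs" "length xs = n"
    "x + z = 2 * y \<Longrightarrow> prec xs x y \<Longrightarrow> \<not> prec xs y z"
proof -
  show *: "set xs = {1..n}" "distinct xs" using assms by (auto simp: free_perms_iff)
  show "length xs = n" using distinct_card[OF *(2)] *(1) by simp
  show "x + z = 2 * y \<Longrightarrow> prec xs x y \<Longrightarrow> \<not> prec xs y z"
    using assms three_free_iff[OF *(2)] by (auto simp: free_perms_iff)
qed

text \<open>The two forbidden orders are \<open>x\<close>, \<open>y\<close>, \<open>z\<close> and
  \<open>z\<close>, \<open>y\<close>, \<open>x\<close>, so the middle term comes before both outer
  terms or after both.\<close>

lemma free_perms_reflect:
  assumes "xs \<in> free_perms n" "x + z = 2 * y" "x \<noteq> y" "x \<in> {1..n}" "z \<in> {1..n}"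
  shows "prec xs x y \<longleftrightarrow> prec xs z y"
proof -
  note F = free_permsD[OF assms(1)]
  have y: "y \<in> {1..n}" using assms by auto
  have n1: "\<not> prec xs x y \<longleftrightarrow> prec xs y x" and n2: "\<not> prec xs z y \<longleftrightarrow> prec xs y z"
    using prec_not[OF F(2)] assms y F(1) by auto
  then show ?thesis using F(4)[OF assms(2)] F(4)[of z x y] assms(2) by (metis add.commute)
qed

lemma rev_free_perms: "xs \<in> free_perms n \<Longrightarrow> rev xs \<in> free_perms n"
  unfolding free_perms_iff by (auto simp: three_free_iff prec_rev) (metis add.commute)

lemma bij_rev_free_perms: "bij_betw rev (free_perms n) (free_perms n)"
  by (rule bij_betwI[where g = rev]) (auto intro: rev_free_perms)

text \<open>This symmetry exchanges the lower and the upper half of the interval, so that facts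
  about runs need a direct proof for one half only.\<close>

definition mirror :: "nat \<Rightarrow> nat list \<Rightarrow> nat list" where
  "mirror n xs = map (\<lambda>x. n + 1 - x) xs"

lemma mirror_mirror: "set xs \<subseteq> {1..n} \<Longrightarrow> mirror n (mirror n xs) = xs"
  unfolding mirror_def map_map by (rule map_idI) auto

lemma inj_on_mirror: "inj_on (\<lambda>x. n + 1 - x) {1..n::nat}"
  by (rule inj_onI) auto

lemma image_mirror: "(\<lambda>x. n + 1 - x) ` {1..n::nat} = {1..n}"
proof (intro equalityI subsetI)
  fix x assume "x \<in> {1..n}"
  then show "x \<in> (\<lambda>x. n + 1 - x) ` {1..n}" by (intro image_eqI[of _ _ "n + 1 - x"]) auto
qed auto

lemma mirror_free_perms:
  assumes "xs \<in> free_perms n"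
  shows "mirror n xs \<in> free_perms n"
proof -
  note F = free_permsD[OF assms]
  let ?f = "\<lambda>x. n + 1 - x"
  have d: "distinct (mirror n xs)" and s: "set (mirror n xs) = {1..n}"
    using F inj_on_mirror image_mirror by (auto simp: mirror_def distinct_map)
  have p: "prec (mirror n xs) x y \<Longrightarrow> prec xs (?f x) (?f y) \<and> x \<in> {1..n} \<and> y \<in> {1..n}" for x y
  proof -
    assume h: "prec (mirror n xs) x y"
    have xy: "x \<in> {1..n}" "y \<in> {1..n}" using prec_in_set[OF h] s by auto
    then have "?f (?f x) = x" "?f (?f y) = y" "?f x \<in> {1..n}" "?f y \<in> {1..n}" by auto
    then show ?thesis using prec_map[of ?f xs "?f x" "?f y"] F(1) inj_on_mirror h xy
      by (simp add: mirror_def)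
  qed
  have "three_free (mirror n xs)"
    unfolding three_free_iff[OF d]
  proof (intro allI impI notI)
    fix x y z assume h: "x + z = 2 * y" "prec (mirror n xs) x y" "prec (mirror n xs) y z"
    from p[OF h(2)] p[OF h(3)] have "prec xs (?f x) (?f y)" "prec xs (?f y) (?f z)"
      "?f x + ?f z = 2 * ?f y" using h(1) by auto
    then show False using F(4) by blast
  qed
  then show ?thesis using s d by (simp add: free_perms_iff)
qed

subsection \<open>Orientation of arithmetic progressions\<close>

text \<open>Each triple of neighbours in the progression with difference \<open>D\<close> reverses
  the orientation from one pair to the next, so an even number of steps restores it.\<close>

lemma prec_shift_even:
  assumes "xs \<in> free_perms n" "D > 0" "1 \<le> x" "x + (2 * j + 1) * D \<le> n"
  shows "prec xs x (x + D) \<longleftrightarrow> prec xs (x + 2 * j * D) (x + (2 * j + 1) * D)"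
  using assms(4)
proof (induction j)
  case (Suc j)
  let ?u = "x + 2 * j * D"
  note F = free_permsD[OF assms(1)]
  have e: "x + 2 * Suc j * D = ?u + 2 * D" "x + (2 * Suc j + 1) * D = ?u + 3 * D"
    "x + (2 * j + 1) * D = ?u + D"
    by (auto simp: algebra_simps)
  have b: "?u + 3 * D \<le> n" using Suc.prems e by simp
  have "prec xs x (x + D) \<longleftrightarrow> prec xs ?u (?u + D)"
    unfolding e(3)[symmetric] by (rule Suc.IH) (use b e(3) in linarith)
  also have "\<dots> \<longleftrightarrow> prec xs (?u + 2 * D) (?u + D)"
    by (rule free_perms_reflect[OF assms(1)]) (use assms b in auto)
  also have "\<dots> \<longleftrightarrow> \<not> prec xs (?u + D) (?u + 2 * D)"
    using prec_not[OF F(2)] F(1) assms b by auto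
  also have "\<dots> \<longleftrightarrow> \<not> prec xs (?u + 3 * D) (?u + 2 * D)"
    by (subst free_perms_reflect[OF assms(1), of "?u + D" "?u + 3 * D"]) (use assms b in auto)
  also have "\<dots> \<longleftrightarrow> prec xs (?u + 2 * D) (?u + 3 * D)"
    using prec_not[OF F(2)] F(1) assms b by auto
  finally show ?case by (simp only: e(1,2))
qed simp

text \<open>Suppose that \<open>w\<close> precedes its neighbours at one of the distances
  \<open>d\<close>, \<open>d + 2\<close> and follows those at the other; left and right agree
  because \<open>w\<close> is the centre. Then \<open>w\<close> stands between the inner and the
  outer neighbour on either side, so both outer neighbours precede their inner ones or both follow
  them. This contradicts the alternation along the progression with difference 2.\<close>

lemma prec_centre:
  assumes "xs \<in> free_perms n" "w \<ge> 1 + (2 * j + 1)" "w + (2 * j + 1) \<le> n"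
  shows "prec xs w (w + (2 * j + 1)) \<longleftrightarrow> prec xs w (w + 1)"
  using assms(2,3)
proof (induction j)
  case (Suc j)
  define d where "d = 2 * j + 1"
  note F = free_permsD[OF assms(1)]
  have prems: "w \<ge> 3 + d" "w + d + 2 \<le> n" "d > 0" using Suc.prems by (auto simp: d_def)
  have m: "w \<in> set xs" "w + d \<in> set xs" "w - d \<in> set xs" "w + (d + 2) \<in> set xs" "w - (d + 2) \<in> set xs"
    using prems F(1) by auto
  have sym: "prec xs w (w + e) \<longleftrightarrow> prec xs w (w - e)"
    if "e > 0" "w + e \<in> set xs" "w - e \<in> set xs" for e
  proof -
    have a: "w + e + (w - e) = 2 * w" "w + e \<noteq> w" "w - e \<noteq> w" using that F(1) by auto
    have "prec xs (w + e) w \<longleftrightarrow> prec xs (w - e) w"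
      using free_perms_reflect[OF assms(1) a(1,2)] that F(1) by auto
    then show ?thesis using prec_not[OF F(2), of "w + e" w]
        prec_not[OF F(2), of "w - e" w] m(1) that a by metis
  qed
  have s1: "prec xs w (w + (d + 2)) \<longleftrightarrow> prec xs w (w - (d + 2))" by (rule sym) (use m in auto)
  have s2: "prec xs w (w + d) \<longleftrightarrow> prec xs w (w - d)" by (rule sym) (use m prems in auto)
  let ?l = "w - (d + 2)"
  \<comment> \<open>The two ends of the progression lie in different classes modulo 4, so exactly one of them precedes its inner neighbour at distance 2.\<close>
  have "prec xs ?l (?l + 2) \<longleftrightarrow> prec xs (?l + 2 * (j + 1) * 2) (?l + (2 * (j + 1) + 1) * 2)"
    by (rule prec_shift_even[OF assms(1)]) (use prems d_def in auto)
  moreover have "?l + 2 = w - d" "?l + 2 * (j + 1) * 2 = w + d" "?l + (2 * (j + 1) + 1) * 2 = w + (d + 2)"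
    using prems d_def by auto
  ultimately have key: "prec xs ?l (w - d) \<longleftrightarrow> prec xs (w + d) (w + (d + 2))" by simp
  have ne: "?l \<noteq> w - d" "w \<noteq> w - d" "w \<noteq> ?l" using prems by auto
  have nk: "\<not> prec xs ?l (w - d) \<longleftrightarrow> prec xs (w - d) ?l"
    "\<not> prec xs (w + d) (w + (d + 2)) \<longleftrightarrow> prec xs (w + (d + 2)) (w + d)"
    "\<not> prec xs w (w + (d + 2)) \<longleftrightarrow> prec xs (w + (d + 2)) w"
    "\<not> prec xs w ?l \<longleftrightarrow> prec xs ?l w"
    "\<not> prec xs w (w + d) \<longleftrightarrow> prec xs (w + d) w"
    "\<not> prec xs w (w - d) \<longleftrightarrow> prec xs (w - d) w"
    by (rule prec_not[OF F(2)]; use m prems ne in simp)+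
  have "prec xs w (w + (d + 2)) \<longleftrightarrow> prec xs w (w + d)"
    using key nk s1 s2 prec_trans[OF F(2)] by metis
  also have "\<dots> \<longleftrightarrow> prec xs w (w + 1)" using Suc.IH Suc.prems by (auto simp: d_def)
  finally show ?case by (simp add: d_def)
qed simp

lemma prec_centre_both:
  assumes "xs \<in> free_perms n" "odd d" "d < w" "w + d \<le> n"
  shows "prec xs w (w + d) \<longleftrightarrow> prec xs w (w + 1)" "prec xs w (w - d) \<longleftrightarrow> prec xs w (w + 1)"
proof -
  note F = free_permsD[OF assms(1)]
  obtain j where j: "d = 2 * j + 1" using assms(2) by (elim oddE)
  show 1: "prec xs w (w + d) \<longleftrightarrow> prec xs w (w + 1)"
    unfolding j by (rule prec_centre[OF assms(1)]) (use assms j in auto)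
  have a: "w + d + (w - d) = 2 * w" "w + d \<noteq> w" "w - d \<noteq> w" "w + d \<in> {1..n}" "w - d \<in> {1..n}" "w \<in> {1..n}"
    using assms j by auto
  have "prec xs (w + d) w \<longleftrightarrow> prec xs (w - d) w"
    using free_perms_reflect[OF assms(1) a(1,2,4,5)] .
  then have "prec xs w (w + d) \<longleftrightarrow> prec xs w (w - d)"
    using prec_not[OF F(2), of "w + d" w] prec_not[OF F(2), of "w - d" w] a F(1) by metis
  with 1 show "prec xs w (w - d) \<longleftrightarrow> prec xs w (w + 1)" by simp
qed

text \<open>The orientation that reversal leaves free. It settles the order of all pairs of
  consecutive numbers: the odd one comes first.\<close>

definition odd_first :: "nat \<Rightarrow> nat list set" where
  "odd_first n = {xs \<in> free_perms n. prec xs 1 2}"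

lemma odd_firstD: "xs \<in> odd_first n \<Longrightarrow> xs \<in> free_perms n"
  by (simp add: odd_first_def)

lemma finite_odd_first [simp]: "finite (odd_first n)"
  by (simp add: odd_first_def)

lemma odd_first_Suc:
  assumes "xs \<in> odd_first n" "odd u" "u + 1 \<le> n"
  shows "prec xs u (u + 1)"
proof -
  obtain j where j: "u = 2 * j + 1" using assms(2) by (elim oddE)
  have "prec xs 1 (1 + 1) \<longleftrightarrow> prec xs (1 + 2 * j * 1) (1 + (2 * j + 1) * 1)"
    by (rule prec_shift_even[OF odd_firstD[OF assms(1)]]) (use assms j in auto)
  then show ?thesis using assms(1) j by (simp add: odd_first_def numeral_2_eq_2)
qed

lemma odd_first_pred:
  assumes "xs \<in> odd_first n" "odd u" "u > 1" "u \<le> n"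
  shows "prec xs u (u - 1)"
proof -
  have u: "u \<ge> 3" using assms(2,3) by presburger
  have "prec xs (u - 2) (u - 2 + 1)" by (rule odd_first_Suc[OF assms(1)]) (use assms u in auto)
  moreover have e: "u - 2 + 1 = u - 1" using u by simp
  moreover have "prec xs (u - 2) (u - 1) \<longleftrightarrow> prec xs u (u - 1)"
    by (rule free_perms_reflect[OF odd_firstD[OF assms(1)]]) (use assms u in auto)
  ultimately show ?thesis by simp
qed

text \<open>The inequalities say that reflecting either number in the other leaves the interval:
  neither is the middle of a progression in \<open>{1..n}\<close> that has the other as an outer
  term.\<close>

definition far :: "nat \<Rightarrow> nat \<Rightarrow> nat \<Rightarrow> bool" where
  "far n x y \<longleftrightarrow> (if x < y then 2 * x \<le> y \<and> n + x < 2 * y else 2 * y \<le> x \<and> n + y < 2 * x)"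

text \<open>If one of the two reflections stayed inside, the pair would be ordered like the centre
  of that reflection and its neighbour by \<open>prec_centre_both\<close>, and there the odd number
  comes first.\<close>

lemma far_inversion:
  assumes "xs \<in> odd_first n" "odd x" "even y" "prec xs y x"
  shows "far n x y"
proof -
  note xs = odd_firstD[OF assms(1)]
  note F = free_permsD[OF xs]
  have r: "x \<in> {1..n}" "y \<in> {1..n}" using prec_in_set[OF assms(4)] F(1) by auto
  have nxy: "\<not> prec xs x y" using prec_asym[OF F(2) assms(4)] .
  have ne: "x \<noteq> y" using assms by auto
  have cy: "\<not> prec xs y (y + 1)" if "y + 1 \<le> n"
    using odd_first_pred[OF assms(1), of "y + 1"] that assms r prec_asym[OF F(2)] by auto
  show ?thesis
  proof (cases "x < y")
    case True
    define d where "d = y - x"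
    have d: "odd d" "y = x + d" "x = y - d" using True assms by (auto simp: d_def)
    have "2 * x \<le> y"
    proof (rule ccontr)
      assume "\<not> 2 * x \<le> y"
      then have b: "d < x" "x + d \<le> n" "x + 1 \<le> n" using d(2) r True by auto
      have "prec xs x (x + d) \<longleftrightarrow> prec xs x (x + 1)"
        by (rule prec_centre_both(1)[OF xs d(1) b(1,2)])
      then show False using nxy odd_first_Suc[OF assms(1,2) b(3)] unfolding d(2)[symmetric] by blast
    qed
    moreover have "n + x < 2 * y"
    proof (rule ccontr)
      assume "\<not> n + x < 2 * y"
      then have b: "d < y" "y + d \<le> n" "y + 1 \<le> n" using d(2) r True by auto
      have "prec xs y (y - d) \<longleftrightarrow> prec xs y (y + 1)"
        by (rule prec_centre_both(2)[OF xs d(1) b(1,2)])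
      then show False using assms(4) cy[OF b(3)] unfolding d(3)[symmetric] by blast
    qed
    ultimately show ?thesis using True by (simp add: far_def)
  next
    case False
    define d where "d = x - y"
    have d: "odd d" "x = y + d" "y = x - d" "d > 0" using False ne assms by (auto simp: d_def)
    have "2 * y \<le> x"
    proof (rule ccontr)
      assume "\<not> 2 * y \<le> x"
      then have b: "d < y" "y + d \<le> n" "y + 1 \<le> n" using d(2,4) r by auto
      have "prec xs y (y + d) \<longleftrightarrow> prec xs y (y + 1)"
        by (rule prec_centre_both(1)[OF xs d(1) b(1,2)])
      then show False using assms(4) cy[OF b(3)] unfolding d(2)[symmetric] by blast
    qed
    moreover have "n + y < 2 * x"
    proof (rule ccontr)
      assume "\<not> n + y < 2 * x"
      then have b: "d < x" "x + d \<le> n" "x + 1 \<le> n" using d(2,4) r by auto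
      have "prec xs x (x - d) \<longleftrightarrow> prec xs x (x + 1)"
        by (rule prec_centre_both(2)[OF xs d(1) b(1,2)])
      then show False using nxy odd_first_Suc[OF assms(1,2) b(3)] unfolding d(3)[symmetric] by blast
    qed
    ultimately show ?thesis using False by (simp add: far_def)
  qed
qed

subsection \<open>Splitting by parity\<close>

definition odds :: "nat list \<Rightarrow> nat list" where
  "odds xs = map (\<lambda>p. 2 * p - 1) xs"

definition evens :: "nat list \<Rightarrow> nat list" where
  "evens xs = map (\<lambda>q. 2 * q) xs"

lemma set_odds: "set (odds xs) = (\<lambda>p. 2 * p - 1) ` set xs"
  by (simp add: odds_def)

lemma set_evens: "set (evens xs) = (\<lambda>q. 2 * q) ` set xs"
  by (simp add: evens_def)

lemma odds_image: "(\<lambda>p. 2 * p - 1) ` {1..(n + 1) div 2} = {x \<in> {1..n::nat}. odd x}"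
proof (intro equalityI subsetI)
  fix x assume "x \<in> {x \<in> {1..n}. odd x}"
  then show "x \<in> (\<lambda>p. 2 * p - 1) ` {1..(n + 1) div 2}"
    by (intro image_eqI[of _ _ "(x + 1) div 2"]) (auto elim!: oddE)
qed auto

lemma evens_image: "(\<lambda>q. 2 * q) ` {1..n div 2} = {x \<in> {1..n::nat}. even x}"
proof (intro equalityI subsetI)
  fix x assume "x \<in> {x \<in> {1..n}. even x}"
  then show "x \<in> (\<lambda>q. 2 * q) ` {1..n div 2}"
    by (intro image_eqI[of _ _ "x div 2"]) (auto elim!: evenE)
qed auto

lemma free_perms_affine:
  fixes f :: "nat \<Rightarrow> nat"
  assumes "distinct xs" "inj_on f (set xs)"
    "\<And>x y z. x \<in> set xs \<Longrightarrow> y \<in> set xs \<Longrightarrow> z \<in> set xs \<Longrightarrow> f x + f z = 2 * f y \<longleftrightarrow> x + z = 2 * y"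
  shows "three_free (map f xs) \<longleftrightarrow> three_free xs"
proof -
  have d: "distinct (map f xs)" using assms by (simp add: distinct_map)
  have p: "\<exists>u v. prec xs u v \<and> x = f u \<and> y = f v" if h: "prec (map f xs) x y" for x y
  proof -
    obtain u v where "u \<in> set xs" "v \<in> set xs" "x = f u" "y = f v"
      using prec_in_set[OF h] by auto
    then show ?thesis using h prec_map[OF assms(2)] by auto
  qed
  show ?thesis
  proof
    assume tf: "three_free (map f xs)"
    show "three_free xs"
      unfolding three_free_iff[OF assms(1)]
    proof (intro allI impI notI)
      fix x y z assume h: "x + z = 2 * y" "prec xs x y" "prec xs y z"
      then have "x \<in> set xs" "y \<in> set xs" "z \<in> set xs" by (auto dest: prec_in_set)
      with h have "prec (map f xs) (f x) (f y)" "prec (map f xs) (f y) (f z)" "f x + f z = 2 * f y"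
        using prec_map[OF assms(2)] assms(3) by auto
      then show False using tf unfolding three_free_iff[OF d] by blast
    qed
  next
    assume tf: "three_free xs"
    show "three_free (map f xs)"
      unfolding three_free_iff[OF d]
    proof (intro allI impI notI)
      fix x y z assume h: "x + z = 2 * y" "prec (map f xs) x y" "prec (map f xs) y z"
      obtain u v where u: "prec xs u v" "x = f u" "y = f v" using p[OF h(2)] by blast
      obtain v' w where w: "prec xs v' w" "y = f v'" "z = f w" using p[OF h(3)] by blast
      have m: "u \<in> set xs" "v \<in> set xs" "v' \<in> set xs" "w \<in> set xs"
        using u w prec_in_set by metis+
      have v: "v' = v" using assms(2) u w m by (auto dest: inj_onD)
      have "u + w = 2 * v" using assms(3) m h u w v by auto
      then show False using tf u w v unfolding three_free_iff[OF assms(1)] by blast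
    qed
  qed
qed

lemma odds_free_perms:
  assumes "set xs = {1..m}" "distinct xs"
  shows "three_free (odds xs) \<longleftrightarrow> xs \<in> free_perms m" "distinct (odds xs)"
proof -
  have i: "inj_on (\<lambda>p. 2 * p - 1::nat) (set xs)" unfolding assms(1) by (rule inj_onI) auto
  have "three_free (odds xs) \<longleftrightarrow> three_free xs"
    unfolding odds_def by (rule free_perms_affine[OF assms(2) i]) (use assms(1) in auto)
  then show "three_free (odds xs) \<longleftrightarrow> xs \<in> free_perms m"
    using assms by (auto simp: free_perms_iff)
  show "distinct (odds xs)" using assms i by (simp add: odds_def distinct_map)
qed

lemma evens_free_perms:
  assumes "set xs = {1..m}" "distinct xs"
  shows "three_free (evens xs) \<longleftrightarrow> xs \<in> free_perms m" "distinct (evens xs)"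
proof -
  have i: "inj_on (\<lambda>p. 2 * p::nat) (set xs)" by (rule inj_onI) auto
  have "three_free (evens xs) \<longleftrightarrow> three_free xs"
    unfolding evens_def by (rule free_perms_affine[OF assms(2) i]) auto
  then show "three_free (evens xs) \<longleftrightarrow> xs \<in> free_perms m"
    using assms by (auto simp: free_perms_iff)
  show "distinct (evens xs)" using assms i by (simp add: evens_def distinct_map)
qed

lemma three_free_filter:
  assumes "distinct xs" "three_free xs"
  shows "three_free (filter P xs)"
  using assms by (simp add: three_free_iff prec_filter)

lemma filter_odd_free_perms:
  assumes "xs \<in> free_perms n"
  obtains p where "p \<in> free_perms ((n + 1) div 2)" "filter odd xs = odds p"
proof
  note F = free_permsD[OF assms]
  let ?p = "map (\<lambda>x. (x + 1) div 2) (filter odd xs)"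
  show e: "filter odd xs = odds ?p"
    unfolding odds_def map_map by (rule map_idI[symmetric]) (auto elim!: oddE)
  have d: "distinct ?p" using F(2) by (auto simp: distinct_map inj_on_def elim!: oddE)
  have "set (odds ?p) = {x \<in> {1..n}. odd x}" unfolding e[symmetric] using F(1) by simp
  then have "(\<lambda>p. 2 * p - 1) ` set ?p = (\<lambda>p. 2 * p - 1) ` {1..(n + 1) div 2}"
    unfolding odds_image set_odds .
  moreover have "inj_on (\<lambda>p::nat. 2 * p - 1) (set ?p \<union> {1..(n + 1) div 2})"
    by (rule inj_onI) (auto elim!: oddE)
  ultimately have s: "set ?p = {1..(n + 1) div 2}"
    by (metis inj_on_Un_image_eq_iff)
  show "?p \<in> free_perms ((n + 1) div 2)"
    using odds_free_perms(1)[OF s d] e three_free_filter[of xs odd] assms F(2) by (simp add: free_perms_iff)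
qed

lemma filter_even_free_perms:
  assumes "xs \<in> free_perms n"
  obtains q where "q \<in> free_perms (n div 2)" "filter even xs = evens q"
proof
  note F = free_permsD[OF assms]
  let ?p = "map (\<lambda>x. x div 2) (filter even xs)"
  show e: "filter even xs = evens ?p"
    unfolding evens_def map_map by (rule map_idI[symmetric]) (auto elim!: evenE)
  have d: "distinct ?p" using F(2) by (auto simp: distinct_map inj_on_def elim!: evenE)
  have "set (evens ?p) = {x \<in> {1..n}. even x}" unfolding e[symmetric] using F(1) by simp
  then have "(\<lambda>p. 2 * p) ` set ?p = (\<lambda>p. 2 * p) ` {1..n div 2}"
    unfolding evens_image set_evens .
  moreover have "inj_on (\<lambda>p::nat. 2 * p) (set ?p \<union> {1..n div 2})"
    by (rule inj_onI) auto
  ultimately have s: "set ?p = {1..n div 2}"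
    by (metis inj_on_Un_image_eq_iff)
  show "?p \<in> free_perms (n div 2)"
    using evens_free_perms(1)[OF s d] e three_free_filter[of xs even] assms F(2) by (simp add: free_perms_iff)
qed

text \<open>Converse to \<open>far_inversion\<close>. In a progression of mixed parity the outer
  terms share a parity and the middle has the other one. If the three occur in progression order,
  then the middle and one outer term form a pair with the even number first, and such a pair is
  never far.\<close>

lemma odd_firstI:
  assumes "set xs = {1..n}" "distinct xs" "n \<ge> 3"
    "p \<in> free_perms ((n + 1) div 2)" "filter odd xs = odds p"
    "q \<in> free_perms (n div 2)" "filter even xs = evens q"
    and far: "\<And>x y. odd x \<Longrightarrow> even y \<Longrightarrow> prec xs y x \<Longrightarrow> far n x y"
  shows "xs \<in> odd_first n"
proof -
  have "three_free (filter odd xs)" "three_free (filter even xs)"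
    using assms(4-7) odds_free_perms(1)[of p] evens_free_perms(1)[of q] by (auto simp: free_perms_iff)
  then have o: "\<And>x y z. x + z = 2 * y \<Longrightarrow> prec xs x y \<Longrightarrow> prec xs y z \<Longrightarrow> odd x \<Longrightarrow> odd y \<Longrightarrow> odd z \<Longrightarrow> False"
    and e: "\<And>x y z. x + z = 2 * y \<Longrightarrow> prec xs x y \<Longrightarrow> prec xs y z \<Longrightarrow> even x \<Longrightarrow> even y \<Longrightarrow> even z \<Longrightarrow> False"
    using assms(2) by (auto simp: three_free_iff prec_filter)
  have "three_free xs"
    unfolding three_free_iff[OF assms(2)]
  proof (intro allI impI notI)
    fix x y z assume h: "x + z = 2 * y" "prec xs x y" "prec xs y z"
    have r: "x \<in> {1..n}" "y \<in> {1..n}" "z \<in> {1..n}" using prec_in_set h assms(1) by metis+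
    have par: "odd x \<longleftrightarrow> odd z" using h(1) by presburger
    show False
    proof (cases "odd y")
      case True
      then have "even x" using o h par by blast
      then have "far n y x" using far True h by blast
      then show False using h(1) r by (auto simp: far_def split: if_splits)
    next
      case False
      then have "odd z" using e h par by blast
      then have "far n z y" using far False h by blast
      then show False using h(1) r by (auto simp: far_def split: if_splits)
    qed
  qed
  then have "xs \<in> free_perms n" using assms by (simp add: free_perms_iff)
  moreover have "prec xs 1 2 \<or> prec xs 2 1" by (rule prec_total) (use assms in auto)
  \<comment> \<open>Being far would require \<open>n + 1 < 4\<close>; this is where
    \<open>n \<ge> 3\<close> enters.\<close>
  moreover have "\<not> far n 1 2" using assms(3) by (simp add: far_def)
  ultimately show ?thesis using far[of 1 2] by (auto simp: odd_first_def)
qed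

subsection \<open>Runs\<close>

lemma prec_take:
  assumes "distinct xs" "prec xs y x" "x \<in> set (take j xs)"
  shows "y \<in> set (take j xs)"
proof -
  have "prec (take j xs @ drop j xs) y x" using assms(2) by (simp only: append_take_drop_id)
  moreover have "x \<notin> set (drop j xs)" using assms by (metis append_take_drop_id disjoint_iff distinct_append)
  ultimately show ?thesis unfolding prec_append by (auto dest: prec_in_set)
qed

lemma prec_hd: "xs \<noteq> [] \<Longrightarrow> x \<in> set xs \<Longrightarrow> x \<noteq> hd xs \<Longrightarrow> prec xs (hd xs) x"
  by (cases xs) auto

text \<open>Let \<open>u\<close> be the largest element of the prefix above the head. As
  \<open>u\<close> lies in the lower half, the reflection of the head in \<open>u\<close> is still
  in the interval. It precedes \<open>u\<close> because the head does, so it belongs to the prefix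
  and exceeds \<open>u\<close>.\<close>

lemma low_prefix:
  assumes "xs \<in> free_perms n" "\<forall>x \<in> set (take j xs). 2 * x \<le> n + 1" "x \<in> set (take j xs)"
  shows "x \<le> hd xs"
proof (rule ccontr)
  assume h: "\<not> x \<le> hd xs"
  note F = free_permsD[OF assms(1)]
  let ?S = "{x \<in> set (take j xs). x > hd xs}"
  have S: "finite ?S" "x \<in> ?S" using h assms by auto
  define u where "u = Max ?S"
  have u: "u \<in> ?S" "\<And>v. v \<in> ?S \<Longrightarrow> v \<le> u" using Max_in[OF S(1)] S Max_ge[OF S(1)] by (auto simp: u_def)
  have hd: "hd xs \<in> {1..n}" using assms(3) F(1) by (metis hd_in_set in_set_takeD list.set_cases list.distinct(1))
  have un: "u \<in> {1..n}" using u F(1) in_set_takeD by fastforce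
  have "xs \<noteq> []" using assms(3) by auto
  then have p: "prec xs (hd xs) u" using prec_hd[of xs u] u un F(1) by auto
  let ?z = "2 * u - hd xs"
  have le: "2 * u \<le> n + 1" "hd xs < u" using u assms(2) by auto
  have "prec xs (hd xs) u \<longleftrightarrow> prec xs ?z u"
    by (rule free_perms_reflect[OF assms(1)]) (use u hd un le in auto)
  then have "prec xs ?z u" using p by simp
  then have "?z \<in> ?S" using prec_take[OF F(2)] u by auto
  then have "?z \<le> u" by (rule u(2))
  then show False using u by auto
qed

lemma high_prefix:
  assumes "xs \<in> free_perms n" "\<forall>x \<in> set (take j xs). n + 1 \<le> 2 * x" "x \<in> set (take j xs)"
  shows "hd xs \<le> x"
proof -
  note F = free_permsD[OF assms(1)]
  have s: "set (take j xs) \<subseteq> {1..n}" using F(1) set_take_subset by metis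
  have m: "mirror n xs \<in> free_perms n" by (rule mirror_free_perms[OF assms(1)])
  have t: "take j (mirror n xs) = mirror n (take j xs)" by (simp add: mirror_def take_map)
  have "n + 1 - x \<le> hd (mirror n xs)"
  proof (rule low_prefix[OF m])
    show "\<forall>x\<in>set (take j (mirror n xs)). 2 * x \<le> n + 1"
      unfolding t using assms(2) by (auto simp: mirror_def)
    show "n + 1 - x \<in> set (take j (mirror n xs))"
      unfolding t using assms(3) by (auto simp: mirror_def)
  qed
  moreover have "hd (mirror n xs) = n + 1 - hd xs" using assms(3) by (cases xs) (auto simp: mirror_def)
  moreover have "x \<in> {1..n}" using s assms(3) by auto
  ultimately show ?thesis by auto
qed

text \<open>\<open>X\<close> and \<open>Y\<close> stand for the odd and the even elements in their
  order. An element of \<open>X\<close> that is overtaken at all is also overtaken by the head of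
  \<open>Y\<close>, so comparison with this head delimits the final segment of \<open>X\<close> that
  can take part in a shuffle. Symmetrically, the last element of \<open>X\<close> delimits the
  initial segment \<open>core_r\<close> of \<open>Y\<close>.\<close>

definition core_l :: "nat \<Rightarrow> nat list \<Rightarrow> nat list \<Rightarrow> nat list" where
  "core_l n X Y = rev (takeWhile (\<lambda>x. far n x (hd Y)) (rev X))"

definition rest_l :: "nat \<Rightarrow> nat list \<Rightarrow> nat list \<Rightarrow> nat list" where
  "rest_l n X Y = rev (dropWhile (\<lambda>x. far n x (hd Y)) (rev X))"

definition core_r :: "nat \<Rightarrow> nat list \<Rightarrow> nat list \<Rightarrow> nat list" where
  "core_r n X Y = takeWhile (far n (last X)) Y"

definition rest_r :: "nat \<Rightarrow> nat list \<Rightarrow> nat list \<Rightarrow> nat list" where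
  "rest_r n X Y = dropWhile (far n (last X)) Y"

lemma rest_core_l: "rest_l n X Y @ core_l n X Y = X"
  unfolding rest_l_def core_l_def rev_append[symmetric] by simp

lemma core_rest_r: "core_r n X Y @ rest_r n X Y = Y"
  unfolding rest_r_def core_r_def by simp

lemma takeWhile_eqI:
  "(\<And>x. x \<in> set (takeWhile R xs) \<Longrightarrow> Q x) \<Longrightarrow> (\<And>x. x \<in> set xs \<Longrightarrow> Q x \<Longrightarrow> R x) \<Longrightarrow> takeWhile R xs = takeWhile Q xs"
proof (induction xs)
  case (Cons a xs)
  then show ?case by (cases "R a") auto
qed simp

text \<open>By \<open>low_prefix\<close> all such conditions \<open>R\<close> cut off the same run.
  One number attached to the permutation therefore serves for every possible partner.\<close>

lemma takeWhile_low:
  assumes "xs \<in> free_perms n" "\<And>x. x \<in> set xs \<Longrightarrow> R x \<Longrightarrow> 2 * x \<le> n + 1" "\<And>x. x \<in> set xs \<Longrightarrow> x \<le> hd xs \<Longrightarrow> R x"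
  shows "takeWhile R xs = takeWhile (\<lambda>x. x \<le> hd xs) xs"
proof (rule takeWhile_eqI)
  fix x assume x: "x \<in> set (takeWhile R xs)"
  have "takeWhile R xs = take (length (takeWhile R xs)) xs" by (rule takeWhile_eq_take)
  then show "x \<le> hd xs"
    using low_prefix[OF assms(1), of "length (takeWhile R xs)" x] x assms(2) set_takeWhileD by metis
qed (use assms in auto)

lemma takeWhile_high:
  assumes "xs \<in> free_perms n" "\<And>x. x \<in> set xs \<Longrightarrow> R x \<Longrightarrow> n + 1 \<le> 2 * x" "\<And>x. x \<in> set xs \<Longrightarrow> hd xs \<le> x \<Longrightarrow> R x"
  shows "takeWhile R xs = takeWhile (\<lambda>x. hd xs \<le> x) xs"
proof (rule takeWhile_eqI)
  fix x assume x: "x \<in> set (takeWhile R xs)"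
  have "takeWhile R xs = take (length (takeWhile R xs)) xs" by (rule takeWhile_eq_take)
  then show "hd xs \<le> x"
    using high_prefix[OF assms(1), of "length (takeWhile R xs)" x] x assms(2) set_takeWhileD by metis
qed (use assms in auto)

lemma hd_rev_odds: "p \<noteq> [] \<Longrightarrow> last (odds p) = 2 * last p - 1"
  by (simp add: odds_def last_map)

lemma hd_evens: "q \<noteq> [] \<Longrightarrow> hd (evens q) = 2 * hd q"
  by (simp add: evens_def hd_map)

lemma rev_odds: "rev (odds p) = odds (rev p)"
  by (simp add: odds_def rev_map)

lemma takeWhile_odds: "takeWhile R (odds xs) = odds (takeWhile (\<lambda>x. R (2 * x - 1)) xs)"
  by (simp add: odds_def takeWhile_map o_def)

lemma takeWhile_evens: "takeWhile R (evens xs) = evens (takeWhile (\<lambda>x. R (2 * x)) xs)"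
  by (simp add: evens_def takeWhile_map o_def)

lemma free_perms_Nil: "xs \<in> free_perms n \<Longrightarrow> n > 0 \<Longrightarrow> xs \<noteq> []"
  using free_permsD(1) by fastforce

context
  fixes n :: nat and p q :: "nat list"
  assumes p: "p \<in> free_perms ((n + 1) div 2)" and q: "q \<in> free_perms (n div 2)" and n: "n \<ge> 2"
begin

lemma pq_props: "p \<noteq> []" "q \<noteq> []" "last p \<in> {1..(n + 1) div 2}" "hd q \<in> {1..n div 2}"
  "set p = {1..(n + 1) div 2}" "set q = {1..n div 2}"
proof -
  show pn: "p \<noteq> []" "q \<noteq> []" using free_perms_Nil p q n by auto
  show s: "set p = {1..(n + 1) div 2}" "set q = {1..n div 2}" using p q free_permsD(1) by auto
  show "last p \<in> {1..(n + 1) div 2}" "hd q \<in> {1..n div 2}"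
    using pn s last_in_set hd_in_set by blast+
qed

text \<open>Being far from a fixed larger partner confines an element to the lower half and is
  inherited by smaller elements, so \<open>takeWhile_low\<close> applies;
  \<open>takeWhile_high\<close> does the same for the other block.\<close>

lemma core_low:
  assumes f: "far n (2 * last p - 1) (2 * hd q)" and less: "2 * last p - 1 < 2 * hd q"
  shows "core_l n (odds p) (evens q) = rev (odds (takeWhile (\<lambda>x. x \<le> last p) (rev p)))"
    "core_r n (odds p) (evens q) = evens (takeWhile (\<lambda>y. hd q \<le> y) q)"
proof -
  note pq = pq_props
  have far1: "2 * (2 * last p - 1) \<le> 2 * hd q" "n + (2 * last p - 1) < 2 * (2 * hd q)"
    using f less by (auto simp: far_def)
  have hr: "hd (rev p) = last p" by (simp add: hd_rev)
  have "takeWhile (\<lambda>x. far n (2 * x - 1) (2 * hd q)) (rev p) = takeWhile (\<lambda>x. x \<le> hd (rev p)) (rev p)"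
  proof (rule takeWhile_low[OF rev_free_perms[OF p]])
    fix x assume "x \<in> set (rev p)" "far n (2 * x - 1) (2 * hd q)"
    then show "2 * x \<le> (n + 1) div 2 + 1" using far1 pq by (auto simp: far_def split: if_splits)
  next
    fix x assume "x \<in> set (rev p)" "x \<le> hd (rev p)"
    then show "far n (2 * x - 1) (2 * hd q)" using far1 pq less by (auto simp: far_def hr)
  qed
  then show "core_l n (odds p) (evens q) = rev (odds (takeWhile (\<lambda>x. x \<le> last p) (rev p)))"
    by (simp add: core_l_def rev_odds hd_evens[OF pq(2)] takeWhile_odds hr)
  have "takeWhile (\<lambda>y. far n (2 * last p - 1) (2 * y)) q = takeWhile (\<lambda>y. hd q \<le> y) q"
  proof (rule takeWhile_high[OF q])
    fix y assume "y \<in> set q" "far n (2 * last p - 1) (2 * y)"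
    then show "n div 2 + 1 \<le> 2 * y" using far1 pq by (auto simp: far_def split: if_splits)
  next
    fix y assume "y \<in> set q" "hd q \<le> y"
    then show "far n (2 * last p - 1) (2 * y)" using far1 pq less by (auto simp: far_def)
  qed
  then show "core_r n (odds p) (evens q) = evens (takeWhile (\<lambda>y. hd q \<le> y) q)"
    by (simp add: core_r_def hd_rev_odds[OF pq(1)] takeWhile_evens)
qed

lemma core_high:
  assumes f: "far n (2 * last p - 1) (2 * hd q)" and less: "2 * hd q < 2 * last p - 1"
  shows "core_l n (odds p) (evens q) = rev (odds (takeWhile (\<lambda>x. last p \<le> x) (rev p)))"
    "core_r n (odds p) (evens q) = evens (takeWhile (\<lambda>y. y \<le> hd q) q)"
proof -
  note pq = pq_props
  have far1: "2 * (2 * hd q) \<le> 2 * last p - 1" "n + 2 * hd q < 2 * (2 * last p - 1)"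
    using f less by (auto simp: far_def)
  have hr: "hd (rev p) = last p" by (simp add: hd_rev)
  have "takeWhile (\<lambda>x. far n (2 * x - 1) (2 * hd q)) (rev p) = takeWhile (\<lambda>x. hd (rev p) \<le> x) (rev p)"
  proof (rule takeWhile_high[OF rev_free_perms[OF p]])
    fix x assume "x \<in> set (rev p)" "far n (2 * x - 1) (2 * hd q)"
    then show "(n + 1) div 2 + 1 \<le> 2 * x" using far1 pq by (auto simp: far_def split: if_splits)
  next
    fix x assume "x \<in> set (rev p)" "hd (rev p) \<le> x"
    then show "far n (2 * x - 1) (2 * hd q)" using far1 pq less by (auto simp: far_def hr)
  qed
  then show "core_l n (odds p) (evens q) = rev (odds (takeWhile (\<lambda>x. last p \<le> x) (rev p)))"
    by (simp add: core_l_def rev_odds hd_evens[OF pq(2)] takeWhile_odds hr)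
  have "takeWhile (\<lambda>y. far n (2 * last p - 1) (2 * y)) q = takeWhile (\<lambda>y. y \<le> hd q) q"
  proof (rule takeWhile_low[OF q])
    fix y assume "y \<in> set q" "far n (2 * last p - 1) (2 * y)"
    then show "2 * y \<le> n div 2 + 1" using far1 pq by (auto simp: far_def split: if_splits)
  next
    fix y assume "y \<in> set q" "y \<le> hd q"
    then show "far n (2 * last p - 1) (2 * y)" using far1 pq less by (auto simp: far_def)
  qed
  then show "core_r n (odds p) (evens q) = evens (takeWhile (\<lambda>y. y \<le> hd q) q)"
    by (simp add: core_r_def hd_rev_odds[OF pq(1)] takeWhile_evens)
qed

lemma core_none:
  assumes "\<not> far n (2 * last p - 1) (2 * hd q)"
  shows "core_l n (odds p) (evens q) = []" "core_r n (odds p) (evens q) = []"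
proof -
  note pq = pq_props
  have "hd (rev (odds p)) = 2 * last p - 1" using pq by (simp add: hd_rev hd_rev_odds)
  moreover have "rev (odds p) \<noteq> []" using pq by (simp add: odds_def)
  ultimately obtain t where "rev (odds p) = (2 * last p - 1) # t" by (metis list.collapse)
  then show "core_l n (odds p) (evens q) = []" using assms pq by (simp add: core_l_def hd_evens)
  obtain t where "evens q = (2 * hd q) # t" using pq by (cases q) (auto simp: evens_def)
  then show "core_r n (odds p) (evens q) = []" using assms pq by (simp add: core_r_def hd_rev_odds)
qed

text \<open>The cores are defined by comparison with a single element each, but as runs they are at
  least as extreme as \<open>last p\<close> and \<open>hd q\<close>. Hence all pairs are far, and
  every shuffle of the two cores is admissible.\<close>

lemma core_far:
  assumes x: "x \<in> set (core_l n (odds p) (evens q))" and y: "y \<in> set (core_r n (odds p) (evens q))"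
  shows "far n x y"
proof -
  note pq = pq_props
  have f: "far n (2 * last p - 1) (2 * hd q)"
    by (rule ccontr) (use core_none(1) x in simp)
  have ne: "2 * last p - 1 \<noteq> 2 * hd q" using pq by auto presburger
  show ?thesis
  proof (cases "2 * last p - 1 < 2 * hd q")
    case True
    obtain u where u: "x = 2 * u - 1" "u \<le> last p"
      using x unfolding core_low(1)[OF f True] by (auto simp: odds_def dest: set_takeWhileD)
    obtain v where v: "y = 2 * v" "hd q \<le> v"
      using y unfolding core_low(2)[OF f True] by (auto simp: evens_def dest: set_takeWhileD)
    show ?thesis using u v f True by (auto simp: far_def)
  next
    case False
    then have less: "2 * hd q < 2 * last p - 1" using ne by simp
    obtain u where u: "x = 2 * u - 1" "last p \<le> u"
      using x unfolding core_high(1)[OF f less] by (auto simp: odds_def dest: set_takeWhileD)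
    obtain v where v: "y = 2 * v" "v \<le> hd q"
      using y unfolding core_high(2)[OF f less] by (auto simp: evens_def dest: set_takeWhileD)
    show ?thesis using u v f less by (auto simp: far_def)
  qed
qed

end

section \<open>Reassembling a permutation from its parity classes\<close>

definition weave :: "nat \<Rightarrow> nat list \<Rightarrow> nat list \<Rightarrow> nat list \<Rightarrow> nat list" where
  "weave n X Y w = rest_l n X Y @ w @ rest_r n X Y"

definition core :: "nat \<Rightarrow> nat list \<Rightarrow> nat list \<Rightarrow> nat list set" where
  "core n X Y = shuffles (core_l n X Y) (core_r n X Y)"

lemma filter_weave:
  assumes "\<And>x. x \<in> set X \<Longrightarrow> P x" "\<And>y. y \<in> set Y \<Longrightarrow> \<not> P y" "w \<in> core n X Y"
  shows "filter P (weave n X Y w) = X" "filter (\<lambda>x. \<not> P x) (weave n X Y w) = Y"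
    "filter P w = core_l n X Y" "filter (\<lambda>x. \<not> P x) w = core_r n X Y"
proof -
  have s: "set X = set (rest_l n X Y) \<union> set (core_l n X Y)" "set Y = set (core_r n X Y) \<union> set (rest_r n X Y)"
    using rest_core_l[of n X Y] core_rest_r[of n X Y] by (metis set_append)+
  have w: "w \<in> shuffles (core_l n X Y) (core_r n X Y)" using assms(3) by (simp add: core_def)
  have f1: "filter P (core_l n X Y) = core_l n X Y" "filter P (core_r n X Y) = []"
    "filter P (rest_l n X Y) = rest_l n X Y" "filter P (rest_r n X Y) = []"
    using assms(1,2) s by (auto simp: filter_id_conv filter_empty_conv)
  have f2: "filter (\<lambda>x. \<not> P x) (core_l n X Y) = []" "filter (\<lambda>x. \<not> P x) (core_r n X Y) = core_r n X Y"
    "filter (\<lambda>x. \<not> P x) (rest_l n X Y) = []" "filter (\<lambda>x. \<not> P x) (rest_r n X Y) = rest_r n X Y"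
    using assms(1,2) s by (auto simp: filter_id_conv filter_empty_conv)
  have "filter P w \<in> filter P ` shuffles (core_l n X Y) (core_r n X Y)" using w by blast
  then show 1: "filter P w = core_l n X Y" unfolding filter_shuffles f1 by simp
  have "filter (\<lambda>x. \<not> P x) w \<in> filter (\<lambda>x. \<not> P x) ` shuffles (core_l n X Y) (core_r n X Y)" using w by blast
  then show 2: "filter (\<lambda>x. \<not> P x) w = core_r n X Y" unfolding filter_shuffles f2 by simp
  show "filter P (weave n X Y w) = X" "filter (\<lambda>x. \<not> P x) (weave n X Y w) = Y"
    by (simp_all add: weave_def f1 f2 1 2 rest_core_l core_rest_r)
qed

text \<open>Isolates the part in front of the shuffle: a list that began with an element outside
  \<open>P\<close> would have it before the first element of \<open>U\<close>.\<close>

lemma split_prefix: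
  assumes "distinct xs" "filter P xs = U @ Z" "\<And>u y. u \<in> set U \<Longrightarrow> y \<in> set xs \<Longrightarrow> \<not> P y \<Longrightarrow> prec xs u y"
  shows "\<exists>ys. xs = U @ ys"
  using assms
proof (induction U arbitrary: xs)
  case (Cons u U)
  have "u \<in> set (filter P xs)" using Cons.prems(2) by simp
  then have "u \<in> set xs" by simp
  then obtain h t where xs: "xs = h # t" by (cases xs) auto
  have "P h"
  proof (rule ccontr)
    assume "\<not> P h"
    then have "prec xs u h" using Cons.prems(3)[of u h] xs by auto
    then show False using xs Cons.prems(1) by (auto dest: prec_in_set)
  qed
  then have u: "h = u" "filter P t = U @ Z" using Cons.prems(2) xs by auto
  have "\<exists>ys. t = U @ ys"
  proof (rule Cons.IH)
    fix v y assume v: "v \<in> set U" "y \<in> set t" "\<not> P y"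
    have "v \<in> set t" using v(1) u(2) by (metis filter_is_subset in_mono in_set_conv_decomp append_assoc append_Cons set_append UnI1)
    then have "v \<noteq> u" using Cons.prems(1) xs u(1) by auto
    then show "prec t v y" using Cons.prems(3)[of v y] v xs u(1) by auto
  qed (use Cons.prems xs u in auto)
  then show ?case using xs u by auto
qed simp

lemma split_suffix:
  assumes "distinct xs" "filter P xs = Z @ V" "\<And>v x. v \<in> set V \<Longrightarrow> x \<in> set xs \<Longrightarrow> \<not> P x \<Longrightarrow> prec xs x v"
  shows "\<exists>ys. xs = ys @ V"
proof -
  have "\<exists>ys. rev xs = rev V @ ys"
  proof (rule split_prefix[where P = P and Z = "rev Z"])
    show "filter P (rev xs) = rev V @ rev Z" using assms(2) by (simp add: rev_filter[symmetric])
  qed (use assms in \<open>auto simp: prec_rev\<close>)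
  then show ?thesis by (metis rev_append rev_rev_ident)
qed

text \<open>The witness is the element at which \<open>takeWhile\<close> stops.\<close>

lemma prec_in_rev_takeWhile:
  assumes "distinct X" "x \<in> set X" "x \<notin> set (takeWhile R X)"
  obtains z where "z = x \<or> prec X z x" "z \<in> set X" "\<not> R z"
proof -
  have "x \<in> set (dropWhile R X)" using assms by (metis UnE set_append takeWhile_dropWhile_id)
  then obtain z t where d: "dropWhile R X = z # t" by (cases "dropWhile R X") auto
  have "\<not> R z" using d by (metis hd_dropWhile list.sel(1) list.distinct(1))
  moreover have "X = takeWhile R X @ z # t" using d by (metis takeWhile_dropWhile_id)
  moreover have "x = z \<or> x \<in> set t" using \<open>x \<in> set (dropWhile R X)\<close> d by auto
  ultimately show ?thesis using that[of z] by (metis in_set_conv_decomp prec.simps(2) prec_append)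
qed

text \<open>If an even element preceded some \<open>u\<close> in \<open>rest_l\<close>, then the
  first even element would precede \<open>u\<close>, and with it the element \<open>z\<close> that
  ended the core. But \<open>z\<close> is not far from that even element, contrary to
  \<open>far_inversion\<close>. The same holds for \<open>rest_r\<close>, so only the cores
  mix.\<close>

lemma odd_first_is_weave:
  assumes xs: "xs \<in> odd_first n" and p: "p \<in> free_perms ((n + 1) div 2)" "filter odd xs = odds p"
    and q: "q \<in> free_perms (n div 2)" "filter even xs = evens q" and n: "n \<ge> 2"
  shows "\<exists>w \<in> core n (odds p) (evens q). xs = weave n (odds p) (evens q) w"
proof -
  note F = free_permsD[OF odd_firstD[OF xs]]
  note pq = pq_props[OF p(1) q(1) n]
  let ?X = "odds p" and ?Y = "evens q"
  have dX: "distinct ?X" "distinct ?Y" using F(2) p q by (metis distinct_filter)+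
  have oX: "\<And>x. x \<in> set ?X \<longleftrightarrow> x \<in> set xs \<and> odd x" "\<And>x. x \<in> set ?Y \<longleftrightarrow> x \<in> set xs \<and> even x"
    unfolding p(2)[symmetric] q(2)[symmetric] by auto
  have pX: "\<And>x y. prec ?X x y \<longleftrightarrow> odd x \<and> odd y \<and> prec xs x y" "\<And>x y. prec ?Y x y \<longleftrightarrow> even x \<and> even y \<and> prec xs x y"
    unfolding p(2)[symmetric] q(2)[symmetric] by (auto simp: prec_filter)
  have ne: "?X \<noteq> []" "?Y \<noteq> []" using pq by (auto simp: odds_def evens_def)
  have hY: "hd ?Y \<in> set ?Y" "last ?X \<in> set ?X" using ne by auto
  have hdY: "y = hd ?Y \<or> prec xs (hd ?Y) y" if "y \<in> set ?Y" for y
    using prec_hd[OF ne(2) that] pX by auto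
  have laX: "x = last ?X \<or> prec xs x (last ?X)" if "x \<in> set ?X" for x
  proof -
    have "x = last ?X \<or> prec (rev ?X) (hd (rev ?X)) x"
      using prec_hd[of "rev ?X" x] ne that by (auto simp: hd_rev)
    then show ?thesis using pX by (auto simp: prec_rev hd_rev)
  qed
  have U: "prec xs u y" if u: "u \<in> set (rest_l n ?X ?Y)" and y: "y \<in> set xs" "\<not> odd y" for u y
  proof (rule ccontr)
    assume nu: "\<not> prec xs u y"
    have uX: "u \<in> set ?X" using u rest_core_l[of n ?X ?Y] by (metis UnI1 set_append)
    have yY: "y \<in> set ?Y" using y oX by auto
    have yu: "prec xs y u" using nu prec_total[of u xs y] uX yY oX by auto
    then have h: "prec xs (hd ?Y) u" using hdY[OF yY] prec_trans[OF F(2)] by auto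
    have "u \<notin> set (takeWhile (\<lambda>x. far n x (hd ?Y)) (rev ?X))"
    proof -
      have "distinct (takeWhile (\<lambda>x. far n x (hd ?Y)) (rev ?X) @ dropWhile (\<lambda>x. far n x (hd ?Y)) (rev ?X))"
        using dX by simp
      then show ?thesis using u unfolding rest_l_def distinct_append by auto
    qed
    then obtain z where z: "z = u \<or> prec (rev ?X) z u" "z \<in> set (rev ?X)" "\<not> far n z (hd ?Y)"
      using prec_in_rev_takeWhile[of "rev ?X" u "\<lambda>x. far n x (hd ?Y)"] dX uX by auto
    have "prec xs (hd ?Y) z" using z(1) h pX prec_trans[OF F(2)] by (auto simp: prec_rev)
    then have "far n z (hd ?Y)" using far_inversion[OF xs, of z "hd ?Y"] z(2) hY oX by auto
    then show False using z(3) by simp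
  qed
  have V: "prec xs x v" if v: "v \<in> set (rest_r n ?X ?Y)" and x: "x \<in> set xs" "\<not> even x" for v x
  proof (rule ccontr)
    assume nu: "\<not> prec xs x v"
    have vY: "v \<in> set ?Y" using v core_rest_r[of n ?X ?Y] by (metis UnI2 set_append)
    have xX: "x \<in> set ?X" using x oX by auto
    have vx: "prec xs v x" using nu prec_total[of x xs v] vY xX oX by auto
    then have h: "prec xs v (last ?X)" using laX[OF xX] prec_trans[OF F(2)] by auto
    have "v \<notin> set (takeWhile (far n (last ?X)) ?Y)"
    proof -
      have "distinct (takeWhile (far n (last ?X)) ?Y @ dropWhile (far n (last ?X)) ?Y)"
        using dX by simp
      then show ?thesis using v unfolding rest_r_def distinct_append by auto
    qed
    then obtain z where z: "z = v \<or> prec ?Y z v" "z \<in> set ?Y" "\<not> far n (last ?X) z"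
      using prec_in_rev_takeWhile[of ?Y v "far n (last ?X)"] dX vY by auto
    have "prec xs z (last ?X)" using z(1) h pX prec_trans[OF F(2)] by auto
    then have "far n (last ?X) z" using far_inversion[OF xs, of "last ?X" z] z(2) hY oX by auto
    then show False using z(3) by simp
  qed
  obtain ys where ys: "xs = rest_l n ?X ?Y @ ys"
    using split_prefix[OF F(2), of odd "rest_l n ?X ?Y" "core_l n ?X ?Y"] p(2) U rest_core_l by metis
  have eU: "filter even (rest_l n ?X ?Y) = []"
  proof -
    have "set (rest_l n ?X ?Y) \<subseteq> set ?X" using rest_core_l[of n ?X ?Y] by (metis Un_upper1 set_append)
    then show ?thesis using oX by (auto simp: filter_empty_conv)
  qed
  have "\<exists>w. ys = w @ rest_r n ?X ?Y"
  proof (rule split_suffix[where P = even and Z = "core_r n ?X ?Y"])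
    show "distinct ys" using F(2) ys by auto
    show "filter even ys = core_r n ?X ?Y @ rest_r n ?X ?Y"
      using q(2) unfolding core_rest_r by (subst (asm) ys) (simp add: eU)
    fix v x assume v: "v \<in> set (rest_r n ?X ?Y)" "x \<in> set ys" "\<not> even x"
    have "prec xs x v" using V v ys by auto
    moreover have "x \<notin> set (rest_l n ?X ?Y)" using v(2) F(2) ys by auto
    ultimately show "prec ys x v" unfolding ys prec_append by (auto dest: prec_in_set)
  qed
  then obtain w where w: "ys = w @ rest_r n ?X ?Y" by blast
  have oV: "filter odd (rest_r n ?X ?Y) = []"
  proof -
    have "set (rest_r n ?X ?Y) \<subseteq> set ?Y" using core_rest_r[of n ?X ?Y] by (metis Un_upper2 set_append)
    then show ?thesis using oX by (auto simp: filter_empty_conv)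
  qed
  have oU: "filter odd (rest_l n ?X ?Y) = rest_l n ?X ?Y" and eV: "filter even (rest_r n ?X ?Y) = rest_r n ?X ?Y"
    using eU oV by (auto simp: filter_id_conv filter_empty_conv)
  have "rest_l n ?X ?Y @ filter odd w = rest_l n ?X ?Y @ core_l n ?X ?Y"
    using p(2) unfolding rest_core_l by (subst (asm) ys) (simp add: w oU oV)
  moreover have "filter even w @ rest_r n ?X ?Y = core_r n ?X ?Y @ rest_r n ?X ?Y"
    using q(2) unfolding core_rest_r by (subst (asm) ys) (simp add: w eU eV)
  ultimately have "filter odd w = core_l n ?X ?Y" "filter even w = core_r n ?X ?Y" by auto
  then have "w \<in> core n ?X ?Y"
    using partition_in_shuffles[of w odd] by (simp add: core_def)
  then show ?thesis using ys w by (auto simp: weave_def)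
qed

lemma weave_odd_first:
  assumes p: "p \<in> free_perms ((n + 1) div 2)" and q: "q \<in> free_perms (n div 2)" and n: "n \<ge> 3"
    and w: "w \<in> core n (odds p) (evens q)"
  shows "weave n (odds p) (evens q) w \<in> odd_first n"
proof -
  let ?X = "odds p" and ?Y = "evens q"
  have n2: "n \<ge> 2" using n by simp
  note pq = pq_props[OF p q n2]
  let ?xs = "weave n ?X ?Y w"
  have oX: "\<And>x. x \<in> set ?X \<Longrightarrow> odd x" "\<And>y. y \<in> set ?Y \<Longrightarrow> \<not> odd y"
    using pq by (auto simp: odds_def evens_def)
  have fw: "filter odd ?xs = ?X" "filter (\<lambda>x. \<not> odd x) ?xs = ?Y"
    "filter odd w = core_l n ?X ?Y" "filter (\<lambda>x. \<not> odd x) w = core_r n ?X ?Y"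
    by (rule filter_weave[OF _ _ w]; use oX in blast)+
  have w': "w \<in> shuffles (core_l n ?X ?Y) (core_r n ?X ?Y)" using w by (simp add: core_def)
  have sX: "set ?X = set (rest_l n ?X ?Y) \<union> set (core_l n ?X ?Y)" "set ?Y = set (core_r n ?X ?Y) \<union> set (rest_r n ?X ?Y)"
    using rest_core_l[of n ?X ?Y] core_rest_r[of n ?X ?Y] by (metis set_append)+
  have "set ?xs = set ?X \<union> set ?Y" using set_shuffles[OF w'] sX by (auto simp: weave_def)
  also have "\<dots> = {1..n}" unfolding set_odds set_evens pq(5,6) odds_image evens_image by auto
  finally have s: "set ?xs = {1..n}" .
  have lX: "length ?X = length (rest_l n ?X ?Y) + length (core_l n ?X ?Y)"
    "length ?Y = length (core_r n ?X ?Y) + length (rest_r n ?X ?Y)"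
    unfolding length_append[symmetric] rest_core_l core_rest_r by simp_all
  have "length ?xs = length ?X + length ?Y"
    unfolding lX weave_def using length_shuffles[OF w'] by simp
  also have "\<dots> = n" using free_permsD(3)[OF p] free_permsD(3)[OF q] by (simp add: odds_def evens_def)
  finally have d: "distinct ?xs" using s by (intro card_distinct) simp
  show ?thesis
  proof (rule odd_firstI[OF s d n p fw(1) q])
    show "filter even ?xs = ?Y" using fw(2) by simp
    fix x y assume h: "odd x" "even y" "prec ?xs y x"
    have "x \<notin> set (rest_r n ?X ?Y)" "y \<notin> set (rest_l n ?X ?Y)" using h oX sX by auto
    then have "prec w y x" using h(3) unfolding weave_def prec_append by (auto dest: prec_in_set)
    then have "x \<in> set w" "y \<in> set w" by (auto dest: prec_in_set)
    then have "x \<in> set (core_l n ?X ?Y)" "y \<in> set (core_r n ?X ?Y)"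
      unfolding fw(3,4)[symmetric] using h by auto
    then show "far n x y" by (rule core_far[OF p q n2])
  qed
qed

text \<open>The decomposition is a bijection because the odd and even subsequences give back
  \<open>p\<close> and \<open>q\<close>. It is stated for sums so that any statistic of permutations
  can be transported.\<close>

theorem sum_odd_first:
  fixes f :: "nat list \<Rightarrow> 'b :: comm_monoid_add"
  assumes n: "n \<ge> 3"
  shows "(\<Sum>xs\<in>odd_first n. f xs) =
    (\<Sum>p\<in>free_perms ((n + 1) div 2). \<Sum>q\<in>free_perms (n div 2).
       \<Sum>w\<in>core n (odds p) (evens q). f (weave n (odds p) (evens q) w))"
proof -
  let ?A = "free_perms ((n + 1) div 2)" and ?B = "free_perms (n div 2)"
  let ?W = "\<lambda>(p, q). weave n (odds p) (evens q) ` core n (odds p) (evens q)"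
  have n2: "n \<ge> 2" using n by simp
  have fil: "filter odd (weave n (odds p) (evens q) w) = odds p" "filter even (weave n (odds p) (evens q) w) = evens q"
    if "p \<in> ?A" "q \<in> ?B" "w \<in> core n (odds p) (evens q)" for p q w
  proof -
    note pq = pq_props[OF that(1,2) n2]
    have oX: "\<And>x. x \<in> set (odds p) \<Longrightarrow> odd x" "\<And>y. y \<in> set (evens q) \<Longrightarrow> \<not> odd y"
      using pq by (auto simp: odds_def evens_def)
    show "filter odd (weave n (odds p) (evens q) w) = odds p" "filter even (weave n (odds p) (evens q) w) = evens q"
      using filter_weave(1,2)[of "odds p" odd "evens q" w n, OF oX that(3)] by auto
  qed
  have inj_odds: "p = p'" if "p \<in> ?A" "p' \<in> ?A" "odds p = odds p'" for p p'
  proof -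
    have "inj_on (\<lambda>p::nat. 2 * p - 1) (set p \<union> set p')"
      using pq_props free_permsD(1)[OF that(1)] free_permsD(1)[OF that(2)] by (intro inj_onI) auto
    then show ?thesis using that(3) unfolding odds_def by (metis map_inj_on)
  qed
  have "inj ((*) (2::nat))" by (simp add: inj_def)
  then have inj_evens: "q = q'" if "evens q = evens q'" for q q' :: "nat list"
    using that unfolding evens_def by (simp add: inj_map_eq_map)
  have "odd_first n = (\<Union>z \<in> ?A \<times> ?B. ?W z)"
  proof (intro equalityI subsetI)
    fix xs assume xs: "xs \<in> odd_first n"
    obtain p where p: "p \<in> ?A" "filter odd xs = odds p" using filter_odd_free_perms[OF odd_firstD[OF xs]] .
    obtain q where q: "q \<in> ?B" "filter even xs = evens q" using filter_even_free_perms[OF odd_firstD[OF xs]] .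
    show "xs \<in> (\<Union>z \<in> ?A \<times> ?B. ?W z)"
      using odd_first_is_weave[OF xs p q n2] p(1) q(1) by fastforce
  next
    fix xs assume "xs \<in> (\<Union>z \<in> ?A \<times> ?B. ?W z)"
    then show "xs \<in> odd_first n" using weave_odd_first[OF _ _ n] by auto
  qed
  then have "(\<Sum>xs\<in>odd_first n. f xs) = (\<Sum>z\<in>?A \<times> ?B. \<Sum>xs\<in>?W z. f xs)"
  proof (simp only:, intro sum.UNION_disjoint ballI impI)
    fix z z' assume h: "z \<in> ?A \<times> ?B" "z' \<in> ?A \<times> ?B" "z \<noteq> z'"
    obtain p q p' q' where z: "z = (p, q)" "z' = (p', q')" by (cases z, cases z') auto
    show "?W z \<inter> ?W z' = {}"
    proof (rule ccontr)
      assume "?W z \<inter> ?W z' \<noteq> {}"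
      then obtain w w' where "w \<in> core n (odds p) (evens q)" "w' \<in> core n (odds p') (evens q')"
        "weave n (odds p) (evens q) w = weave n (odds p') (evens q') w'" using z by auto
      then have "odds p = odds p'" "evens q = evens q'" using fil h z by (metis SigmaE prod.inject)+
      then have "p = p'" "q = q'" using inj_odds inj_evens h z by auto
      then show False using h z by simp
    qed
  qed (auto simp: core_def)
  also have "\<dots> = (\<Sum>p\<in>?A. \<Sum>q\<in>?B. \<Sum>xs\<in>?W (p, q). f xs)"
    by (simp add: sum.cartesian_product split_def)
  also have "\<dots> = (\<Sum>p\<in>?A. \<Sum>q\<in>?B. \<Sum>w\<in>core n (odds p) (evens q). f (weave n (odds p) (evens q) w))"
  proof (rule sum.cong[OF refl], rule sum.cong[OF refl])
    fix p q
    have "inj_on (weave n (odds p) (evens q)) (core n (odds p) (evens q))"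
      by (auto simp: inj_on_def weave_def)
    then show "(\<Sum>xs\<in>?W (p, q). f xs) = (\<Sum>w\<in>core n (odds p) (evens q). f (weave n (odds p) (evens q) w))"
      by (simp add: sum.reindex)
  qed
  finally show ?thesis .
qed

section \<open>Types of permutations and their behaviour under weaving\<close>

definition run :: "nat list \<Rightarrow> nat" where
  "run xs = length (takeWhile (\<lambda>x. x \<le> hd xs) xs)"

definition hrun :: "nat list \<Rightarrow> nat" where
  "hrun xs = length (takeWhile (\<lambda>x. hd xs \<le> x) xs)"

type_synonym stype = "nat \<times> nat \<times> nat"

text \<open>All that the next level needs to know about the beginning of a permutation. Each run is
  recorded only if the head lies in the matching half, where \<open>low_prefix\<close> or
  \<open>high_prefix\<close> applies; both are recorded exactly for a head in the middle.\<close>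

definition stype :: "nat \<Rightarrow> nat list \<Rightarrow> stype" where
  "stype n xs = (hd xs, if 2 * hd xs \<le> n + 1 then run xs else 0, if n + 1 \<le> 2 * hd xs then hrun xs else 0)"

lemma fst_stype [simp]: "fst (stype n xs) = hd xs"
  by (simp add: stype_def)

text \<open>Here \<open>(x, l, h)\<close> is the type of one parity class of size \<open>m\<close>,
  \<open>len\<close> the length of its block in the shuffle, and \<open>i\<close> the number of
  foreign elements in front of that block. Foreign elements can prolong a run only if it consists of
  everything before the block (\<open>l + len = m\<close>) and the block lies in the opposite half;
  the foreign elements then lie in the half of the run.\<close>

fun lift :: "nat \<Rightarrow> nat \<Rightarrow> nat \<Rightarrow> stype \<Rightarrow> nat \<Rightarrow> nat \<Rightarrow> nat \<Rightarrow> stype" where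
  "lift n m X (x, l, h) c len i =
     (X, if 2 * X \<le> n + 1 then (if c = 2 \<and> l + len = m then l + i else l) else 0,
         if n + 1 \<le> 2 * X then (if c = 1 \<and> h + len = m then h + i else h) else 0)"

text \<open>Either the run stops inside \<open>U\<close>, or it exhausts \<open>U\<close> and goes
  on through the foreign elements up to the first own element of \<open>w\<close>.\<close>

lemma length_takeWhile_core:
  assumes "(\<exists>u\<in>set U. \<not> R u) \<or>
    P \<noteq> [] \<and> (\<forall>x\<in>set P. \<not> R x) \<and> (\<forall>y\<in>set w. R y \<longleftrightarrow> \<not> own y) \<and> (\<exists>x\<in>set w. own x)"
  shows "length (takeWhile R (U @ w @ V)) = length (takeWhile R (U @ P)) +
      (if \<forall>u\<in>set U. R u then length (takeWhile (\<lambda>x. \<not> own x) w) else 0)"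
    "length (takeWhile R (U @ P)) + length P = length (U @ P) \<longleftrightarrow> (\<forall>u\<in>set U. R u)"
proof -
  show "length (takeWhile R (U @ w @ V)) = length (takeWhile R (U @ P)) +
      (if \<forall>u\<in>set U. R u then length (takeWhile (\<lambda>x. \<not> own x) w) else 0)"
  proof (cases "\<forall>u\<in>set U. R u")
    case True
    then have *: "P \<noteq> []" "\<forall>x\<in>set P. \<not> R x" "\<forall>y\<in>set w. R y \<longleftrightarrow> \<not> own y" "\<exists>x\<in>set w. own x"
      using assms by auto
    have "takeWhile R (w @ V) = takeWhile R w" using *(3,4) by (auto intro!: takeWhile_append1)
    also have "\<dots> = takeWhile (\<lambda>x. \<not> own x) w" using *(3) by (intro takeWhile_cong) auto
    finally show ?thesis using True * by (cases P) (auto simp: takeWhile_append2)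
  next
    case False
    then obtain u where "u \<in> set U" "\<not> R u" by auto
    then show ?thesis by (auto simp: takeWhile_append1)
  qed
  show "length (takeWhile R (U @ P)) + length P = length (U @ P) \<longleftrightarrow> (\<forall>u\<in>set U. R u)"
  proof (cases "\<forall>u\<in>set U. R u")
    case True
    then show ?thesis using assms by (cases P) (auto simp: takeWhile_append2)
  next
    case False
    then obtain u where u: "u \<in> set U" "\<not> R u" by auto
    then have "takeWhile R U \<noteq> U" by (metis set_takeWhileD)
    then have "length (takeWhile R U) < length U"
      by (metis le_neq_implies_less length_takeWhile_le takeWhile_eq_take take_all_iff order_refl)
    then show ?thesis using u by (auto simp: takeWhile_append1)
  qed
qed

text \<open>
  In the next lemma, \<open>c\<close> records the position of the block \<open>P\<close> of its own parity class that may be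
  overtaken: 0 if there is none, 1 if it lies in the lower half and 2 if it lies in the upper half.
\<close>

lemma stype_embed:
  assumes xs: "xs \<in> free_perms n" and t: "t \<in> free_perms m" and m: "m \<ge> 2"
    and tUP: "map g t = U @ P" and xsU: "xs = U @ w @ V" and sw: "set w = set P \<union> S"
    and mono: "\<And>x y. x \<le> y \<Longrightarrow> g x \<le> g y"
    and g_low: "\<And>x. x \<in> {1..m} \<Longrightarrow> 2 * g x \<le> n + 1 \<Longrightarrow> 2 * x \<le> m + 1"
    and g_high: "\<And>x. x \<in> {1..m} \<Longrightarrow> n + 1 \<le> 2 * g x \<Longrightarrow> m + 1 \<le> 2 * x"
    and g_m: "n + 1 < 2 * g m" and g_1: "2 * g 1 < n + 1"
    and own: "\<And>x. x \<in> set P \<Longrightarrow> own x" "\<And>y. y \<in> S \<Longrightarrow> \<not> own y"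
    and c: "c = 0 \<and> P = [] \<or>
      c = 1 \<and> P \<noteq> [] \<and> (\<forall>x\<in>set P. 2 * x \<le> n) \<and> (\<forall>y\<in>S. n + 1 < 2 * y) \<or>
      c = 2 \<and> P \<noteq> [] \<and> (\<forall>x\<in>set P. n + 1 < 2 * x) \<and> (\<forall>y\<in>S. 2 * y \<le> n)"
  shows "stype n xs = lift n m (g (hd t)) (stype m t) c (length P) (length (takeWhile (\<lambda>x. \<not> own x) w))"
proof -
  have st: "set t = {1..m}" and lt: "length t = m" using free_permsD[OF t] by auto
  have tne: "t \<noteq> []" using m lt by auto
  have UP: "set U \<union> set P = g ` {1..m}" using arg_cong[OF tUP, of set] st by simp
  \<comment> \<open>The largest element of the class is in the upper half, so unless the block is
    there too, it stays in \<open>U\<close> and stops every run of the lower half.\<close>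
  have gU: "g m \<in> set U" if "c \<noteq> 2"
  proof -
    have "g m \<in> set U \<union> set P" using UP m by auto
    moreover have "g m \<notin> set P" using c that g_m by fastforce
    ultimately show ?thesis by simp
  qed
  have gU': "g 1 \<in> set U" if "c \<noteq> 1"
  proof -
    have "g 1 \<in> set U \<union> set P" using UP m by auto
    moreover have "g 1 \<notin> set P" using c that g_1 by fastforce
    ultimately show ?thesis by simp
  qed
  have Une: "U \<noteq> []" using gU gU' by (cases "c = 2") auto
  have hd: "hd xs = g (hd t)" using Une tUP tne xsU by (metis hd_append2 hd_map)
  have lU: "length (U @ P) = m" using tUP lt by (metis length_map)
  have ht: "hd t \<in> {1..m}" using st tne hd_in_set by blast
  have low: "run xs = (if c = 2 \<and> run t + length P = m then run t + length (takeWhile (\<lambda>x. \<not> own x) w) else run t)"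
    if h: "2 * g (hd t) \<le> n + 1"
  proof -
    let ?R = "\<lambda>x. 2 * x \<le> n + 1"
    \<comment> \<open>Membership in the lower half replaces the comparison with the head, because it
      can be tested in the same way on \<open>U\<close>, on the block and on the foreign
      elements.\<close>
    have "takeWhile ?R xs = takeWhile (\<lambda>x. x \<le> hd xs) xs"
      by (rule takeWhile_low[OF xs]) (use h hd in auto)
    then have r1: "run xs = length (takeWhile ?R (U @ w @ V))" by (simp add: run_def xsU)
    have "takeWhile (\<lambda>x. ?R (g x)) t = takeWhile (\<lambda>x. x \<le> hd t) t"
    proof (rule takeWhile_low[OF t])
      fix x assume "x \<in> set t" "x \<le> hd t"
      then show "2 * g x \<le> n + 1" using mono[of x "hd t"] h by simp
    qed (use g_low st in auto)
    then have "run t = length (takeWhile ?R (map g t))" by (simp add: run_def takeWhile_map o_def)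
    then have r2: "run t = length (takeWhile ?R (U @ P))" unfolding tUP .
    have *: "(\<exists>u\<in>set U. \<not> ?R u) \<or>
      P \<noteq> [] \<and> (\<forall>x\<in>set P. \<not> ?R x) \<and> (\<forall>y\<in>set w. ?R y \<longleftrightarrow> \<not> own y) \<and> (\<exists>x\<in>set w. own x)"
    proof (cases "c = 2")
      case True
      then have "P \<noteq> []" "\<forall>x\<in>set P. n + 1 < 2 * x" "\<forall>y\<in>S. 2 * y \<le> n" using c by auto
      then show ?thesis using own sw by (intro disjI2) (fastforce simp: neq_Nil_conv)
    next
      case False
      then show ?thesis using gU g_m by (intro disjI1 bexI[of _ "g m"]) auto
    qed
    have n2: "c \<noteq> 2 \<Longrightarrow> \<not> (\<forall>u\<in>set U. ?R u)" using gU g_m by fastforce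
    show ?thesis
    proof (cases "\<forall>u\<in>set U. ?R u")
      case True
      have "run xs = run t + length (takeWhile (\<lambda>x. \<not> own x) w)"
        unfolding r1 r2 length_takeWhile_core(1)[OF *, of V] by (simp only: if_P[OF True])
      moreover have "run t + length P = m"
        unfolding r2 lU[symmetric] using True length_takeWhile_core(2)[OF *] by blast
      moreover have "c = 2" using True n2 by blast
      ultimately show ?thesis by simp
    next
      case False
      have "run xs = run t"
        unfolding r1 r2 length_takeWhile_core(1)[OF *, of V] by (simp only: if_not_P[OF False] add_0_right)
      moreover have "run t + length P \<noteq> m"
        unfolding r2 lU[symmetric] using False length_takeWhile_core(2)[OF *] by blast
      ultimately show ?thesis by simp
    qed
  qed
  have high: "hrun xs = (if c = 1 \<and> hrun t + length P = m then hrun t + length (takeWhile (\<lambda>x. \<not> own x) w) else hrun t)"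
    if h: "n + 1 \<le> 2 * g (hd t)"
  proof -
    let ?R = "\<lambda>x. n + 1 \<le> 2 * x"
    have "takeWhile ?R xs = takeWhile (\<lambda>x. hd xs \<le> x) xs"
      by (rule takeWhile_high[OF xs]) (use h hd in auto)
    then have r1: "hrun xs = length (takeWhile ?R (U @ w @ V))" by (simp add: hrun_def xsU)
    have "takeWhile (\<lambda>x. ?R (g x)) t = takeWhile (\<lambda>x. hd t \<le> x) t"
    proof (rule takeWhile_high[OF t])
      fix x assume "x \<in> set t" "hd t \<le> x"
      then show "n + 1 \<le> 2 * g x" using mono[of "hd t" x] h by simp
    qed (use g_high st in auto)
    then have "hrun t = length (takeWhile ?R (map g t))" by (simp add: hrun_def takeWhile_map o_def)
    then have r2: "hrun t = length (takeWhile ?R (U @ P))" unfolding tUP .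
    have *: "(\<exists>u\<in>set U. \<not> ?R u) \<or>
      P \<noteq> [] \<and> (\<forall>x\<in>set P. \<not> ?R x) \<and> (\<forall>y\<in>set w. ?R y \<longleftrightarrow> \<not> own y) \<and> (\<exists>x\<in>set w. own x)"
    proof (cases "c = 1")
      case True
      then have "P \<noteq> []" "\<forall>x\<in>set P. 2 * x \<le> n" "\<forall>y\<in>S. n + 1 < 2 * y" using c by auto
      then show ?thesis using own sw by (intro disjI2) (fastforce simp: neq_Nil_conv)
    next
      case False
      then show ?thesis using gU' g_1 by (intro disjI1 bexI[of _ "g 1"]) auto
    qed
    have n1: "c \<noteq> 1 \<Longrightarrow> \<not> (\<forall>u\<in>set U. ?R u)" using gU' g_1 by fastforce
    show ?thesis
    proof (cases "\<forall>u\<in>set U. ?R u")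
      case True
      have "hrun xs = hrun t + length (takeWhile (\<lambda>x. \<not> own x) w)"
        unfolding r1 r2 length_takeWhile_core(1)[OF *, of V] by (simp only: if_P[OF True])
      moreover have "hrun t + length P = m"
        unfolding r2 lU[symmetric] using True length_takeWhile_core(2)[OF *] by blast
      moreover have "c = 1" using True n1 by blast
      ultimately show ?thesis by simp
    next
      case False
      have "hrun xs = hrun t"
        unfolding r1 r2 length_takeWhile_core(1)[OF *, of V] by (simp only: if_not_P[OF False] add_0_right)
      moreover have "hrun t + length P \<noteq> m"
        unfolding r2 lU[symmetric] using False length_takeWhile_core(2)[OF *] by blast
      ultimately show ?thesis by simp
    qed
  qed
  show ?thesis
    using low high g_low[OF ht] g_high[OF ht] by (auto simp: stype_def hd)
qed

text \<open>The tests are the two cases of \<open>far n (2 * z - 1) (2 * y)\<close>. The first type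
  is that of the reversed odd class, so its runs are measured at the end that meets the even class.
  A low odd block always faces a high even block, and conversely.\<close>

fun rect :: "nat \<Rightarrow> stype \<Rightarrow> stype \<Rightarrow> nat \<times> nat \<times> nat \<times> nat" where
  "rect n (z, l, h) (y, l', h') =
     (if 2 * (2 * z - 1) \<le> 2 * y \<and> n + (2 * z - 1) < 4 * y then (1, l, 2, h')
      else if 4 * y \<le> 2 * z - 1 \<and> n + 2 * y < 2 * (2 * z - 1) then (2, h, 1, l')
      else (0, 0, 0, 0))"

definition lift_odd :: "nat \<Rightarrow> stype \<Rightarrow> nat \<Rightarrow> nat \<Rightarrow> nat \<Rightarrow> stype" where
  "lift_odd n s c len i = lift n ((n + 1) div 2) (2 * fst s - 1) s c len i"

definition lift_even :: "nat \<Rightarrow> stype \<Rightarrow> nat \<Rightarrow> nat \<Rightarrow> nat \<Rightarrow> stype" where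
  "lift_even n s c len i = lift n (n div 2) (2 * fst s) s c len i"

lemma length_odds [simp]: "length (odds p) = length p"
  by (simp add: odds_def)

lemma length_evens [simp]: "length (evens p) = length p"
  by (simp add: evens_def)

lemma rect_core:
  assumes p: "p \<in> free_perms ((n + 1) div 2)" and q: "q \<in> free_perms (n div 2)" and n: "n \<ge> 2"
    and r: "rect n (stype ((n + 1) div 2) (rev p)) (stype (n div 2) q) = (cp, s, cq, k)"
  defines "P \<equiv> core_l n (odds p) (evens q)" and "Q \<equiv> core_r n (odds p) (evens q)"
  shows "length P = s" "length Q = k"
    "cp = 0 \<and> cq = 0 \<and> P = [] \<and> Q = [] \<or>
     cp = 1 \<and> cq = 2 \<and> P \<noteq> [] \<and> Q \<noteq> [] \<and> (\<forall>x\<in>set P. 2 * x \<le> n) \<and> (\<forall>y\<in>set Q. n + 1 < 2 * y) \<or>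
     cp = 2 \<and> cq = 1 \<and> P \<noteq> [] \<and> Q \<noteq> [] \<and> (\<forall>x\<in>set P. n + 1 < 2 * x) \<and> (\<forall>y\<in>set Q. 2 * y \<le> n)"
proof -
  note pq = pq_props[OF p q n]
  let ?x = "2 * last p - 1" and ?y = "2 * hd q"
  have hr: "hd (rev p) = last p" by (simp add: hd_rev)
  have x1: "last p \<ge> 1" "hd q \<ge> 1" "2 * hd q \<le> n" "?x \<le> n" using pq by auto
  have "(length P = s \<and> length Q = k) \<and> (cp = 0 \<and> cq = 0 \<and> P = [] \<and> Q = [] \<or>
     cp = 1 \<and> cq = 2 \<and> P \<noteq> [] \<and> Q \<noteq> [] \<and> (\<forall>x\<in>set P. 2 * x \<le> n) \<and> (\<forall>y\<in>set Q. n + 1 < 2 * y) \<or>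
     cp = 2 \<and> cq = 1 \<and> P \<noteq> [] \<and> Q \<noteq> [] \<and> (\<forall>x\<in>set P. n + 1 < 2 * x) \<and> (\<forall>y\<in>set Q. 2 * y \<le> n))"
  proof (cases "far n ?x ?y")
    case False
    then have "\<not> (2 * ?x \<le> ?y \<and> n + ?x < 4 * hd q)" "\<not> (4 * hd q \<le> ?x \<and> n + ?y < 2 * ?x)"
      using x1 by (auto simp: far_def split: if_splits)
    then have "(cp, s, cq, k) = (0, 0, 0, 0)" using r by (auto simp: stype_def hr)
    then show ?thesis using core_none[OF p q n False] by (simp add: P_def Q_def)
  next
    case True
    show ?thesis
    proof (cases "?x < ?y")
      case less: True
      then have f: "2 * ?x \<le> ?y" "n + ?x < 4 * hd q" using True by (auto simp: far_def)
      have hl: "2 * last p \<le> (n + 1) div 2 + 1" "n div 2 + 1 \<le> 2 * hd q" using f x1 by auto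
      have "(cp, s, cq, k) = (1, run (rev p), 2, hrun q)"
        using r f hl by (auto simp: stype_def hr)
      moreover have P: "P = rev (odds (takeWhile (\<lambda>x. x \<le> last p) (rev p)))"
        and Q: "Q = evens (takeWhile (\<lambda>y. hd q \<le> y) q)"
        unfolding P_def Q_def by (rule core_low[OF p q n True less])+
      moreover have "2 * x \<le> n" if x: "x \<in> set P" for x
      proof -
        obtain u where "x = 2 * u - 1" "u \<le> last p"
          using x unfolding P by (auto simp: odds_def dest: set_takeWhileD)
        then show ?thesis using f x1 by auto
      qed
      moreover have "n + 1 < 2 * y" if y: "y \<in> set Q" for y
      proof -
        obtain v where "y = 2 * v" "hd q \<le> v"
          using y unfolding Q by (auto simp: evens_def dest: set_takeWhileD)
        then show ?thesis using f x1 by auto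
      qed
      moreover have "P \<noteq> []" "Q \<noteq> []"
      proof -
        obtain t where "rev p = last p # t" using pq(1) by (metis hr list.collapse rev_is_Nil_conv)
        then show "P \<noteq> []" unfolding P \<open>rev p = last p # t\<close> by (simp add: odds_def)
        show "Q \<noteq> []" unfolding Q using pq(2) by (cases q) (auto simp: evens_def)
      qed
      ultimately show ?thesis by (auto simp: run_def hrun_def hr)
    next
      case False
      have "?x \<noteq> ?y" using x1 by presburger
      then have less: "?y < ?x" using False by simp
      have f: "4 * hd q \<le> ?x" "n + ?y < 2 * ?x" using True False by (auto simp: far_def)
      have hl: "(n + 1) div 2 + 1 \<le> 2 * last p" "2 * hd q \<le> n div 2 + 1" using f x1 by auto
      have "\<not> (2 * ?x \<le> ?y \<and> n + ?x < 4 * hd q)" using less by auto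
      then have "(cp, s, cq, k) = (2, hrun (rev p), 1, run q)"
        using r f hl by (auto simp: stype_def hr)
      moreover have P: "P = rev (odds (takeWhile (\<lambda>x. last p \<le> x) (rev p)))"
        and Q: "Q = evens (takeWhile (\<lambda>y. y \<le> hd q) q)"
        unfolding P_def Q_def by (rule core_high[OF p q n True less])+
      moreover have "n + 1 < 2 * x" if x: "x \<in> set P" for x
      proof -
        obtain u where "x = 2 * u - 1" "last p \<le> u"
          using x unfolding P by (auto simp: odds_def dest: set_takeWhileD)
        then show ?thesis using f x1 by auto
      qed
      moreover have "2 * y \<le> n" if y: "y \<in> set Q" for y
      proof -
        obtain v where "y = 2 * v" "v \<le> hd q"
          using y unfolding Q by (auto simp: evens_def dest: set_takeWhileD)
        then show ?thesis using f x1 by auto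
      qed
      moreover have "P \<noteq> []" "Q \<noteq> []"
      proof -
        obtain t where "rev p = last p # t" using pq(1) by (metis hr list.collapse rev_is_Nil_conv)
        then show "P \<noteq> []" unfolding P \<open>rev p = last p # t\<close> by (simp add: odds_def)
        show "Q \<noteq> []" unfolding Q using pq(2) by (cases q) (auto simp: evens_def)
      qed
      ultimately show ?thesis by (auto simp: run_def hrun_def hr)
    qed
  qed
  then show "length P = s" "length Q = k"
    "cp = 0 \<and> cq = 0 \<and> P = [] \<and> Q = [] \<or>
     cp = 1 \<and> cq = 2 \<and> P \<noteq> [] \<and> Q \<noteq> [] \<and> (\<forall>x\<in>set P. 2 * x \<le> n) \<and> (\<forall>y\<in>set Q. n + 1 < 2 * y) \<or>
     cp = 2 \<and> cq = 1 \<and> P \<noteq> [] \<and> Q \<noteq> [] \<and> (\<forall>x\<in>set P. n + 1 < 2 * x) \<and> (\<forall>y\<in>set Q. 2 * y \<le> n)"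
    by blast+
qed

text \<open>A weave starts like its odd class and ends like its even class. The second equation is
  the argument for the first, applied to the reversed list with the classes exchanged.\<close>

lemma stype_weave:
  assumes p: "p \<in> free_perms ((n + 1) div 2)" and q: "q \<in> free_perms (n div 2)" and n: "n \<ge> 4"
    and r: "rect n (stype ((n + 1) div 2) (rev p)) (stype (n div 2) q) = (cp, s, cq, k)"
    and w: "w \<in> core n (odds p) (evens q)"
  shows "stype n (weave n (odds p) (evens q) w) =
      lift_odd n (stype ((n + 1) div 2) p) cp s (length (takeWhile even w))" (is ?P)
    "stype n (rev (weave n (odds p) (evens q) w)) =
      lift_even n (stype (n div 2) (rev q)) cq k (length (takeWhile odd (rev w)))" (is ?Q)
proof -
  let ?X = "odds p" and ?Y = "evens q"
  have n': "n \<ge> 2" "n \<ge> 3" using n by auto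
  note rc = rect_core[OF p q n'(1) r]
  note pq = pq_props[OF p q n'(1)]
  have xs: "weave n ?X ?Y w \<in> free_perms n" using weave_odd_first[OF p q n'(2) w] odd_firstD by blast
  have w': "w \<in> shuffles (core_l n ?X ?Y) (core_r n ?X ?Y)" using w by (simp add: core_def)
  have oX: "x \<in> set (core_l n ?X ?Y) \<Longrightarrow> odd x" for x
  proof -
    assume "x \<in> set (core_l n ?X ?Y)"
    then have "x \<in> set ?X" using rest_core_l[of n ?X ?Y] by (metis UnI2 set_append)
    then show ?thesis using pq by (auto simp: odds_def)
  qed
  have eY: "y \<in> set (core_r n ?X ?Y) \<Longrightarrow> even y" for y
  proof -
    assume "y \<in> set (core_r n ?X ?Y)"
    then have "y \<in> set ?Y" using core_rest_r[of n ?X ?Y] by (metis UnI1 set_append)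
    then show ?thesis by (auto simp: evens_def)
  qed
  have sw: "set w = set (core_l n ?X ?Y) \<union> set (core_r n ?X ?Y)" by (rule set_shuffles[OF w'])
  have "stype n (weave n ?X ?Y w) =
      lift n ((n + 1) div 2) (2 * hd p - 1) (stype ((n + 1) div 2) p) cp (length (core_l n ?X ?Y))
        (length (takeWhile (\<lambda>x. \<not> odd x) w))"
  proof (rule stype_embed[OF xs p, where g = "\<lambda>x. 2 * x - 1" and U = "rest_l n ?X ?Y" and V = "rest_r n ?X ?Y"
      and S = "set (core_r n ?X ?Y)"])
    show "map (\<lambda>x. 2 * x - 1) p = rest_l n ?X ?Y @ core_l n ?X ?Y"
      unfolding rest_core_l by (simp add: odds_def)
    show "cp = 0 \<and> core_l n ?X ?Y = [] \<or>
      cp = 1 \<and> core_l n ?X ?Y \<noteq> [] \<and> (\<forall>x\<in>set (core_l n ?X ?Y). 2 * x \<le> n) \<and> (\<forall>y\<in>set (core_r n ?X ?Y). n + 1 < 2 * y) \<or>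
      cp = 2 \<and> core_l n ?X ?Y \<noteq> [] \<and> (\<forall>x\<in>set (core_l n ?X ?Y). n + 1 < 2 * x) \<and> (\<forall>y\<in>set (core_r n ?X ?Y). 2 * y \<le> n)"
      using rc(3) by blast
  qed (use n sw oX eY in \<open>auto simp: weave_def\<close>)
  then show ?P by (simp add: lift_odd_def rc(1))
  have "stype n (rev (weave n ?X ?Y w)) =
      lift n (n div 2) (2 * hd (rev q)) (stype (n div 2) (rev q)) cq (length (rev (core_r n ?X ?Y)))
        (length (takeWhile (\<lambda>x. \<not> even x) (rev w)))"
  proof (rule stype_embed[OF rev_free_perms[OF xs] rev_free_perms[OF q], where g = "\<lambda>x. 2 * x"
      and U = "rev (rest_r n ?X ?Y)" and V = "rev (rest_l n ?X ?Y)" and S = "set (core_l n ?X ?Y)"])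
    show "map (\<lambda>x. 2 * x) (rev q) = rev (rest_r n ?X ?Y) @ rev (core_r n ?X ?Y)"
      unfolding rev_append[symmetric] core_rest_r by (simp add: evens_def rev_map)
    show "cq = 0 \<and> rev (core_r n ?X ?Y) = [] \<or>
      cq = 1 \<and> rev (core_r n ?X ?Y) \<noteq> [] \<and> (\<forall>x\<in>set (rev (core_r n ?X ?Y)). 2 * x \<le> n) \<and> (\<forall>y\<in>set (core_l n ?X ?Y). n + 1 < 2 * y) \<or>
      cq = 2 \<and> rev (core_r n ?X ?Y) \<noteq> [] \<and> (\<forall>x\<in>set (rev (core_r n ?X ?Y)). n + 1 < 2 * x) \<and> (\<forall>y\<in>set (core_l n ?X ?Y). 2 * y \<le> n)"
      using rc(3) by auto
  qed (use n sw oX eY in \<open>auto simp: weave_def\<close>)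
  then show ?Q by (simp add: lift_even_def rc(2))
qed

subsection \<open>Summing over shuffles\<close>

text \<open>Shuffles reduced to parities, with \<open>True\<close> for an odd element; the counts
  that are needed depend on nothing else.\<close>

fun patterns :: "nat \<Rightarrow> nat \<Rightarrow> bool list list" where
  "patterns s k = (if s = 0 then [replicate k False] else if k = 0 then [replicate s True]
     else map ((#) True) (patterns (s - 1) k) @ map ((#) False) (patterns s (k - 1)))"

declare patterns.simps [simp del]

lemma sum_shuffles:
  fixes g :: "bool list \<Rightarrow> nat"
  assumes "\<forall>x\<in>set P. odd (x::nat)" "\<forall>y\<in>set Q. even y"
  shows "(\<Sum>w\<in>shuffles P Q. g (map odd w)) = (\<Sum>v\<leftarrow>patterns (length P) (length Q). g v)"
  using assms
proof (induction P Q arbitrary: g rule: shuffles.induct)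
  case (1 ys)
  then have "map odd ys = replicate (length ys) False"
    by (induction ys) auto
  then show ?case by (simp add: patterns.simps)
next
  case (2 xs)
  then have "map odd xs = replicate (length xs) True"
    by (induction xs) auto
  then show ?case by (simp add: patterns.simps)
next
  case (3 x xs y ys)
  have disj: "(#) x ` shuffles xs (y # ys) \<inter> (#) y ` shuffles (x # xs) ys = {}"
    using 3(3,4) by auto
  have "(\<Sum>w\<in>shuffles (x # xs) (y # ys). g (map odd w)) =
     (\<Sum>w\<in>(#) x ` shuffles xs (y # ys). g (map odd w)) + (\<Sum>w\<in>(#) y ` shuffles (x # xs) ys. g (map odd w))"
    unfolding shuffles.simps(3) by (rule sum.union_disjoint) (use disj in auto)
  also have "\<dots> = (\<Sum>w\<in>shuffles xs (y # ys). g (True # map odd w)) + (\<Sum>w\<in>shuffles (x # xs) ys. g (False # map odd w))"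
    using 3(3,4) by (simp add: sum.reindex)
  also have "\<dots> = (\<Sum>v\<leftarrow>patterns (length xs) (length (y # ys)). g (True # v)) +
      (\<Sum>v\<leftarrow>patterns (length (x # xs)) (length ys). g (False # v))"
    using 3(1)[of "\<lambda>v. g (True # v)"] 3(2)[of "\<lambda>v. g (False # v)"] 3(3,4) by simp
  also have "\<dots> = (\<Sum>v\<leftarrow>patterns (length (x # xs)) (length (y # ys)). g v)"
    by (subst (3) patterns.simps) (simp add: o_def)
  finally show ?case .
qed

text \<open>Per shuffle, the even elements ahead of every odd one and the odd elements behind every
  even one. These are the two arguments \<open>i\<close> that \<open>lift\<close> takes at the start
  and at the end.\<close>

definition overtakes :: "nat \<Rightarrow> nat \<Rightarrow> (nat \<times> nat) list" where
  "overtakes s k = map (\<lambda>v. (length (takeWhile Not v), length (takeWhile id (rev v)))) (patterns s k)"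

lemma sum_core:
  fixes f :: "nat \<Rightarrow> nat \<Rightarrow> nat"
  assumes p: "p \<in> free_perms ((n + 1) div 2)" and q: "q \<in> free_perms (n div 2)" and n: "n \<ge> 2"
  shows "(\<Sum>w\<in>core n (odds p) (evens q). f (length (takeWhile even w)) (length (takeWhile odd (rev w)))) =
     (\<Sum>(i, j)\<leftarrow>overtakes (length (core_l n (odds p) (evens q))) (length (core_r n (odds p) (evens q))). f i j)"
proof -
  let ?P = "core_l n (odds p) (evens q)" and ?Q = "core_r n (odds p) (evens q)"
  note pq = pq_props[OF p q n]
  have "set ?P \<subseteq> set (odds p)" using rest_core_l[of n "odds p" "evens q"] by (metis Un_upper2 set_append)
  then have o: "\<forall>x\<in>set ?P. odd x" using pq by (auto simp: odds_def)
  have "set ?Q \<subseteq> set (evens q)" using core_rest_r[of n "odds p" "evens q"] by (metis Un_upper1 set_append)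
  then have e: "\<forall>x\<in>set ?Q. even x" by (auto simp: evens_def)
  have l: "length (takeWhile Not (map odd w)) = length (takeWhile even w)"
    "length (takeWhile id (rev (map odd w))) = length (takeWhile odd (rev w))" for w :: "nat list"
    by (simp_all add: takeWhile_map o_def rev_map)
  show ?thesis
    using sum_shuffles[OF o e, of "\<lambda>v. f (length (takeWhile Not v)) (length (takeWhile id (rev v)))"]
    unfolding l by (simp add: core_def overtakes_def o_def)
qed

theorem sum_odd_first_stype:
  fixes f :: "stype \<Rightarrow> stype \<Rightarrow> nat"
  assumes n: "n \<ge> 4"
  shows "(\<Sum>xs\<in>odd_first n. f (stype n xs) (stype n (rev xs))) =
    (\<Sum>p\<in>free_perms ((n + 1) div 2). \<Sum>q\<in>free_perms (n div 2).
      case rect n (stype ((n + 1) div 2) (rev p)) (stype (n div 2) q) of (cp, s, cq, k) \<Rightarrow>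
       (\<Sum>(i, j)\<leftarrow>overtakes s k. f (lift_odd n (stype ((n + 1) div 2) p) cp s i)
          (lift_even n (stype (n div 2) (rev q)) cq k j)))"
proof -
  have n': "n \<ge> 3" "n \<ge> 2" using n by auto
  show ?thesis
    unfolding sum_odd_first[OF n'(1)]
  proof (rule sum.cong[OF refl], rule sum.cong[OF refl])
    fix p q assume p: "p \<in> free_perms ((n + 1) div 2)" and q: "q \<in> free_perms (n div 2)"
    obtain cp s cq k where r: "rect n (stype ((n + 1) div 2) (rev p)) (stype (n div 2) q) = (cp, s, cq, k)"
      by (metis prod_cases4)
    let ?C = "core n (odds p) (evens q)"
    have "(\<Sum>w\<in>?C. f (stype n (weave n (odds p) (evens q) w)) (stype n (rev (weave n (odds p) (evens q) w)))) =
      (\<Sum>w\<in>?C. f (lift_odd n (stype ((n + 1) div 2) p) cp s (length (takeWhile even w)))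
         (lift_even n (stype (n div 2) (rev q)) cq k (length (takeWhile odd (rev w)))))"
      by (rule sum.cong[OF refl]) (simp only: stype_weave[OF p q n r])
    also have "\<dots> = (\<Sum>(i, j)\<leftarrow>overtakes s k. f (lift_odd n (stype ((n + 1) div 2) p) cp s i)
          (lift_even n (stype (n div 2) (rev q)) cq k j))"
      using sum_core[OF p q n'(2), of "\<lambda>i j. f (lift_odd n (stype ((n + 1) div 2) p) cp s i)
          (lift_even n (stype (n div 2) (rev q)) cq k j)"] rect_core(1,2)[OF p q n'(2) r]
      by simp
    finally show "(\<Sum>w\<in>?C. f (stype n (weave n (odds p) (evens q) w)) (stype n (rev (weave n (odds p) (evens q) w)))) =
      (case rect n (stype ((n + 1) div 2) (rev p)) (stype (n div 2) q) of (cp, s, cq, k) \<Rightarrow>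
       (\<Sum>(i, j)\<leftarrow>overtakes s k. f (lift_odd n (stype ((n + 1) div 2) p) cp s i)
          (lift_even n (stype (n div 2) (rev q)) cq k j)))"
      unfolding r prod.case .
  qed
qed

section \<open>Tables for the joint distribution of the types of both ends\<close>

type_synonym table = "(stype \<times> (stype \<times> nat) list) list"

definition wsum :: "('a \<Rightarrow> nat) \<Rightarrow> ('a \<times> nat) list \<Rightarrow> nat" where
  "wsum g xs = (\<Sum>(t, c)\<leftarrow>xs. c * g t)"

definition tsum :: "(stype \<Rightarrow> stype \<Rightarrow> nat) \<Rightarrow> table \<Rightarrow> nat" where
  "tsum f T = (\<Sum>(s, row)\<leftarrow>T. wsum (f s) row)"

text \<open>A row holds the final types that occur together with one initial type, with
  multiplicities. Since a table is judged only by the sums it yields, the order of its entries and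
  repeated keys are immaterial.\<close>

definition represents :: "nat \<Rightarrow> table \<Rightarrow> bool" where
  "represents n T \<longleftrightarrow> (\<forall>f. (\<Sum>xs\<in>free_perms n. f (stype n xs) (stype n (rev xs))) = tsum f T)"

lemma wsum_Nil [simp]: "wsum g [] = 0"
  by (simp add: wsum_def)

lemma wsum_Cons [simp]: "wsum g ((t, c) # xs) = c * g t + wsum g xs"
  by (simp add: wsum_def)

lemma wsum_append [simp]: "wsum g (xs @ ys) = wsum g xs + wsum g ys"
  by (simp add: wsum_def)

lemma wsum_map: "wsum g (map (\<lambda>(t, c). (h t, k * c)) xs) = k * wsum (\<lambda>t. g (h t)) xs"
  by (induction xs) (auto simp: algebra_simps)

lemma wsum_add: "wsum (\<lambda>t. g t + h t) xs = wsum g xs + wsum h xs"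
  by (induction xs) (auto simp: algebra_simps)

lemma wsum_mult: "wsum (\<lambda>t. k * g t) xs = k * wsum g xs"
  by (induction xs) (auto simp: algebra_simps)

lemma wsum_cong: "(\<And>t c. (t, c) \<in> set xs \<Longrightarrow> g t = h t) \<Longrightarrow> wsum g xs = wsum h xs"
  unfolding wsum_def by (rule arg_cong[where f = sum_list], rule map_cong) auto

lemma tsum_Nil [simp]: "tsum f [] = 0"
  by (simp add: tsum_def)

lemma tsum_Cons [simp]: "tsum f ((s, row) # T) = wsum (f s) row + tsum f T"
  by (simp add: tsum_def)

lemma tsum_append [simp]: "tsum f (T @ T') = tsum f T + tsum f T'"
  by (simp add: tsum_def)

lemma representsD: "represents n T \<Longrightarrow> (\<Sum>xs\<in>free_perms n. f (stype n xs) (stype n (rev xs))) = tsum f T"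
  by (simp add: represents_def)

lemma sum_rev_free_perms: "(\<Sum>xs\<in>free_perms n. f (rev xs)) = (\<Sum>xs\<in>free_perms n. f xs)"
  by (rule sum.reindex_bij_betw[OF bij_rev_free_perms])

lemma free_perms_split:
  assumes "n \<ge> 2"
  shows "(\<Sum>xs\<in>free_perms n. f xs) = (\<Sum>xs\<in>odd_first n. f xs) + (\<Sum>xs\<in>odd_first n. f (rev xs) :: nat)"
proof -
  have "free_perms n = odd_first n \<union> rev ` odd_first n"
  proof (intro equalityI subsetI)
    fix xs assume xs: "xs \<in> free_perms n"
    have "prec xs 1 2 \<or> prec xs 2 1"
      by (rule prec_total) (use free_permsD(1)[OF xs] assms in auto)
    then show "xs \<in> odd_first n \<union> rev ` odd_first n"
    proof
      assume "prec xs 2 1"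
      then have "rev xs \<in> odd_first n" using xs rev_free_perms by (auto simp: odd_first_def prec_rev)
      then show ?thesis by (auto intro: image_eqI[of _ _ "rev xs"])
    qed (use xs in \<open>auto simp: odd_first_def\<close>)
  qed (auto simp: odd_first_def intro: rev_free_perms)
  moreover have "odd_first n \<inter> rev ` odd_first n = {}"
  proof (rule ccontr)
    assume "odd_first n \<inter> rev ` odd_first n \<noteq> {}"
    then obtain xs where "xs \<in> free_perms n" "prec xs 1 2" "prec xs 2 1"
      by (auto simp: odd_first_def prec_rev)
    then show False using prec_asym[OF free_permsD(2)] by blast
  qed
  ultimately have "(\<Sum>xs\<in>free_perms n. f xs) = (\<Sum>xs\<in>odd_first n. f xs) + (\<Sum>xs\<in>rev ` odd_first n. f xs)"
    by (simp add: sum.union_disjoint)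
  then show ?thesis by (simp add: sum.reindex)
qed

text \<open>
  The evaluation by rewriting re-normalises whatever stands below \<open>if\<close> or \<open>case\<close>. The functions with
  suffix \<open>_by\<close> therefore dispatch on an evaluated argument instead.
\<close>

datatype cmp = Lt | Eq | Gt

definition cmp_nat :: "nat \<Rightarrow> nat \<Rightarrow> cmp" where
  "cmp_nat a b = (if a < b then Lt else if a = b then Eq else Gt)"

fun cmp_snd :: "cmp \<Rightarrow> nat \<Rightarrow> nat \<Rightarrow> cmp" where
  "cmp_snd Lt h h' = Lt"
| "cmp_snd Eq h h' = cmp_nat h h'"
| "cmp_snd Gt h h' = Gt"

fun cmp_fst :: "cmp \<Rightarrow> nat \<Rightarrow> nat \<Rightarrow> nat \<Rightarrow> nat \<Rightarrow> cmp" where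
  "cmp_fst Lt l l' h h' = Lt"
| "cmp_fst Eq l l' h h' = cmp_snd (cmp_nat l l') h h'"
| "cmp_fst Gt l l' h h' = Gt"

fun cmp_stype :: "stype \<Rightarrow> stype \<Rightarrow> cmp" where
  "cmp_stype (x, l, h) (x', l', h') = cmp_fst (cmp_nat x x') l l' h h'"

lemma cmp_nat_Eq: "cmp_nat a b = Eq \<Longrightarrow> a = b"
  by (simp add: cmp_nat_def split: if_splits)

lemma cmp_snd_Eq: "cmp_snd c h h' = Eq \<Longrightarrow> c = Eq \<and> h = h'"
  by (cases c) (auto dest: cmp_nat_Eq)

lemma cmp_fst_Eq: "cmp_fst c l l' h h' = Eq \<Longrightarrow> c = Eq \<and> l = l' \<and> h = h'"
  by (cases c) (auto dest: cmp_snd_Eq cmp_nat_Eq)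

lemma cmp_stype_Eq: "cmp_stype s s' = Eq \<Longrightarrow> s = s'"
  by (cases s; cases s') (auto dest!: cmp_fst_Eq cmp_nat_Eq)

fun merge :: "(stype \<times> nat) list \<Rightarrow> (stype \<times> nat) list \<Rightarrow> (stype \<times> nat) list" where
  "merge [] ys = ys"
| "merge (x # xs) [] = x # xs"
| "merge ((k, c) # xs) ((l, d) # ys) =
    (case cmp_stype k l of
       Lt \<Rightarrow> (k, c) # merge xs ((l, d) # ys)
     | Eq \<Rightarrow> (k, c + d) # merge xs ys
     | Gt \<Rightarrow> (l, d) # merge ((k, c) # xs) ys)"

definition merge_by :: "cmp \<Rightarrow> stype \<Rightarrow> nat \<Rightarrow> (stype \<times> nat) list \<Rightarrow> stype \<Rightarrow> nat \<Rightarrow> (stype \<times> nat) list \<Rightarrow> (stype \<times> nat) list" where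
  "merge_by o' k c xs l d ys =
    (case o' of
       Lt \<Rightarrow> (k, c) # merge xs ((l, d) # ys)
     | Eq \<Rightarrow> (k, c + d) # merge xs ys
     | Gt \<Rightarrow> (l, d) # merge ((k, c) # xs) ys)"

lemma merge_by_code [code]:
  "merge_by Lt k c xs l d ys = (k, c) # merge xs ((l, d) # ys)"
  "merge_by Eq k c xs l d ys = (k, c + d) # merge xs ys"
  "merge_by Gt k c xs l d ys = (l, d) # merge ((k, c) # xs) ys"
  by (simp_all add: merge_by_def)

lemma merge_code [code]:
  "merge [] ys = ys"
  "merge (x # xs) [] = x # xs"
  "merge ((k, c) # xs) ((l, d) # ys) = merge_by (cmp_stype k l) k c xs l d ys"
  by (simp_all add: merge_by_def)

text \<open>Sortedness only makes the merged rows short. The identity holds for arbitrary rows, as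
  entries are combined only when their types are equal.\<close>

lemma wsum_merge [simp]: "wsum g (merge xs ys) = wsum g xs + wsum g ys"
  by (induction xs ys rule: merge.induct)
    (auto simp: algebra_simps dest!: cmp_stype_Eq split: cmp.split)

fun insert_row :: "stype \<Rightarrow> (stype \<times> nat) list \<Rightarrow> table \<Rightarrow> table" where
  "insert_row k row [] = [(k, row)]"
| "insert_row k row ((l, r) # T) = (if k = l then (l, merge row r) # T else (l, r) # insert_row k row T)"

definition insert_row_by :: "bool \<Rightarrow> stype \<Rightarrow> (stype \<times> nat) list \<Rightarrow> stype \<Rightarrow> (stype \<times> nat) list \<Rightarrow> table \<Rightarrow> table" where
  "insert_row_by b k row l r T = (if b then (l, merge row r) # T else (l, r) # insert_row k row T)"

lemma insert_row_by_code [code]: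
  "insert_row_by True k row l r T = (l, merge row r) # T"
  "insert_row_by False k row l r T = (l, r) # insert_row k row T"
  by (simp_all add: insert_row_by_def)

lemma insert_row_code [code]:
  "insert_row k row [] = [(k, row)]"
  "insert_row k row ((l, r) # T) = insert_row_by (k = l) k row l r T"
  by (simp_all add: insert_row_by_def)

lemma tsum_insert_row [simp]: "tsum f (insert_row k row T) = wsum (f k) row + tsum f T"
  by (induction k row T rule: insert_row.induct) auto

fun consolidate :: "table \<Rightarrow> table" where
  "consolidate [] = []"
| "consolidate ((k, row) # T) = insert_row k row (consolidate T)"

lemma tsum_consolidate [simp]: "tsum f (consolidate T) = tsum f T"
  by (induction T rule: consolidate.induct) auto

fun ways :: "nat \<Rightarrow> nat \<Rightarrow> nat" where
  "ways s k = (if s = 0 \<or> k = 0 then 1 else ways (s - 1) k + ways s (k - 1))"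

declare ways.simps [simp del]

lemma ways_0 [simp]: "ways 0 k = 1" "ways s 0 = 1"
  by (subst ways.simps, simp)+

lemma length_patterns: "length (patterns s k) = ways s k"
  by (induction s k rule: ways.induct) (subst patterns.simps, subst ways.simps, auto)

lemma length_overtakes: "length (overtakes s k) = ways s k"
  by (simp add: overtakes_def length_patterns)

text \<open>
  The functions below multiply two tables. A pair of entries is \<^emph>\<open>plain\<close> if shuffling the two blocks
  certainly affects neither the initial nor the final run, so that only the number of shuffles matters.
\<close>

type_synonym rdata = "nat \<times> nat \<times> nat \<times> nat"
type_synonym lifter = "stype \<Rightarrow> nat \<Rightarrow> nat \<Rightarrow> nat \<Rightarrow> stype"

fun max_run :: "stype \<Rightarrow> nat" where
  "max_run (x, l, h) = max l h"

fun row_bound :: "(stype \<times> nat) list \<Rightarrow> nat" where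
  "row_bound [] = 0"
| "row_bound ((t, c) # row) = max (max_run t) (row_bound row)"

lemma max_run_le_row_bound: "(t, c) \<in> set row \<Longrightarrow> max_run t \<le> row_bound row"
  by (induction row rule: row_bound.induct) auto

fun plain :: "nat \<Rightarrow> nat \<Rightarrow> nat \<Rightarrow> nat \<Rightarrow> rdata \<Rightarrow> bool" where
  "plain m1 m2 b1 b2 (ck, a, cr, b) =
    (if ck = 0 then True else if b1 + a < m1 then b2 + b < m2 else False)"

fun weight :: "rdata \<Rightarrow> nat" where
  "weight (ck, a, cr, b) = (if ck = 0 then 1 else ways a b)"

fun add_weight :: "bool \<Rightarrow> rdata \<Rightarrow> nat \<Rightarrow> nat \<Rightarrow> nat" where
  "add_weight True r c acc = c * weight r + acc"
| "add_weight False r c acc = acc"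

text \<open>All plain pairs in a cell lead to the same lifted types, so their weights are added
  before the row is touched. Only the remaining pairs are expanded shuffle by shuffle in
  \<open>extras\<close>.\<close>

fun coeff :: "nat \<Rightarrow> nat \<Rightarrow> nat \<Rightarrow> nat \<Rightarrow> (rdata \<times> nat) list \<Rightarrow> nat" where
  "coeff m1 m2 b1 b2 [] = 0"
| "coeff m1 m2 b1 b2 ((r, c) # rs) = add_weight (plain m1 m2 b1 b2 r) r c (coeff m1 m2 b1 b2 rs)"

fun expand :: "lifter \<Rightarrow> lifter \<Rightarrow> (nat \<Rightarrow> nat \<Rightarrow> (nat \<times> nat) list) \<Rightarrow> stype \<Rightarrow> (stype \<times> nat) list \<Rightarrow> nat \<Rightarrow> rdata \<Rightarrow> table" where
  "expand lk lr ov k rowr c (ck, a, cr, b) =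
    map (\<lambda>(i, j). (lk k ck a i, map (\<lambda>(t, d). (lr t cr b j, c * d)) rowr)) (ov a b)"

fun add_rows :: "bool \<Rightarrow> lifter \<Rightarrow> lifter \<Rightarrow> (nat \<Rightarrow> nat \<Rightarrow> (nat \<times> nat) list) \<Rightarrow> stype \<Rightarrow> (stype \<times> nat) list \<Rightarrow> nat \<Rightarrow> rdata \<Rightarrow> table \<Rightarrow> table" where
  "add_rows True lk lr ov k rowr c r acc = acc"
| "add_rows False lk lr ov k rowr c r acc = expand lk lr ov k rowr c r @ acc"

fun extras :: "nat \<Rightarrow> nat \<Rightarrow> lifter \<Rightarrow> lifter \<Rightarrow> (nat \<Rightarrow> nat \<Rightarrow> (nat \<times> nat) list) \<Rightarrow> stype \<Rightarrow> nat \<Rightarrow> (stype \<times> nat) list \<Rightarrow> (rdata \<times> nat) list \<Rightarrow> table" where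
  "extras m1 m2 lk lr ov k b2 rowr [] = []"
| "extras m1 m2 lk lr ov k b2 rowr ((r, c) # rs) =
    add_rows (plain m1 m2 (max_run k) b2 r) lk lr ov k rowr c r (extras m1 m2 lk lr ov k b2 rowr rs)"

fun scale_row_by :: "bool \<Rightarrow> nat \<Rightarrow> (stype \<times> nat) list \<Rightarrow> (stype \<times> nat) list" where
  "scale_row_by True c row = []"
| "scale_row_by False c [] = []"
| "scale_row_by False c ((t, d) # row) = (t, c * d) # scale_row_by False c row"

definition scale_row :: "nat \<Rightarrow> (stype \<times> nat) list \<Rightarrow> (stype \<times> nat) list" where
  "scale_row c row = scale_row_by (c = 0) c row"

fun lift_row :: "lifter \<Rightarrow> (stype \<times> nat) list \<Rightarrow> (stype \<times> nat) list" where
  "lift_row lr [] = []"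
| "lift_row lr ((t, c) # row) = (lr t 0 0 0, c) # lift_row lr row"

fun pair_row :: "(stype \<Rightarrow> stype \<Rightarrow> rdata) \<Rightarrow> stype \<Rightarrow> (stype \<times> nat) list \<Rightarrow> (rdata \<times> nat) list" where
  "pair_row rc v [] = []"
| "pair_row rc v ((u, c) # row) = (rc u v, c) # pair_row rc v row"

type_synonym cells = "((rdata \<times> nat) list \<times> nat \<times> (stype \<times> nat) list) list"

fun cells :: "(stype \<Rightarrow> stype \<Rightarrow> rdata) \<Rightarrow> (stype \<times> nat) list \<Rightarrow> (stype \<times> nat \<times> (stype \<times> nat) list) list \<Rightarrow> cells" where
  "cells rc row [] = []"
| "cells rc row ((v, b2, rowr) # T) = (pair_row rc v row, b2, rowr) # cells rc row T"

fun main_row :: "nat \<Rightarrow> nat \<Rightarrow> nat \<Rightarrow> cells \<Rightarrow> (stype \<times> nat) list" where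
  "main_row m1 m2 b1 [] = []"
| "main_row m1 m2 b1 ((rs, b2, rowr) # cs) =
    merge (scale_row (coeff m1 m2 b1 b2 rs) rowr) (main_row m1 m2 b1 cs)"

fun extra_rows :: "nat \<Rightarrow> nat \<Rightarrow> lifter \<Rightarrow> lifter \<Rightarrow> (nat \<Rightarrow> nat \<Rightarrow> (nat \<times> nat) list) \<Rightarrow> stype \<Rightarrow> cells \<Rightarrow> table" where
  "extra_rows m1 m2 lk lr ov k [] = []"
| "extra_rows m1 m2 lk lr ov k ((rs, b2, rowr) # cs) =
    extras m1 m2 lk lr ov k b2 rowr rs @ extra_rows m1 m2 lk lr ov k cs"

fun block :: "nat \<Rightarrow> nat \<Rightarrow> lifter \<Rightarrow> lifter \<Rightarrow> (nat \<Rightarrow> nat \<Rightarrow> (nat \<times> nat) list) \<Rightarrow> stype \<Rightarrow> cells \<Rightarrow> table" where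
  "block m1 m2 lk lr ov k cs =
    (lk k 0 0 0, lift_row lr (main_row m1 m2 (max_run k) cs)) # extra_rows m1 m2 lk lr ov k cs"

fun annotate :: "table \<Rightarrow> (stype \<times> nat \<times> (stype \<times> nat) list) list" where
  "annotate [] = []"
| "annotate ((v, row) # T) = (v, row_bound row, row) # annotate T"

fun mult_table :: "(stype \<Rightarrow> stype \<Rightarrow> rdata) \<Rightarrow> nat \<Rightarrow> nat \<Rightarrow> lifter \<Rightarrow> lifter \<Rightarrow> (nat \<Rightarrow> nat \<Rightarrow> (nat \<times> nat) list) \<Rightarrow> table \<Rightarrow>
    (stype \<times> nat \<times> (stype \<times> nat) list) list \<Rightarrow> table" where
  "mult_table rc m1 m2 lk lr ov [] T = []"
| "mult_table rc m1 m2 lk lr ov ((k, row) # T') T =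
    block m1 m2 lk lr ov k (cells rc row T) @ mult_table rc m1 m2 lk lr ov T' T"

text \<open>The contribution of one pair of entries, shuffle by shuffle: the specification against
  which the accelerated product is verified.\<close>

definition item :: "lifter \<Rightarrow> lifter \<Rightarrow> (nat \<Rightarrow> nat \<Rightarrow> (nat \<times> nat) list) \<Rightarrow> (stype \<Rightarrow> stype \<Rightarrow> nat) \<Rightarrow> stype \<Rightarrow> rdata \<Rightarrow> stype \<Rightarrow> nat" where
  "item lk lr ov f k r t = (case r of (ck, a, cr, b) \<Rightarrow> \<Sum>(i, j)\<leftarrow>ov a b. f (lk k ck a i) (lr t cr b j))"

lemma tsum_expand:
  "tsum f (expand lk lr ov k rowr c r) = c * wsum (item lk lr ov f k r) rowr"
proof -
  obtain ck a cr b where r: "r = (ck, a, cr, b)" by (metis prod_cases4)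
  have "tsum f (map (\<lambda>(i, j). (lk k ck a i, map (\<lambda>(t, d). (lr t cr b j, c * d)) rowr)) xs) =
     c * wsum (\<lambda>t. \<Sum>(i, j)\<leftarrow>xs. f (lk k ck a i) (lr t cr b j)) rowr" for xs
  proof (induction xs)
    case Nil
    then show ?case by (induction rowr) auto
  next
    case (Cons ij xs)
    then show ?case
      by (cases ij) (simp only: list.map prod.case tsum_Cons wsum_map sum_list.Cons wsum_add distrib_left)
  qed
  then show ?thesis by (simp add: r item_def[abs_def])
qed

lemma wsum_scale_row: "wsum g (scale_row c row) = c * wsum g row"
proof -
  have "wsum g (scale_row_by False c row) = c * wsum g row"
    by (induction row) (auto simp: algebra_simps)
  then show ?thesis by (cases "c = 0") (auto simp: scale_row_def)
qed

lemma wsum_lift_row: "wsum g (lift_row lr row) = wsum (\<lambda>t. g (lr t 0 0 0)) row"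
  by (induction lr row rule: lift_row.induct) auto

lemma wsum_pair_row: "wsum g (pair_row rc v row) = wsum (\<lambda>u. g (rc u v)) row"
  by (induction rc v row rule: pair_row.induct) auto

lemma set_pair_row: "(r, c) \<in> set (pair_row rc v row) \<Longrightarrow> \<exists>u. r = rc u v"
  by (induction rc v row rule: pair_row.induct) auto

context
  fixes rc :: "stype \<Rightarrow> stype \<Rightarrow> rdata" and lk lr :: lifter and ov :: "nat \<Rightarrow> nat \<Rightarrow> (nat \<times> nat) list"
    and m1 m2 :: nat
  assumes rc0: "\<And>u v. fst (rc u v) = 0 \<Longrightarrow> rc u v = (0, 0, 0, 0)"
    and lk1: "\<And>k ck a i. max_run k + a < m1 \<Longrightarrow> lk k ck a i = lk k 0 0 0"
    and lr1: "\<And>k ck a i. max_run k + a < m2 \<Longrightarrow> lr k ck a i = lr k 0 0 0"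
    and lk0: "\<And>k i. lk k 0 0 i = lk k 0 0 0" and lr0: "\<And>t i. lr t 0 0 i = lr t 0 0 0"
    and ov: "\<And>a b. length (ov a b) = ways a b"
begin

lemma item_plain:
  assumes "plain m1 m2 (max_run k) b2 r" "max_run t \<le> b2" and r0: "fst r = 0 \<Longrightarrow> r = (0, 0, 0, 0)"
  shows "item lk lr ov f k r t = weight r * f (lk k 0 0 0) (lr t 0 0 0)"
proof -
  obtain ck a cr b where r: "r = (ck, a, cr, b)" by (metis prod_cases4)
  have "lk k ck a i = lk k 0 0 0 \<and> lr t cr b j = lr t 0 0 0" for i j
  proof (cases "ck = 0")
    case True
    then show ?thesis using r0 r lk0 lr0 by auto
  next
    case False
    then have "max_run k + a < m1" "max_run t + b < m2"
      using assms(1,2) unfolding r by (auto split: if_splits)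
    then show ?thesis using lk1 lr1 by blast
  qed
  then have l: "lk k ck a i = lk k 0 0 0" and m: "lr t cr b j = lr t 0 0 0" for i j by auto
  have w: "weight r = ways a b" using r0 r by auto
  show ?thesis
    unfolding item_def w unfolding r prod.case l m by (simp only: split_def sum_list_triv ov of_nat_id)
qed

lemma wsum_extras:
  assumes "\<And>r c. (r, c) \<in> set rs \<Longrightarrow> fst r = 0 \<Longrightarrow> r = (0, 0, 0, 0)" "row_bound rowr \<le> b2"
  shows "coeff m1 m2 (max_run k) b2 rs * wsum (\<lambda>t. f (lk k 0 0 0) (lr t 0 0 0)) rowr +
      tsum f (extras m1 m2 lk lr ov k b2 rowr rs) = wsum (\<lambda>r. wsum (item lk lr ov f k r) rowr) rs"
  using assms(1)
proof (induction rs)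
  case (Cons rc' rs)
  obtain r c where rc': "rc' = (r, c)" by (cases rc') auto
  have IH: "coeff m1 m2 (max_run k) b2 rs * wsum (\<lambda>t. f (lk k 0 0 0) (lr t 0 0 0)) rowr +
      tsum f (extras m1 m2 lk lr ov k b2 rowr rs) = wsum (\<lambda>r. wsum (item lk lr ov f k r) rowr) rs"
    by (rule Cons.IH) (meson Cons.prems list.set_intros(2))
  have r0: "fst r = 0 \<Longrightarrow> r = (0, 0, 0, 0)"
    by (rule Cons.prems[of r c]) (simp_all add: rc')
  show ?case
  proof (cases "plain m1 m2 (max_run k) b2 r")
    case True
    have "wsum (item lk lr ov f k r) rowr = wsum (\<lambda>t. weight r * f (lk k 0 0 0) (lr t 0 0 0)) rowr"
      by (rule wsum_cong, rule item_plain[OF True _ r0])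
        (use max_run_le_row_bound assms(2) le_trans in blast)+
    then show ?thesis using IH True by (simp add: rc' wsum_mult algebra_simps)
  next
    case False
    then show ?thesis using IH by (simp add: rc' tsum_expand algebra_simps)
  qed
qed simp

lemma tsum_mult_table:
  "tsum f (mult_table rc m1 m2 lk lr ov T' (annotate T)) =
    tsum (\<lambda>k u. tsum (\<lambda>v t. item lk lr ov f k (rc u v) t) T) T'"
proof -
  have row: "wsum (f (lk k 0 0 0)) (lift_row lr (main_row m1 m2 (max_run k) (cells rc row (annotate T)))) +
      tsum f (extra_rows m1 m2 lk lr ov k (cells rc row (annotate T))) =
      wsum (\<lambda>u. tsum (\<lambda>v t. item lk lr ov f k (rc u v) t) T) row" for k row
  proof (induction T)
    case Nil
    then show ?case by (induction row) auto
  next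
    case (Cons vr T)
    obtain v rowr where vr: "vr = (v, rowr)" by (cases vr) auto
    let ?rs = "pair_row rc v row" and ?b = "row_bound rowr"
    have r0: "r = (0, 0, 0, 0)" if rs: "(r, c) \<in> set ?rs" and "fst r = 0" for r c
    proof -
      obtain u where "r = rc u v" using set_pair_row[OF rs] by blast
      then show ?thesis using rc0[of u v] that(2) by simp
    qed
    have "coeff m1 m2 (max_run k) ?b ?rs * wsum (\<lambda>t. f (lk k 0 0 0) (lr t 0 0 0)) rowr +
        tsum f (extras m1 m2 lk lr ov k ?b rowr ?rs) = wsum (\<lambda>r. wsum (item lk lr ov f k r) rowr) ?rs"
      by (rule wsum_extras[OF r0 order_refl])
    also have "\<dots> = wsum (\<lambda>u. wsum (item lk lr ov f k (rc u v)) rowr) row" by (rule wsum_pair_row)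
    finally show ?case using Cons.IH
      by (simp add: vr wsum_lift_row wsum_scale_row wsum_add)
  qed
  show ?thesis
  proof (induction T')
    case (Cons kr T')
    obtain k ro where "kr = (k, ro)" by (cases kr) auto
    then show ?case using Cons row[of k ro] by simp
  qed simp
qed

end

text \<open>A run is prolonged only if it and the block together fill the class, which the
  inequality rules out. This justifies treating such pairs as plain.\<close>

lemma lift_same: "max_run s + len < m \<Longrightarrow> lift n m X s c len i = lift n m X s 0 0 0"
  by (cases s) auto

lemma lift_0: "lift n m X s 0 0 i = lift n m X s 0 0 0"
  by (cases s) auto

lemma lift_odd_same: "max_run s + len < (n + 1) div 2 \<Longrightarrow> lift_odd n s c len i = lift_odd n s 0 0 0"
  unfolding lift_odd_def by (rule lift_same)

lemma lift_even_same: "max_run s + len < n div 2 \<Longrightarrow> lift_even n s c len i = lift_even n s 0 0 0"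
  unfolding lift_even_def by (rule lift_same)

lemma lift_odd_0: "lift_odd n s 0 0 i = lift_odd n s 0 0 0"
  unfolding lift_odd_def by (rule lift_0)

lemma lift_even_0: "lift_even n s 0 0 i = lift_even n s 0 0 0"
  unfolding lift_even_def by (rule lift_0)

fun swap_rect :: "rdata \<Rightarrow> rdata" where
  "swap_rect (cp, s, cq, k) = (cq, k, cp, s)"

definition rect_swap :: "nat \<Rightarrow> stype \<Rightarrow> stype \<Rightarrow> rdata" where
  "rect_swap n u v = swap_rect (rect n v u)"

definition swap_overtakes :: "nat \<Rightarrow> nat \<Rightarrow> (nat \<times> nat) list" where
  "swap_overtakes k s = map (\<lambda>(i, j). (j, i)) (overtakes s k)"

text \<open>The first product accounts for the permutations with 1 before 2, whose start comes from
  the odd and whose end comes from the even class. The second accounts for their reversals, with the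
  classes exchanged.\<close>

definition table_step :: "nat \<Rightarrow> table \<Rightarrow> table \<Rightarrow> table" where
  "table_step n Ta Tb = consolidate
     (mult_table (rect n) ((n + 1) div 2) (n div 2) (lift_odd n) (lift_even n) overtakes Ta (annotate Tb) @
      mult_table (rect_swap n) (n div 2) ((n + 1) div 2) (lift_even n) (lift_odd n) swap_overtakes Tb (annotate Ta))"

lemma ways_commute: "ways s k = ways k s"
proof (induction s k rule: ways.induct)
  case (1 s k)
  then show ?case by (subst (1 2) ways.simps) auto
qed

lemma rect_0: "fst (rect n e f) = 0 \<Longrightarrow> rect n e f = (0, 0, 0, 0)"
  "fst (rect_swap n e f) = 0 \<Longrightarrow> rect_swap n e f = (0, 0, 0, 0)"
  unfolding rect_swap_def by (cases e; cases f; auto split: if_splits)+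

lemma item_swap: "item lr lk swap_overtakes f t (swap_rect r) k = item lk lr overtakes (\<lambda>x y. f y x) k r t"
  by (cases r) (simp add: item_def swap_overtakes_def o_def split_def)

lemma represents_double:
  assumes "represents m T" "represents m' T'"
  shows "(\<Sum>p\<in>free_perms m. \<Sum>q\<in>free_perms m'. G (stype m p) (stype m (rev p)) (stype m' q) (stype m' (rev q))) =
    tsum (\<lambda>s e. tsum (G s e) T') T"
proof -
  have "(\<Sum>q\<in>free_perms m'. G s e (stype m' q) (stype m' (rev q))) = tsum (G s e) T'" for s e
    by (rule representsD[OF assms(2)])
  then show ?thesis using representsD[OF assms(1), of "\<lambda>s e. tsum (G s e) T'"] by simp
qed

lemma length_swap_overtakes: "length (swap_overtakes k s) = ways k s"
  by (simp add: swap_overtakes_def length_overtakes ways_commute)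

lemma sum_rev_rev:
  "(\<Sum>q\<in>free_perms b. \<Sum>p\<in>free_perms a. H (rev q) (rev p)) = (\<Sum>q\<in>free_perms b. \<Sum>p\<in>free_perms a. H q p)"
proof -
  have "(\<Sum>p\<in>free_perms a. H (rev q) (rev p)) = (\<Sum>p\<in>free_perms a. H (rev q) p)" for q
    by (rule sum_rev_free_perms)
  then show ?thesis using sum_rev_free_perms[of "\<lambda>q. \<Sum>p\<in>free_perms a. H q p" b] by simp
qed

definition rect_at :: "nat \<Rightarrow> nat \<Rightarrow> nat \<Rightarrow> nat \<Rightarrow> nat \<Rightarrow> nat \<Rightarrow> nat \<Rightarrow> rdata" where
  "rect_at n x y l h l' h' =
     (if x < y then (if 2 * x \<le> y then (if n + x < 2 * y then (1, l, 2, h') else (0, 0, 0, 0)) else (0, 0, 0, 0))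
      else if 2 * y \<le> x then (if n + y < 2 * x then (2, h, 1, l') else (0, 0, 0, 0)) else (0, 0, 0, 0))"

lemma rect_code [code]:
  "rect n (z, l, h) (y, l', h') = rect_at n (2 * z - 1) (2 * y) l h l' h'"
  by (auto simp: rect_at_def)

theorem represents_step:
  assumes a: "represents ((n + 1) div 2) Ta" and b: "represents (n div 2) Tb" and n: "n \<ge> 4"
  shows "represents n (table_step n Ta Tb)"
  unfolding represents_def
proof
  fix f :: "stype \<Rightarrow> stype \<Rightarrow> nat"
  let ?a = "(n + 1) div 2" and ?b = "n div 2"
  let ?sa = "stype ?a" and ?sb = "stype ?b"
  have n2: "n \<ge> 2" using n by simp
  have odd: "(\<Sum>xs\<in>odd_first n. g (stype n xs) (stype n (rev xs))) =
      (\<Sum>p\<in>free_perms ?a. \<Sum>q\<in>free_perms ?b.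
        item (lift_odd n) (lift_even n) overtakes g (?sa p) (rect n (?sa (rev p)) (?sb q)) (?sb (rev q)))" for g
    unfolding sum_odd_first_stype[OF n] item_def ..
  have 1: "(\<Sum>xs\<in>odd_first n. f (stype n xs) (stype n (rev xs))) =
      tsum f (mult_table (rect n) ?a ?b (lift_odd n) (lift_even n) overtakes Ta (annotate Tb))"
    unfolding odd
      represents_double[OF a b, of "\<lambda>s e v z. item (lift_odd n) (lift_even n) overtakes f s (rect n e v) z"]
    by (rule tsum_mult_table[symmetric])
      (rule lift_odd_0 lift_even_0 length_overtakes | erule rect_0(1) lift_odd_same lift_even_same)+
  have "(\<Sum>xs\<in>odd_first n. f (stype n (rev xs)) (stype n xs)) =
      (\<Sum>p\<in>free_perms ?a. \<Sum>q\<in>free_perms ?b.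
        item (lift_even n) (lift_odd n) swap_overtakes f (?sb (rev q)) (rect_swap n (?sb q) (?sa (rev p))) (?sa p))"
    using odd[of "\<lambda>x y. f y x"] unfolding rect_swap_def item_swap .
  also have "\<dots> = (\<Sum>q\<in>free_perms ?b. \<Sum>p\<in>free_perms ?a.
        item (lift_even n) (lift_odd n) swap_overtakes f (?sb (rev q)) (rect_swap n (?sb q) (?sa (rev p))) (?sa p))"
    by (rule sum.swap)
  \<comment> \<open>Reversing both classes makes the outer end of \<open>q\<close> the key and its
    inner end the row entry, while for \<open>p\<close> the inner end becomes the key. This is the
    arrangement in which \<open>mult_table\<close> reads its two tables.\<close>
  also have "\<dots> = (\<Sum>q\<in>free_perms ?b. \<Sum>p\<in>free_perms ?a.
        item (lift_even n) (lift_odd n) swap_overtakes f (?sb q) (rect_swap n (?sb (rev q)) (?sa p)) (?sa (rev p)))"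
    using sum_rev_rev[where a = ?a and b = ?b and H = "\<lambda>q p. item (lift_even n) (lift_odd n) swap_overtakes f (?sb q)
        (rect_swap n (?sb (rev q)) (?sa p)) (?sa (rev p))"]
    unfolding rev_rev_ident .
  also have "\<dots> = tsum f (mult_table (rect_swap n) ?b ?a (lift_even n) (lift_odd n) swap_overtakes Tb (annotate Ta))"
    unfolding represents_double[OF b a, of "\<lambda>k u v t. item (lift_even n) (lift_odd n) swap_overtakes f k (rect_swap n u v) t"]
    by (rule tsum_mult_table[symmetric])
      (rule lift_odd_0 lift_even_0 length_swap_overtakes | erule rect_0(2) lift_odd_same lift_even_same)+
  finally have 2: "(\<Sum>xs\<in>odd_first n. f (stype n (rev xs)) (stype n xs)) =
    tsum f (mult_table (rect_swap n) ?b ?a (lift_even n) (lift_odd n) swap_overtakes Tb (annotate Ta))" .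
  show "(\<Sum>xs\<in>free_perms n. f (stype n xs) (stype n (rev xs))) = tsum f (table_step n Ta Tb)"
    unfolding free_perms_split[OF n2] rev_rev_ident 1 2 by (simp add: table_step_def)
qed

lemma free_perms_2: "free_perms 2 = {[1, 2], [2, 1]}"
proof (intro equalityI subsetI)
  fix xs assume xs: "xs \<in> free_perms 2"
  note F = free_permsD[OF xs]
  obtain a b where ab: "xs = [a, b]" using F(3) by (auto simp: numeral_eq_Suc length_Suc_conv)
  have m: "a \<in> {1..2}" "b \<in> {1..2}" "a \<noteq> b" unfolding F(1)[symmetric] using F(2) ab by auto
  then have "a = 1 \<or> a = 2" "b = 1 \<or> b = 2" by auto
  then show "xs \<in> {[1, 2], [2, 1]}" using m(3) ab by auto
next
  fix xs :: "nat list" assume xs: "xs \<in> {[1, 2], [2, 1]}"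
  then have "set xs = {1..2}" "distinct xs" by (elim insertE emptyE; force)+
  moreover have "length xs = 2" using xs by auto
  then have "three_free xs" unfolding three_free_def by auto
  ultimately show "xs \<in> free_perms 2" by (simp only: free_perms_iff)
qed

lemma free_perms_3: "free_perms 3 = {[1, 3, 2], [2, 1, 3], [2, 3, 1], [3, 1, 2]}"
proof (intro equalityI subsetI)
  fix xs assume xs: "xs \<in> free_perms 3"
  note F = free_permsD[OF xs]
  obtain a b c where ab: "xs = [a, b, c]" using F(3) by (auto simp: numeral_eq_Suc length_Suc_conv)
  have m: "a \<in> {1..3}" "b \<in> {1..3}" "c \<in> {1..3}" "a \<noteq> b" "a \<noteq> c" "b \<noteq> c"
    unfolding F(1)[symmetric] using F(2) ab by auto
  then have "a = 1 \<or> a = 2 \<or> a = 3" "b = 1 \<or> b = 2 \<or> b = 3" "c = 1 \<or> c = 2 \<or> c = 3" by auto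
  moreover have "\<not> (a + c = 2 * b)" using F(4)[of a c b] ab by auto
  ultimately show "xs \<in> {[1, 3, 2], [2, 1, 3], [2, 3, 1], [3, 1, 2]}" using m(4-6) ab by auto
next
  fix xs :: "nat list" assume xs: "xs \<in> {[1, 3, 2], [2, 1, 3], [2, 3, 1], [3, 1, 2]}"
  then have s: "set xs = {1..3}" "distinct xs" by (elim insertE emptyE; force)+
  have "three_free xs" unfolding three_free_iff[OF s(2)] using xs by auto
  then show "xs \<in> free_perms 3" using s by (simp only: free_perms_iff)
qed

lemma represents_2: "represents 2 [((1, 1, 0), [((2, 0, 1), 1)]), ((2, 0, 1), [((1, 1, 0), 1)])]"
  by (simp add: represents_def free_perms_2 stype_def run_def hrun_def)

lemma represents_3: "represents 3 [((1, 1, 0), [((2, 1, 2), 1)]), ((2, 1, 2), [((1, 1, 0), 1)]),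
    ((2, 2, 1), [((3, 0, 1), 1)]), ((3, 0, 1), [((2, 2, 1), 1)])]"
  unfolding represents_def free_perms_3 by (simp add: stype_def run_def hrun_def numeral_2_eq_2 numeral_3_eq_3 algebra_simps)

lemma represents_table_step:
  "represents m Ta \<Longrightarrow> represents k Tb \<Longrightarrow> m = (n + 1) div 2 \<Longrightarrow> k = n div 2 \<Longrightarrow> n \<ge> 4 \<Longrightarrow>
    table_step n Ta Tb = T \<Longrightarrow> represents n T"
  using represents_step by blast

\<comment> \<open>The table is left open in the statement and is instantiated by the evaluation of
  \<open>table_step\<close>.\<close>
schematic_goal represents_4: "represents 4 ?T"
  by (rule represents_table_step[OF represents_2 represents_2], simp, simp, simp, code_simp)
schematic_goal represents_5: "represents 5 ?T"
  by (rule represents_table_step[OF represents_3 represents_2], simp, simp, simp, code_simp)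
schematic_goal represents_6: "represents 6 ?T"
  by (rule represents_table_step[OF represents_3 represents_3], simp, simp, simp, code_simp)
schematic_goal represents_7: "represents 7 ?T"
  by (rule represents_table_step[OF represents_4 represents_3], simp, simp, simp, code_simp)
schematic_goal represents_8: "represents 8 ?T"
  by (rule represents_table_step[OF represents_4 represents_4], simp, simp, simp, code_simp)
schematic_goal represents_9: "represents 9 ?T"
  by (rule represents_table_step[OF represents_5 represents_4], simp, simp, simp, code_simp)

section \<open>Distribution of the initial type alone, and short runs\<close>

definition represents1 :: "nat \<Rightarrow> (stype \<times> nat) list \<Rightarrow> bool" where
  "represents1 n S \<longleftrightarrow> (\<forall>f. (\<Sum>xs\<in>free_perms n. f (stype n xs)) = wsum f S)"

lemma represents1D: "represents1 n S \<Longrightarrow> (\<Sum>xs\<in>free_perms n. f (stype n xs)) = wsum f S"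
  by (simp add: represents1_def)

fun row_total :: "(stype \<times> nat) list \<Rightarrow> nat" where
  "row_total [] = 0"
| "row_total ((t, c) # row) = c + row_total row"

lemma wsum_const: "wsum (\<lambda>_. k) row = row_total row * k"
  by (induction row rule: row_total.induct) (auto simp: algebra_simps)

fun start_table :: "table \<Rightarrow> (stype \<times> nat) list" where
  "start_table [] = []"
| "start_table ((s, row) # T) = (s, row_total row) # start_table T"

lemma represents1_start_table:
  assumes "represents n T"
  shows "represents1 n (start_table T)"
  unfolding represents1_def
proof
  fix f
  have "wsum f (start_table T) = tsum (\<lambda>s _. f s) T"
    by (induction T rule: start_table.induct) (auto simp: wsum_const)
  then show "(\<Sum>xs\<in>free_perms n. f (stype n xs)) = wsum f (start_table T)"
    using representsD[OF assms, of "\<lambda>s _. f s"] by simp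
qed

text \<open>Apply the representation to the indicator function of the types absent from
  \<open>S\<close>: its sum is 0, so no permutation has such a type. This turns checks on a table
  into statements about all permutations.\<close>

lemma represents1_support:
  assumes "represents1 n S" "xs \<in> free_perms n"
  shows "stype n xs \<in> fst ` set S"
proof -
  let ?f = "\<lambda>s. if s \<in> fst ` set S then 0 else 1 :: nat"
  have "wsum ?f S = wsum (\<lambda>_. 0) S" by (rule wsum_cong) force
  also have "\<dots> = 0" by (induction S) auto
  finally have "(\<Sum>xs\<in>free_perms n. ?f (stype n xs)) = 0" using represents1D[OF assms(1), of ?f] by simp
  then have "\<forall>ys\<in>free_perms n. ?f (stype n ys) = 0" by (simp only: sum_eq_0_iff[OF finite_free_perms])
  then have "?f (stype n xs) = 0" using assms(2) by (rule bspec)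
  then show ?thesis by (simp split: if_splits)
qed

text \<open>If runs and blocks are both shorter than half of a class, they cannot fill it together.
  Shuffling then leaves the types at the outer ends alone, and only the number of shuffles
  matters.\<close>

definition short_runs :: "nat \<Rightarrow> bool" where
  "short_runs m \<longleftrightarrow> (\<forall>xs\<in>free_perms m. 2 * fst (snd (stype m xs)) < m \<and> 2 * snd (snd (stype m xs)) < m)"

fun short_table :: "nat \<Rightarrow> (stype \<times> nat) list \<Rightarrow> bool" where
  "short_table m [] \<longleftrightarrow> True"
| "short_table m (((x, l, h), c) # S) \<longleftrightarrow> 2 * l < m \<and> 2 * h < m \<and> short_table m S"

lemma short_table_iff: "short_table m S \<longleftrightarrow> (\<forall>((x, l, h), c)\<in>set S. 2 * l < m \<and> 2 * h < m)"
  by (induction m S rule: short_table.induct) auto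

lemma short_runsI:
  assumes "represents1 m S" "short_table m S"
  shows "short_runs m"
  unfolding short_runs_def
proof
  fix xs assume "xs \<in> free_perms m"
  from represents1_support[OF assms(1) this]
  show "2 * fst (snd (stype m xs)) < m \<and> 2 * snd (snd (stype m xs)) < m"
    using assms(2) by (auto simp: short_table_iff)
qed

lemma rect_cases:
  "rect n e v = (0, 0, 0, 0) \<or> rect n e v = (1, fst (snd e), 2, snd (snd v)) \<or>
    rect n e v = (2, snd (snd e), 1, fst (snd v))"
  by (cases e; cases v) auto

lemma lift_short: "2 * fst (snd s) < m \<Longrightarrow> 2 * snd (snd s) < m \<Longrightarrow> 2 * len < m \<Longrightarrow> lift n m X s c len i = lift n m X s 0 0 0"
  by (cases s) auto

lemma weight_rect:
  "rect n e v = (c, s, d, k) \<Longrightarrow> weight (rect n e v) = ways s k"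
  using rect_cases[of n e v] by auto

lemma sum_odd_first_short:
  fixes f :: "stype \<Rightarrow> stype \<Rightarrow> nat"
  assumes n: "n \<ge> 4" and a: "short_runs ((n + 1) div 2)" and b: "short_runs (n div 2)"
  shows "(\<Sum>xs\<in>odd_first n. f (stype n xs) (stype n (rev xs))) =
    (\<Sum>p\<in>free_perms ((n + 1) div 2). \<Sum>q\<in>free_perms (n div 2).
      weight (rect n (stype ((n + 1) div 2) (rev p)) (stype (n div 2) q)) *
      f (lift_odd n (stype ((n + 1) div 2) p) 0 0 0) (lift_even n (stype (n div 2) (rev q)) 0 0 0))"
  unfolding sum_odd_first_stype[OF n]
proof (rule sum.cong[OF refl], rule sum.cong[OF refl])
  fix p q assume p: "p \<in> free_perms ((n + 1) div 2)" and q: "q \<in> free_perms (n div 2)"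
  let ?sp = "stype ((n + 1) div 2) p" and ?ep = "stype ((n + 1) div 2) (rev p)"
    and ?sq = "stype (n div 2) q" and ?eq = "stype (n div 2) (rev q)"
  obtain c s d k where r: "rect n ?ep ?sq = (c, s, d, k)" by (metis prod_cases4)
  note A = a[unfolded short_runs_def, rule_format] and B = b[unfolded short_runs_def, rule_format]
  have "2 * s < (n + 1) div 2" "2 * k < n div 2"
    using r A[OF rev_free_perms[OF p]] B[OF q] n rect_cases[of n ?ep ?sq] by auto
  then have "lift_odd n ?sp c s i = lift_odd n ?sp 0 0 0" "lift_even n ?eq d k j = lift_even n ?eq 0 0 0" for i j
    unfolding lift_odd_def lift_even_def using A[OF p] B[OF rev_free_perms[OF q]] lift_short by blast+
  then show "(case rect n ?ep ?sq of (cp, s, cq, k) \<Rightarrow>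
       \<Sum>(i, j)\<leftarrow>overtakes s k. f (lift_odd n ?sp cp s i) (lift_even n ?eq cq k j)) =
     weight (rect n ?ep ?sq) * f (lift_odd n ?sp 0 0 0) (lift_even n ?eq 0 0 0)"
    unfolding weight_rect[OF r] unfolding r prod.case
    by (simp only: split_def sum_list_triv length_overtakes of_nat_id)
qed

fun odd_weight :: "nat \<Rightarrow> stype \<Rightarrow> (stype \<times> nat) list \<Rightarrow> nat" where
  "odd_weight n e [] = 0"
| "odd_weight n e ((v, d) # S) = d * weight (rect n e v) + odd_weight n e S"

fun even_weight :: "nat \<Rightarrow> stype \<Rightarrow> (stype \<times> nat) list \<Rightarrow> nat" where
  "even_weight n v [] = 0"
| "even_weight n v ((e, d) # S) = d * weight (rect n e v) + even_weight n v S"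

lemma odd_weight_wsum: "odd_weight n e S = wsum (\<lambda>v. weight (rect n e v)) S"
  by (induction n e S rule: odd_weight.induct) auto

lemma even_weight_wsum: "even_weight n v S = wsum (\<lambda>e. weight (rect n e v)) S"
  by (induction n v S rule: even_weight.induct) auto

fun collect_odd :: "nat \<Rightarrow> (stype \<times> nat) list \<Rightarrow> table \<Rightarrow> (stype \<times> nat) list" where
  "collect_odd n S [] = []"
| "collect_odd n S ((e, row) # T) = merge (scale_row (odd_weight n e S) row) (collect_odd n S T)"

fun collect_even :: "nat \<Rightarrow> (stype \<times> nat) list \<Rightarrow> table \<Rightarrow> (stype \<times> nat) list" where
  "collect_even n S [] = []"
| "collect_even n S ((v, row) # T) = merge (scale_row (even_weight n v S) row) (collect_even n S T)"

lemma wsum_collect_odd: "wsum g (collect_odd n S T) = tsum (\<lambda>e s. wsum (\<lambda>v. weight (rect n e v)) S * g s) T"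
  by (induction n S T rule: collect_odd.induct) (auto simp: wsum_scale_row wsum_mult odd_weight_wsum)

lemma wsum_collect_even: "wsum g (collect_even n S T) = tsum (\<lambda>v s. wsum (\<lambda>e. weight (rect n e v)) S * g s) T"
  by (induction n S T rule: collect_even.induct) (auto simp: wsum_scale_row wsum_mult even_weight_wsum)

text \<open>The joint tables of the two halves are used once more: the inner end of each class is
  weighted by its shuffles with the other class, and the outer end survives as a start. The even
  class supplies the starts of the reversed permutations.\<close>

definition start_step :: "nat \<Rightarrow> table \<Rightarrow> (stype \<times> nat) list \<Rightarrow> table \<Rightarrow> (stype \<times> nat) list \<Rightarrow> (stype \<times> nat) list" where
  "start_step n Ta Sa Tb Sb =
    lift_row (lift_odd n) (collect_odd n Sb Ta) @ lift_row (lift_even n) (collect_even n Sa Tb)"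

theorem represents1_step:
  assumes a: "represents ((n + 1) div 2) Ta" and b: "represents (n div 2) Tb" and n: "n \<ge> 4"
    and sa: "short_table ((n + 1) div 2) (start_table Ta)" and sb: "short_table (n div 2) (start_table Tb)"
  shows "represents1 n (start_step n Ta (start_table Ta) Tb (start_table Tb))"
  unfolding represents1_def
proof
  fix f :: "stype \<Rightarrow> nat"
  let ?a = "(n + 1) div 2" and ?b = "n div 2"
  let ?sa = "stype ?a" and ?sb = "stype ?b"
  let ?Sa = "start_table Ta" and ?Sb = "start_table Tb"
  let ?w = "\<lambda>e v. weight (rect n e v)"
  have n2: "n \<ge> 2" using n by simp
  note Ra = represents1_start_table[OF a] and Rb = represents1_start_table[OF b]
  note short = sum_odd_first_short[OF n short_runsI[OF Ra sa] short_runsI[OF Rb sb]]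
  have inner_b: "(\<Sum>q\<in>free_perms ?b. ?w e (?sb q)) = wsum (?w e) ?Sb" for e
    by (rule represents1D[OF Rb])
  have inner_a: "(\<Sum>p\<in>free_perms ?a. ?w (?sa p) v) = wsum (\<lambda>e. ?w e v) ?Sa" for v
    by (rule represents1D[OF Ra])
  have "(\<Sum>xs\<in>odd_first n. f (stype n xs)) =
    (\<Sum>p\<in>free_perms ?a. \<Sum>q\<in>free_perms ?b. ?w (?sa (rev p)) (?sb q) * f (lift_odd n (?sa p) 0 0 0))"
    by (rule short[of "\<lambda>x y. f x"])
  also have "\<dots> = (\<Sum>p\<in>free_perms ?a. (\<Sum>q\<in>free_perms ?b. ?w (?sa (rev p)) (?sb q)) * f (lift_odd n (?sa p) 0 0 0))"
    by (simp add: sum_distrib_right)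
  also have "\<dots> = (\<Sum>p\<in>free_perms ?a. wsum (?w (?sa (rev p))) ?Sb * f (lift_odd n (?sa p) 0 0 0))"
    by (simp only: inner_b)
  \<comment> \<open>Reversal symmetry moves the inner end of \<open>p\<close> to the key of the
    table and the outer end into the row.\<close>
  also have "\<dots> = (\<Sum>p\<in>free_perms ?a. wsum (?w (?sa p)) ?Sb * f (lift_odd n (?sa (rev p)) 0 0 0))"
    using sum_rev_free_perms[of "\<lambda>p. wsum (?w (?sa p)) ?Sb * f (lift_odd n (?sa (rev p)) 0 0 0)" ?a]
    unfolding rev_rev_ident .
  also have "\<dots> = tsum (\<lambda>e s. wsum (?w e) ?Sb * f (lift_odd n s 0 0 0)) Ta"
    by (rule representsD[OF a])
  finally have 1: "(\<Sum>xs\<in>odd_first n. f (stype n xs)) = tsum (\<lambda>e s. wsum (?w e) ?Sb * f (lift_odd n s 0 0 0)) Ta" .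
  have "(\<Sum>xs\<in>odd_first n. f (stype n (rev xs))) =
    (\<Sum>p\<in>free_perms ?a. \<Sum>q\<in>free_perms ?b. ?w (?sa (rev p)) (?sb q) * f (lift_even n (?sb (rev q)) 0 0 0))"
    by (rule short[of "\<lambda>x y. f y"])
  also have "\<dots> = (\<Sum>q\<in>free_perms ?b. \<Sum>p\<in>free_perms ?a. ?w (?sa (rev p)) (?sb q) * f (lift_even n (?sb (rev q)) 0 0 0))"
    by (rule sum.swap)
  also have "\<dots> = (\<Sum>q\<in>free_perms ?b. (\<Sum>p\<in>free_perms ?a. ?w (?sa (rev p)) (?sb q)) * f (lift_even n (?sb (rev q)) 0 0 0))"
    by (simp add: sum_distrib_right)
  also have "\<dots> = (\<Sum>q\<in>free_perms ?b. (\<Sum>p\<in>free_perms ?a. ?w (?sa p) (?sb q)) * f (lift_even n (?sb (rev q)) 0 0 0))"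
    using sum_rev_free_perms[of "\<lambda>p. ?w (?sa p) v" ?a for v] by simp
  also have "\<dots> = (\<Sum>q\<in>free_perms ?b. wsum (\<lambda>e. ?w e (?sb q)) ?Sa * f (lift_even n (?sb (rev q)) 0 0 0))"
    by (simp only: inner_a)
  also have "\<dots> = tsum (\<lambda>v s. wsum (\<lambda>e. ?w e v) ?Sa * f (lift_even n s 0 0 0)) Tb"
    by (rule representsD[OF b])
  finally have 2: "(\<Sum>xs\<in>odd_first n. f (stype n (rev xs))) =
    tsum (\<lambda>v s. wsum (\<lambda>e. ?w e v) ?Sa * f (lift_even n s 0 0 0)) Tb" .
  show "(\<Sum>xs\<in>free_perms n. f (stype n xs)) = wsum f (start_step n Ta ?Sa Tb ?Sb)"
    unfolding free_perms_split[OF n2] 1 2 by (simp add: start_step_def wsum_lift_row wsum_collect_odd wsum_collect_even)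
qed

text \<open>The factor 2 accounts for reversal. The odd class may be reversed under the sum, so that
  only initial types appear.\<close>

lemma theta_sum:
  assumes n: "n \<ge> 4"
  shows "theta n = 2 * (\<Sum>p\<in>free_perms ((n + 1) div 2). \<Sum>q\<in>free_perms (n div 2).
      weight (rect n (stype ((n + 1) div 2) p) (stype (n div 2) q)))"
proof -
  let ?a = "(n + 1) div 2" and ?b = "n div 2"
  have n2: "n \<ge> 2" using n by simp
  have "theta n = 2 * (\<Sum>xs\<in>odd_first n. 1)"
    using free_perms_split[OF n2, of "\<lambda>_. 1"] by (simp add: theta_card)
  also have "(\<Sum>xs\<in>odd_first n. 1::nat) = (\<Sum>p\<in>free_perms ?a. \<Sum>q\<in>free_perms ?b.
      weight (rect n (stype ?a (rev p)) (stype ?b q)))"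
    unfolding sum_odd_first_stype[OF n, of "\<lambda>_ _. 1"]
  proof (rule sum.cong[OF refl], rule sum.cong[OF refl])
    fix p q
    obtain c s d k where r: "rect n (stype ?a (rev p)) (stype ?b q) = (c, s, d, k)" by (metis prod_cases4)
    show "(case rect n (stype ?a (rev p)) (stype ?b q) of (cp, s, cq, k) \<Rightarrow> \<Sum>(i, j)\<leftarrow>overtakes s k. 1) =
        weight (rect n (stype ?a (rev p)) (stype ?b q))"
      unfolding weight_rect[OF r] unfolding r prod.case
      by (simp only: split_def sum_list_triv length_overtakes of_nat_id mult_1_right)
  qed
  also have "\<dots> = (\<Sum>p\<in>free_perms ?a. \<Sum>q\<in>free_perms ?b. weight (rect n (stype ?a p) (stype ?b q)))"
    by (rule sum_rev_free_perms)
  finally show ?thesis .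
qed

fun pair_weight :: "nat \<Rightarrow> (stype \<times> nat) list \<Rightarrow> (stype \<times> nat) list \<Rightarrow> nat" where
  "pair_weight n [] Sb = 0"
| "pair_weight n ((e, c) # Sa) Sb = c * odd_weight n e Sb + pair_weight n Sa Sb"

lemma theta_from_starts:
  assumes "represents1 a Sa" "represents1 b Sb" "a = (n + 1) div 2" "b = n div 2" "n \<ge> 4"
    "2 * pair_weight n Sa Sb = N"
  shows "theta n = N"
proof -
  have "pair_weight n Sa Sb = wsum (\<lambda>e. wsum (\<lambda>v. weight (rect n e v)) Sb) Sa"
    by (induction n Sa Sb rule: pair_weight.induct) (auto simp: odd_weight_wsum)
  also have "\<dots> = (\<Sum>p\<in>free_perms a. wsum (\<lambda>v. weight (rect n (stype a p) v)) Sb)"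
    by (rule represents1D[OF assms(1), symmetric])
  also have "\<dots> = (\<Sum>p\<in>free_perms a. \<Sum>q\<in>free_perms b. weight (rect n (stype a p) (stype b q)))"
    by (rule sum.cong[OF refl], rule represents1D[OF assms(2), symmetric])
  finally show ?thesis
    using theta_sum[OF assms(5)] assms(6) unfolding assms(3,4) by simp
qed

lemma represents1_from_table:
  "represents m T \<Longrightarrow> start_table T = S \<Longrightarrow> represents1 m S"
  using represents1_start_table by blast

lemma represents1_start_step_eq:
  "represents m Ta \<Longrightarrow> represents k Tb \<Longrightarrow> m = (n + 1) div 2 \<Longrightarrow> k = n div 2 \<Longrightarrow> n \<ge> 4 \<Longrightarrow>
    short_table m (start_table Ta) \<Longrightarrow> short_table k (start_table Tb) \<Longrightarrow>
    start_step n Ta (start_table Ta) Tb (start_table Tb) = S \<Longrightarrow> represents1 n S"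
  using represents1_step by blast

lemma stype_odd_first:
  assumes xs: "xs \<in> odd_first n" and n: "n \<ge> 4" and a: "short_runs ((n + 1) div 2)" and b: "short_runs (n div 2)"
  obtains p q where "p \<in> free_perms ((n + 1) div 2)" "q \<in> free_perms (n div 2)"
    "stype n xs = lift_odd n (stype ((n + 1) div 2) p) 0 0 0"
    "stype n (rev xs) = lift_even n (stype (n div 2) q) 0 0 0"
proof -
  have n2: "n \<ge> 2" using n by simp
  obtain p where p: "p \<in> free_perms ((n + 1) div 2)" "filter odd xs = odds p"
    using filter_odd_free_perms[OF odd_firstD[OF xs]] .
  obtain q where q: "q \<in> free_perms (n div 2)" "filter even xs = evens q"
    using filter_even_free_perms[OF odd_firstD[OF xs]] .
  obtain w where w: "w \<in> core n (odds p) (evens q)" "xs = weave n (odds p) (evens q) w"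
    using odd_first_is_weave[OF xs p q n2] by blast
  let ?ep = "stype ((n + 1) div 2) (rev p)" and ?sq = "stype (n div 2) q"
  obtain c s d k where r: "rect n ?ep ?sq = (c, s, d, k)" by (metis prod_cases4)
  note A = a[unfolded short_runs_def, rule_format] and B = b[unfolded short_runs_def, rule_format]
  have sk: "2 * s < (n + 1) div 2" "2 * k < n div 2"
    using r A[OF rev_free_perms[OF p(1)]] B[OF q(1)] n rect_cases[of n ?ep ?sq] by auto
  have "stype n xs = lift_odd n (stype ((n + 1) div 2) p) 0 0 0"
    unfolding w(2) stype_weave(1)[OF p(1) q(1) n r w(1)] lift_odd_def
    using A[OF p(1)] sk lift_short by blast
  moreover have "stype n (rev xs) = lift_even n (stype (n div 2) (rev q)) 0 0 0"
    unfolding w(2) stype_weave(2)[OF p(1) q(1) n r w(1)] lift_even_def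
    using B[OF rev_free_perms[OF q(1)]] sk lift_short by blast
  ultimately show ?thesis using that p(1) rev_free_perms[OF q(1)] by blast
qed

lemma stype_half:
  assumes xs: "xs \<in> free_perms n" and n: "n \<ge> 4" and a: "short_runs ((n + 1) div 2)" and b: "short_runs (n div 2)"
  obtains p where "p \<in> free_perms ((n + 1) div 2)" "stype n xs = lift_odd n (stype ((n + 1) div 2) p) 0 0 0"
  | q where "q \<in> free_perms (n div 2)" "stype n xs = lift_even n (stype (n div 2) q) 0 0 0"
proof (cases "xs \<in> odd_first n")
  case True
  then show ?thesis using stype_odd_first[OF True n a b] that(1) by metis
next
  case False
  have "prec xs 1 2 \<or> prec xs 2 1"
    by (rule prec_total) (use free_permsD(1)[OF xs] n in auto)
  then have "rev xs \<in> odd_first n"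
    using False xs rev_free_perms by (auto simp: odd_first_def prec_rev)
  from stype_odd_first[OF this n a b] that(2) show ?thesis by (metis rev_rev_ident)
qed

lemma lift_le:
  "fst (snd (lift n m X s 0 0 0)) \<le> fst (snd s)" "snd (snd (lift n m X s 0 0 0)) \<le> snd (snd s)"
  by (cases s; simp)+

text \<open>A run is inherited from a parity class without growing, whereas the length of the
  permutation about doubles.\<close>

lemma short_runs_step:
  assumes "n \<ge> 4" "short_runs ((n + 1) div 2)" "short_runs (n div 2)"
  shows "short_runs n"
  unfolding short_runs_def
proof
  fix xs assume xs: "xs \<in> free_perms n"
  show "2 * fst (snd (stype n xs)) < n \<and> 2 * snd (snd (stype n xs)) < n"
  proof (rule stype_half[OF xs assms])
    fix p assume p: "p \<in> free_perms ((n + 1) div 2)" "stype n xs = lift_odd n (stype ((n + 1) div 2) p) 0 0 0"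
    have "2 * fst (snd (stype ((n + 1) div 2) p)) < (n + 1) div 2" "2 * snd (snd (stype ((n + 1) div 2) p)) < (n + 1) div 2"
      using assms(2) p(1) by (auto simp: short_runs_def)
    then show ?thesis unfolding p(2) lift_odd_def
      using lift_le[of n "(n + 1) div 2" "2 * fst (stype ((n + 1) div 2) p) - 1" "stype ((n + 1) div 2) p"] assms(1) by linarith
  next
    fix q assume q: "q \<in> free_perms (n div 2)" "stype n xs = lift_even n (stype (n div 2) q) 0 0 0"
    have "2 * fst (snd (stype (n div 2) q)) < n div 2" "2 * snd (snd (stype (n div 2) q)) < n div 2"
      using assms(3) q(1) by (auto simp: short_runs_def)
    then show ?thesis unfolding q(2) lift_even_def
      using lift_le[of n "n div 2" "2 * fst (stype (n div 2) q)" "stype (n div 2) q"] assms(1) by linarith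
  qed
qed

text \<open>The base ends at 17 because from 18 on both halves are at least 9.\<close>

lemma short_runs_induct:
  assumes base: "\<And>m. 9 \<le> m \<Longrightarrow> m \<le> 17 \<Longrightarrow> short_runs m" and "m \<ge> 9"
  shows "short_runs m"
  using assms(2)
proof (induction m rule: less_induct)
  case (less m)
  show ?case
  proof (cases "m \<le> 17")
    case False
    show ?thesis
    proof (rule short_runs_step)
      show "short_runs ((m + 1) div 2)" by (rule less.IH) (use False in auto)
      show "short_runs (m div 2)" by (rule less.IH) (use False in auto)
    qed (use False in auto)
  next
    case True
    then show ?thesis using base less.prems by blast
  qed
qed

section \<open>A uniform bound on the number of shuffles\<close>

text \<open>
  The following condition on the initial elements \<open>x\<close> and \<open>y\<close>, both counted from the respective nearer
  end of the interval, is implied by \<^const>\<open>far\<close> and is inherited by the parity classes.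
\<close>

fun tame :: "nat \<Rightarrow> nat \<Rightarrow> stype \<Rightarrow> stype \<Rightarrow> bool" where
  "tame m1 m2 (x, l, h) (y, l', h') \<longleftrightarrow> (2 * x + y \<le> m2 + 2 \<and> x + 2 * y \<le> m1 + 2 \<longrightarrow> ways l l' \<le> 20)"

definition few_ways :: "nat \<Rightarrow> nat \<Rightarrow> bool" where
  "few_ways m1 m2 \<longleftrightarrow> (\<forall>p\<in>free_perms m1. \<forall>q\<in>free_perms m2. tame m1 m2 (stype m1 p) (stype m2 q))"

lemma tame_sym: "tame m1 m2 s t \<Longrightarrow> tame m2 m1 t s"
  by (cases s; cases t) (auto simp: ways_commute add.commute)

lemma few_ways_sym: "few_ways m1 m2 \<Longrightarrow> few_ways m2 m1"
  using tame_sym by (auto simp: few_ways_def)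

text \<open>The element \<open>x\<close> of a parity class of size \<open>m\<close> becomes
  \<open>X\<close> in the interval of size \<open>n\<close>. The bounds on \<open>n\<close> reflect
  that the odd class has the rounded-up and the even class the rounded-down half.\<close>

definition halves :: "nat \<Rightarrow> nat \<Rightarrow> nat \<Rightarrow> nat \<Rightarrow> bool" where
  "halves n m x X \<longleftrightarrow> x \<ge> 1 \<and> (X = 2 * x - 1 \<and> n \<le> 2 * m \<or> X = 2 * x \<and> n \<le> 2 * m + 1)"

text \<open>The summand 2 in \<open>tame\<close> is stable under halving:
  \<open>2 * X + Y \<le> n2 + 2\<close> gives at worst
  \<open>4 * x + 2 * y \<le> 2 * m2 + 5\<close>, and integrality yields
  \<open>2 * x + y \<le> m2 + 2\<close>. The recorded runs are kept or become 0, so the number of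
  shuffles does not increase.\<close>

lemma tame_lift:
  assumes "tame m1 m2 s t" "halves n1 m1 (fst s) X" "halves n2 m2 (fst t) Y"
  shows "tame n1 n2 (lift n1 m1 X s 0 0 0) (lift n2 m2 Y t 0 0 0)"
proof -
  obtain x l h where s: "s = (x, l, h)" by (cases s)
  obtain y l' h' where t: "t = (y, l', h')" by (cases t)
  have "2 * x + y \<le> m2 + 2" if "2 * X + Y \<le> n2 + 2"
    using assms(2,3) that unfolding s t halves_def fst_conv by (elim conjE disjE) linarith+
  moreover have "x + 2 * y \<le> m1 + 2" if "X + 2 * Y \<le> n1 + 2"
    using assms(2,3) that unfolding s t halves_def fst_conv by (elim conjE disjE) linarith+
  ultimately show ?thesis using assms(1) by (auto simp: s t)
qed

lemma halves_stype:
  assumes "n \<ge> 2"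
  shows "p \<in> free_perms ((n + 1) div 2) \<Longrightarrow> halves n ((n + 1) div 2) (fst (stype ((n + 1) div 2) p)) (2 * fst (stype ((n + 1) div 2) p) - 1)"
    "q \<in> free_perms (n div 2) \<Longrightarrow> halves n (n div 2) (fst (stype (n div 2) q)) (2 * fst (stype (n div 2) q))"
proof -
  have h: "hd xs \<ge> 1" if "xs \<in> free_perms m" "m > 0" for xs m
    using free_permsD(1)[OF that(1)] free_perms_Nil[OF that] hd_in_set[of xs] by auto
  show "p \<in> free_perms ((n + 1) div 2) \<Longrightarrow> halves n ((n + 1) div 2) (fst (stype ((n + 1) div 2) p)) (2 * fst (stype ((n + 1) div 2) p) - 1)"
    using h[of p "(n + 1) div 2"] assms by (auto simp: halves_def)
  show "q \<in> free_perms (n div 2) \<Longrightarrow> halves n (n div 2) (fst (stype (n div 2) q)) (2 * fst (stype (n div 2) q))"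
    using h[of q "n div 2"] assms by (auto simp: halves_def)
qed

lemma stype_lift:
  assumes "xs \<in> free_perms n" "n \<ge> 4" "short_runs ((n + 1) div 2)" "short_runs (n div 2)"
  obtains m p X where "m = (n + 1) div 2 \<or> m = n div 2" "p \<in> free_perms m"
    "stype n xs = lift n m X (stype m p) 0 0 0" "halves n m (fst (stype m p)) X"
proof -
  have n: "n \<ge> 2" using assms(2) by simp
  show ?thesis
    by (rule stype_half[OF assms]; unfold lift_odd_def lift_even_def)
      (use that halves_stype[OF n] in blast)+
qed

lemma few_ways_step:
  assumes n: "n1 \<ge> 4" "n2 \<ge> 4"
    and s: "short_runs ((n1 + 1) div 2)" "short_runs (n1 div 2)" "short_runs ((n2 + 1) div 2)" "short_runs (n2 div 2)"
    and few: "\<And>m1 m2. m1 = (n1 + 1) div 2 \<or> m1 = n1 div 2 \<Longrightarrow> m2 = (n2 + 1) div 2 \<or> m2 = n2 div 2 \<Longrightarrow> few_ways m1 m2"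
  shows "few_ways n1 n2"
  unfolding few_ways_def
proof (intro ballI)
  fix p q assume p: "p \<in> free_perms n1" and q: "q \<in> free_perms n2"
  obtain m1 p' X where 1: "m1 = (n1 + 1) div 2 \<or> m1 = n1 div 2" "p' \<in> free_perms m1"
    "stype n1 p = lift n1 m1 X (stype m1 p') 0 0 0" "halves n1 m1 (fst (stype m1 p')) X"
    using stype_lift[OF p n(1) s(1,2)] .
  obtain m2 q' Y where 2: "m2 = (n2 + 1) div 2 \<or> m2 = n2 div 2" "q' \<in> free_perms m2"
    "stype n2 q = lift n2 m2 Y (stype m2 q') 0 0 0" "halves n2 m2 (fst (stype m2 q')) Y"
    using stype_lift[OF q n(2) s(3,4)] .
  have "tame m1 m2 (stype m1 p') (stype m2 q')"
    using few[OF 1(1) 2(1)] 1(2) 2(2) by (auto simp: few_ways_def)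
  then show "tame n1 n2 (stype n1 p) (stype n2 q)"
    unfolding 1(3) 2(3) by (rule tame_lift[OF _ 1(4) 2(4)])
qed

text \<open>Sizes that differ by at most 1 have halves that differ by at most 1, so only nearly
  equal sizes occur. Above 17 all halves are at least 9.\<close>

lemma few_ways_induct:
  assumes short: "\<And>m. m \<ge> 9 \<Longrightarrow> short_runs m"
    and base: "\<And>m. 9 \<le> m \<Longrightarrow> m \<le> 17 \<Longrightarrow> few_ways m m \<and> few_ways m (m + 1)"
    and "m1 \<ge> 9" "m2 \<ge> 9" "m1 \<le> m2 + 1" "m2 \<le> m1 + 1"
  shows "few_ways m1 m2"
  using assms(3-)
proof (induction "m1 + m2" arbitrary: m1 m2 rule: less_induct)
  case less
  show ?case
  proof (cases "m1 \<le> 17 \<or> m2 \<le> 17")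
    case True
    consider "m2 = m1" "m1 \<le> 17" | "m2 = m1 + 1" "m1 \<le> 17" | "m1 = m2 + 1" "m2 \<le> 17"
      using True less.prems by linarith
    then show ?thesis
    proof cases
      case 3
      then show ?thesis using base[of m2] less.prems few_ways_sym by auto
    qed (use base[of m1] less.prems in auto)
  next
    case False
    show ?thesis
    proof (rule few_ways_step)
      fix k1 k2 assume k: "k1 = (m1 + 1) div 2 \<or> k1 = m1 div 2" "k2 = (m2 + 1) div 2 \<or> k2 = m2 div 2"
      show "few_ways k1 k2"
      proof (rule less.hyps)
        show "k1 + k2 < m1 + m2" "k1 \<ge> 9" "k2 \<ge> 9" "k1 \<le> k2 + 1" "k2 \<le> k1 + 1"
          using k False less.prems by linarith+
      qed
    qed (use False in \<open>auto intro!: short\<close>)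
  qed
qed

text \<open>Turns a high block into a low one with its head counted from the upper end, so that a
  pair of opposite blocks takes the form of two low blocks treated in \<open>tame\<close>.\<close>

lemma stype_mirror:
  assumes "xs \<in> free_perms n" "n > 0"
  shows "stype n (mirror n xs) = (n + 1 - hd xs, snd (snd (stype n xs)), fst (snd (stype n xs)))"
proof -
  have s: "set xs = {1..n}" and ne: "xs \<noteq> []" using free_permsD(1) free_perms_Nil assms by auto
  have h: "hd xs \<in> {1..n}" using s ne hd_in_set by blast
  have hm: "hd (mirror n xs) = n + 1 - hd xs" using ne by (simp add: mirror_def hd_map)
  have "takeWhile (\<lambda>x. n + 1 - x \<le> n + 1 - hd xs) xs = takeWhile (\<lambda>x. hd xs \<le> x) xs"
    by (rule takeWhile_cong) (use s h in auto)
  then have 1: "run (mirror n xs) = hrun xs"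
    unfolding run_def hrun_def hm by (simp add: mirror_def takeWhile_map o_def)
  have "takeWhile (\<lambda>x. n + 1 - hd xs \<le> n + 1 - x) xs = takeWhile (\<lambda>x. x \<le> hd xs) xs"
    by (rule takeWhile_cong) (use s h in auto)
  then have 2: "hrun (mirror n xs) = run xs"
    unfolding run_def hrun_def hm by (simp add: mirror_def takeWhile_map o_def)
  show ?thesis using h by (auto simp: stype_def hm 1 2)
qed

section \<open>The factor 21\<close>

context
  fixes n :: nat
  assumes n: "n \<ge> 4" and few: "few_ways ((n + 1) div 2) (n div 2)"
begin

text \<open>Mirror the class whose block is high. The far condition then becomes the hypothesis of
  \<open>tame\<close>; the sizes of the classes, which differ by at most 1 and add up to
  \<open>n\<close>, make the inequalities match.\<close>

lemma weight_le_20: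
  assumes p: "p \<in> free_perms ((n + 1) div 2)" and q: "q \<in> free_perms (n div 2)"
  shows "weight (rect n (stype ((n + 1) div 2) p) (stype (n div 2) q)) \<le> 20"
proof -
  let ?a = "(n + 1) div 2" and ?b = "n div 2"
  obtain z l h where s: "stype ?a p = (z, l, h)" by (metis prod_cases3)
  obtain y l' h' where t: "stype ?b q = (y, l', h')" by (metis prod_cases3)
  have z: "z = hd p" and y: "y = hd q" using s t by (auto simp: stype_def)
  have zr: "z \<in> {1..?a}" "y \<in> {1..?b}"
    unfolding z y using hd_in_set[of p] hd_in_set[of q] free_permsD(1)[OF p] free_permsD(1)[OF q]
      free_perms_Nil[OF p] free_perms_Nil[OF q] n by auto
  have ab: "?a + ?b = n" "?b \<le> ?a" "?a \<le> ?b + 1" by linarith+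
  have "rect n (z, l, h) (y, l', h') = (0, 0, 0, 0) \<or>
      rect n (z, l, h) (y, l', h') = (1, l, 2, h') \<and> 2 * (2 * z - 1) \<le> 2 * y \<and> n + (2 * z - 1) < 4 * y \<or>
      rect n (z, l, h) (y, l', h') = (2, h, 1, l') \<and> 4 * y \<le> 2 * z - 1 \<and> n + 2 * y < 2 * (2 * z - 1)"
    by simp
  then consider "rect n (z, l, h) (y, l', h') = (0, 0, 0, 0)"
    | "rect n (z, l, h) (y, l', h') = (1, l, 2, h')" "2 * (2 * z - 1) \<le> 2 * y" "n + (2 * z - 1) < 4 * y"
    | "rect n (z, l, h) (y, l', h') = (2, h, 1, l')" "4 * y \<le> 2 * z - 1" "n + 2 * y < 2 * (2 * z - 1)"
    by blast
  then show ?thesis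
  proof cases
    case 1
    then show ?thesis unfolding s t by simp
  next
    case 2
    have "tame ?a ?b (stype ?a p) (stype ?b (mirror ?b q))"
      using few p mirror_free_perms[OF q] by (auto simp: few_ways_def)
    then have "tame ?a ?b (z, l, h) (?b + 1 - y, h', l')"
      using stype_mirror[OF q] n unfolding s t by (simp add: y)
    moreover have "2 * z + (?b + 1 - y) \<le> ?b + 2" "z + 2 * (?b + 1 - y) \<le> ?a + 2"
      using 2(2,3) zr ab unfolding atLeastAtMost_iff by linarith+
    ultimately show ?thesis unfolding s t 2(1) by simp
  next
    case 3
    have "tame ?a ?b (stype ?a (mirror ?a p)) (stype ?b q)"
      using few q mirror_free_perms[OF p] by (auto simp: few_ways_def)
    then have "tame ?a ?b (?a + 1 - z, h, l) (y, l', h')"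
      using stype_mirror[OF p] n unfolding s t by (simp add: z)
    moreover have "2 * (?a + 1 - z) + y \<le> ?b + 2" "(?a + 1 - z) + 2 * y \<le> ?a + 2"
      using 3(2,3) zr ab unfolding atLeastAtMost_iff by linarith+
    ultimately show ?thesis unfolding s t 3(1) by simp
  qed
qed

end

definition lower :: "nat \<Rightarrow> nat list set" where
  "lower m = {p \<in> free_perms m. 2 * hd p < m + 1}"

definition middle :: "nat \<Rightarrow> nat list set" where
  "middle m = {p \<in> free_perms m. 2 * hd p = m + 1}"

definition upper :: "nat \<Rightarrow> nat list set" where
  "upper m = {p \<in> free_perms m. m + 1 < 2 * hd p}"

lemma card_upper:
  assumes "m > 0"
  shows "card (upper m) = card (lower m)"
proof (rule bij_betw_same_card[of "mirror m"], rule bij_betwI[where g = "mirror m"])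
  have hm: "hd (mirror m p) = m + 1 - hd p \<and> hd p \<in> {1..m}" if "p \<in> free_perms m" for p
  proof -
    have "p \<noteq> []" "set p = {1..m}" using free_perms_Nil that assms free_permsD(1) by auto
    then show ?thesis using hd_in_set[of p] by (simp add: mirror_def hd_map)
  qed
  show "mirror m \<in> upper m \<rightarrow> lower m" "mirror m \<in> lower m \<rightarrow> upper m"
    using hm mirror_free_perms by (fastforce simp: upper_def lower_def)+
qed (auto simp: upper_def lower_def intro: mirror_mirror dest: free_permsD(1))

lemma theta_split:
  assumes "m > 0"
  shows "theta m = 2 * card (lower m) + card (middle m)"
proof -
  have f: "finite (lower m)" "finite (middle m)" "finite (upper m)"
    by (auto simp: lower_def middle_def upper_def)
  have "free_perms m = lower m \<union> (middle m \<union> upper m)" by (auto simp: lower_def middle_def upper_def)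
  moreover have "card (lower m \<union> (middle m \<union> upper m)) = card (lower m) + (card (middle m) + card (upper m))"
    using f by (subst card_Un_disjoint, simp, simp, force simp: lower_def middle_def upper_def)
      (subst card_Un_disjoint, auto simp: lower_def middle_def upper_def)
  ultimately show ?thesis using card_upper[OF assms] by (simp add: theta_card)
qed

definition far_pairs :: "nat \<Rightarrow> (nat list \<times> nat list) set" where
  "far_pairs n = {(p, q) \<in> free_perms ((n + 1) div 2) \<times> free_perms (n div 2).
     fst (rect n (stype ((n + 1) div 2) p) (stype (n div 2) q)) \<noteq> 0}"

text \<open>Let L and M count the low and the middle heads of one class, L' and M' those of the
  other. There are at most 2LL' + LM' + ML' far pairs, and twice this is at most (2L + M)(2L' + M'),
  the product of the two values of \<open>theta\<close>.\<close>

lemma card_far_pairs: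
  assumes n: "n \<ge> 4"
  shows "2 * card (far_pairs n) \<le> theta ((n + 1) div 2) * theta (n div 2)"
proof -
  let ?a = "(n + 1) div 2" and ?b = "n div 2"
  have ab: "?a + ?b = n" "?b \<le> ?a" "?a \<le> ?b + 1" "?b \<ge> 2" using n by linarith+
  \<comment> \<open>Far heads lie on opposite sides, or one of them is in the middle and the even
    head is the larger one. The two other combinations with a middle head are excluded, which is
    what keeps the count below one half.\<close>
  have "far_pairs n \<subseteq> upper ?a \<times> lower ?b \<union> lower ?a \<times> upper ?b \<union> lower ?a \<times> middle ?b \<union> middle ?a \<times> upper ?b"
  proof
    fix pq assume "pq \<in> far_pairs n"
    then obtain p q where pq: "pq = (p, q)" "p \<in> free_perms ?a" "q \<in> free_perms ?b"
      and r: "fst (rect n (stype ?a p) (stype ?b q)) \<noteq> 0" by (auto simp: far_pairs_def)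
    have "hd p \<in> {1..?a}" "hd q \<in> {1..?b}"
      using free_permsD(1)[OF pq(2)] free_permsD(1)[OF pq(3)] free_perms_Nil[OF pq(2)] free_perms_Nil[OF pq(3)]
        hd_in_set[of p] hd_in_set[of q] ab by auto
    moreover have "2 * (2 * hd p - 1) \<le> 2 * hd q \<and> n + (2 * hd p - 1) < 4 * hd q \<or>
        4 * hd q \<le> 2 * hd p - 1 \<and> n + 2 * hd q < 2 * (2 * hd p - 1)"
      using r by (auto simp: stype_def split: if_splits)
    ultimately have "?a + 1 < 2 * hd p \<and> 2 * hd q < ?b + 1 \<or>
        2 * hd p < ?a + 1 \<and> ?b + 1 < 2 * hd q \<or> 2 * hd p < ?a + 1 \<and> 2 * hd q = ?b + 1 \<or>
        2 * hd p = ?a + 1 \<and> ?b + 1 < 2 * hd q"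
      using ab unfolding atLeastAtMost_iff by linarith
    then show "pq \<in> upper ?a \<times> lower ?b \<union> lower ?a \<times> upper ?b \<union> lower ?a \<times> middle ?b \<union> middle ?a \<times> upper ?b"
      using pq by (auto simp: lower_def middle_def upper_def)
  qed
  then have "card (far_pairs n) \<le> card (upper ?a \<times> lower ?b \<union> lower ?a \<times> upper ?b \<union> lower ?a \<times> middle ?b \<union> middle ?a \<times> upper ?b)"
    by (rule card_mono[rotated]) (auto simp: lower_def middle_def upper_def)
  also have "\<dots> \<le> card (upper ?a \<times> lower ?b) + card (lower ?a \<times> upper ?b) + card (lower ?a \<times> middle ?b) + card (middle ?a \<times> upper ?b)"
    by (meson card_Un_le le_trans add_le_mono order_refl)
  also have "\<dots> = 2 * (card (lower ?a) * card (lower ?b)) + card (lower ?a) * card (middle ?b) + card (middle ?a) * card (lower ?b)"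
    using card_upper[of ?a] card_upper[of ?b] ab by (simp add: card_cartesian_product)
  finally show ?thesis
    using theta_split[of ?a] theta_split[of ?b] ab by (simp add: algebra_simps)
qed

text \<open>Every pair contributes 1, and a far pair at most 19 more. With the factor 2 of
  \<open>theta_sum\<close> and at most half of the pairs far, the total factor is 2 + 19.\<close>

theorem theta_le_21:
  assumes n: "n \<ge> 4" and few: "few_ways ((n + 1) div 2) (n div 2)"
  shows "theta n \<le> 21 * (theta ((n + 1) div 2) * theta (n div 2))"
proof -
  let ?A = "free_perms ((n + 1) div 2)" and ?B = "free_perms (n div 2)"
  let ?w = "\<lambda>(p, q). weight (rect n (stype ((n + 1) div 2) p) (stype (n div 2) q))"
  have sub: "far_pairs n \<subseteq> ?A \<times> ?B" by (auto simp: far_pairs_def)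
  have "(\<Sum>z\<in>?A \<times> ?B. ?w z) \<le> (\<Sum>z\<in>?A \<times> ?B. 1 + (if z \<in> far_pairs n then 19 else 0))"
  proof (rule sum_mono)
    fix z assume z: "z \<in> ?A \<times> ?B"
    obtain p q where pq: "z = (p, q)" by (cases z)
    obtain c s d k where r: "rect n (stype ((n + 1) div 2) p) (stype (n div 2) q) = (c, s, d, k)" by (metis prod_cases4)
    show "?w z \<le> 1 + (if z \<in> far_pairs n then 19 else 0)"
    proof (cases "z \<in> far_pairs n")
      case True
      then show ?thesis using weight_le_20[OF n few, of p q] z pq by auto
    next
      case False
      then have "c = 0" using z pq r by (auto simp: far_pairs_def)
      then show ?thesis using False pq r by simp
    qed
  qed
  also have "\<dots> = card (?A \<times> ?B) + 19 * card (far_pairs n)"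
  proof -
    have "(\<Sum>z\<in>?A \<times> ?B. if z \<in> far_pairs n then 19 else 0) = (\<Sum>z\<in>far_pairs n. 19::nat)"
      using sub by (simp add: sum.If_cases Int_absorb1)
    then show ?thesis by (simp only: sum.distrib sum_constant) simp
  qed
  finally have "(\<Sum>z\<in>?A \<times> ?B. ?w z) \<le> theta ((n + 1) div 2) * theta (n div 2) + 19 * card (far_pairs n)"
    by (simp add: theta_card card_cartesian_product)
  moreover have "theta n = 2 * (\<Sum>z\<in>?A \<times> ?B. ?w z)"
    using theta_sum[OF n] by (simp add: sum.cartesian_product split_def)
  ultimately show ?thesis using card_far_pairs[OF n] by linarith
qed

section \<open>Evaluation of tables, run bounds and values of \<open>theta\<close>\<close>

fun tame_row :: "nat \<Rightarrow> nat \<Rightarrow> stype \<Rightarrow> (stype \<times> nat) list \<Rightarrow> bool" where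
  "tame_row m1 m2 s [] \<longleftrightarrow> True"
| "tame_row m1 m2 s ((t, d) # S) \<longleftrightarrow> tame m1 m2 s t \<and> tame_row m1 m2 s S"

fun tame_table :: "nat \<Rightarrow> nat \<Rightarrow> (stype \<times> nat) list \<Rightarrow> (stype \<times> nat) list \<Rightarrow> bool" where
  "tame_table m1 m2 [] S2 \<longleftrightarrow> True"
| "tame_table m1 m2 ((s, c) # S1) S2 \<longleftrightarrow> tame_row m1 m2 s S2 \<and> tame_table m1 m2 S1 S2"

lemma tame_row_iff: "tame_row m1 m2 s S \<longleftrightarrow> (\<forall>t\<in>fst ` set S. tame m1 m2 s t)"
  by (induction m1 m2 s S rule: tame_row.induct) auto

lemma tame_table_iff: "tame_table m1 m2 S1 S2 \<longleftrightarrow> (\<forall>s\<in>fst ` set S1. \<forall>t\<in>fst ` set S2. tame m1 m2 s t)"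
  by (induction m1 m2 S1 S2 rule: tame_table.induct) (auto simp: tame_row_iff)

lemma few_waysI:
  assumes "represents1 m1 S1" "represents1 m2 S2" "tame_table m1 m2 S1 S2"
  shows "few_ways m1 m2"
  unfolding few_ways_def
proof (intro ballI)
  fix p q assume p: "p \<in> free_perms m1" and q: "q \<in> free_perms m2"
  have "\<forall>s\<in>fst ` set S1. \<forall>t\<in>fst ` set S2. tame m1 m2 s t"
    using assms(3) by (simp only: tame_table_iff)
  from bspec[OF bspec[OF this represents1_support[OF assms(1) p]] represents1_support[OF assms(2) q]]
  show "tame m1 m2 (stype m1 p) (stype m2 q)" .
qed

schematic_goal represents_10: "represents 10 ?T"
  by (rule represents_table_step[OF represents_5 represents_5], simp, simp, simp, code_simp)

schematic_goal represents_11: "represents 11 ?T"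
  by (rule represents_table_step[OF represents_6 represents_5], simp, simp, simp, code_simp)

schematic_goal represents_12: "represents 12 ?T"
  by (rule represents_table_step[OF represents_6 represents_6], simp, simp, simp, code_simp)

schematic_goal represents_13: "represents 13 ?T"
  by (rule represents_table_step[OF represents_7 represents_6], simp, simp, simp, code_simp)

schematic_goal represents_14: "represents 14 ?T"
  by (rule represents_table_step[OF represents_7 represents_7], simp, simp, simp, code_simp)

schematic_goal represents_15: "represents 15 ?T"
  by (rule represents_table_step[OF represents_8 represents_7], simp, simp, simp, code_simp)

schematic_goal represents_16: "represents 16 ?T"
  by (rule represents_table_step[OF represents_8 represents_8], simp, simp, simp, code_simp)

schematic_goal represents_17: "represents 17 ?T"
  by (rule represents_table_step[OF represents_9 represents_8], simp, simp, simp, code_simp)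

schematic_goal represents_18: "represents 18 ?T"
  by (rule represents_table_step[OF represents_9 represents_9], simp, simp, simp, code_simp)

schematic_goal starts_9: "represents1 9 ?S"
  by (rule represents1_from_table[OF represents_9], code_simp)

schematic_goal starts_10: "represents1 10 ?S"
  by (rule represents1_from_table[OF represents_10], code_simp)

schematic_goal starts_11: "represents1 11 ?S"
  by (rule represents1_from_table[OF represents_11], code_simp)

schematic_goal starts_12: "represents1 12 ?S"
  by (rule represents1_from_table[OF represents_12], code_simp)

schematic_goal starts_13: "represents1 13 ?S"
  by (rule represents1_from_table[OF represents_13], code_simp)

schematic_goal starts_14: "represents1 14 ?S"
  by (rule represents1_from_table[OF represents_14], code_simp)

schematic_goal starts_15: "represents1 15 ?S"
  by (rule represents1_from_table[OF represents_15], code_simp)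

schematic_goal starts_16: "represents1 16 ?S"
  by (rule represents1_from_table[OF represents_16], code_simp)

schematic_goal starts_17: "represents1 17 ?S"
  by (rule represents1_from_table[OF represents_17], code_simp)

schematic_goal starts_18: "represents1 18 ?S"
  by (rule represents1_from_table[OF represents_18], code_simp)

lemma short_runs_9: "short_runs 9"
  by (rule short_runsI[OF starts_9], code_simp)

lemma short_runs_10: "short_runs 10"
  by (rule short_runsI[OF starts_10], code_simp)

lemma short_runs_11: "short_runs 11"
  by (rule short_runsI[OF starts_11], code_simp)

lemma short_runs_12: "short_runs 12"
  by (rule short_runsI[OF starts_12], code_simp)

lemma short_runs_13: "short_runs 13"
  by (rule short_runsI[OF starts_13], code_simp)

lemma short_runs_14: "short_runs 14"
  by (rule short_runsI[OF starts_14], code_simp)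

lemma short_runs_15: "short_runs 15"
  by (rule short_runsI[OF starts_15], code_simp)

lemma short_runs_16: "short_runs 16"
  by (rule short_runsI[OF starts_16], code_simp)

lemma short_runs_17: "short_runs 17"
  by (rule short_runsI[OF starts_17], code_simp)

lemma few_ways_9: "few_ways 9 9"
  by (rule few_waysI[OF starts_9 starts_9], code_simp)

lemma few_ways_9_10: "few_ways 9 10"
  by (rule few_waysI[OF starts_9 starts_10], code_simp)

lemma few_ways_10: "few_ways 10 10"
  by (rule few_waysI[OF starts_10 starts_10], code_simp)

lemma few_ways_10_11: "few_ways 10 11"
  by (rule few_waysI[OF starts_10 starts_11], code_simp)

lemma few_ways_11: "few_ways 11 11"
  by (rule few_waysI[OF starts_11 starts_11], code_simp)

lemma few_ways_11_12: "few_ways 11 12"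
  by (rule few_waysI[OF starts_11 starts_12], code_simp)

lemma few_ways_12: "few_ways 12 12"
  by (rule few_waysI[OF starts_12 starts_12], code_simp)

lemma few_ways_12_13: "few_ways 12 13"
  by (rule few_waysI[OF starts_12 starts_13], code_simp)

lemma few_ways_13: "few_ways 13 13"
  by (rule few_waysI[OF starts_13 starts_13], code_simp)

lemma few_ways_13_14: "few_ways 13 14"
  by (rule few_waysI[OF starts_13 starts_14], code_simp)

lemma few_ways_14: "few_ways 14 14"
  by (rule few_waysI[OF starts_14 starts_14], code_simp)

lemma few_ways_14_15: "few_ways 14 15"
  by (rule few_waysI[OF starts_14 starts_15], code_simp)

lemma few_ways_15: "few_ways 15 15"
  by (rule few_waysI[OF starts_15 starts_15], code_simp)

lemma few_ways_15_16: "few_ways 15 16"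
  by (rule few_waysI[OF starts_15 starts_16], code_simp)

lemma few_ways_16: "few_ways 16 16"
  by (rule few_waysI[OF starts_16 starts_16], code_simp)

lemma few_ways_16_17: "few_ways 16 17"
  by (rule few_waysI[OF starts_16 starts_17], code_simp)

lemma few_ways_17: "few_ways 17 17"
  by (rule few_waysI[OF starts_17 starts_17], code_simp)

lemma few_ways_17_18: "few_ways 17 18"
  by (rule few_waysI[OF starts_17 starts_18], code_simp)

\<comment> \<open>From here on both halves have length at least 9. Their runs are short, so the
  initial types are obtained without building a joint table of this length.\<close>
schematic_goal starts_19: "represents1 19 ?S"
  by (rule represents1_start_step_eq[OF represents_10 represents_9], simp, simp, simp, code_simp, code_simp, code_simp)

schematic_goal starts_20: "represents1 20 ?S"
  by (rule represents1_start_step_eq[OF represents_10 represents_10], simp, simp, simp, code_simp, code_simp, code_simp)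

schematic_goal starts_21: "represents1 21 ?S"
  by (rule represents1_start_step_eq[OF represents_11 represents_10], simp, simp, simp, code_simp, code_simp, code_simp)

schematic_goal starts_22: "represents1 22 ?S"
  by (rule represents1_start_step_eq[OF represents_11 represents_11], simp, simp, simp, code_simp, code_simp, code_simp)

schematic_goal starts_23: "represents1 23 ?S"
  by (rule represents1_start_step_eq[OF represents_12 represents_11], simp, simp, simp, code_simp, code_simp, code_simp)

schematic_goal starts_24: "represents1 24 ?S"
  by (rule represents1_start_step_eq[OF represents_12 represents_12], simp, simp, simp, code_simp, code_simp, code_simp)

schematic_goal starts_25: "represents1 25 ?S"
  by (rule represents1_start_step_eq[OF represents_13 represents_12], simp, simp, simp, code_simp, code_simp, code_simp)

schematic_goal starts_26: "represents1 26 ?S"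
  by (rule represents1_start_step_eq[OF represents_13 represents_13], simp, simp, simp, code_simp, code_simp, code_simp)

schematic_goal starts_27: "represents1 27 ?S"
  by (rule represents1_start_step_eq[OF represents_14 represents_13], simp, simp, simp, code_simp, code_simp, code_simp)

schematic_goal starts_28: "represents1 28 ?S"
  by (rule represents1_start_step_eq[OF represents_14 represents_14], simp, simp, simp, code_simp, code_simp, code_simp)

schematic_goal starts_29: "represents1 29 ?S"
  by (rule represents1_start_step_eq[OF represents_15 represents_14], simp, simp, simp, code_simp, code_simp, code_simp)

schematic_goal starts_30: "represents1 30 ?S"
  by (rule represents1_start_step_eq[OF represents_15 represents_15], simp, simp, simp, code_simp, code_simp, code_simp)

schematic_goal starts_31: "represents1 31 ?S"
  by (rule represents1_start_step_eq[OF represents_16 represents_15], simp, simp, simp, code_simp, code_simp, code_simp)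

schematic_goal starts_32: "represents1 32 ?S"
  by (rule represents1_start_step_eq[OF represents_16 represents_16], simp, simp, simp, code_simp, code_simp, code_simp)

schematic_goal starts_33: "represents1 33 ?S"
  by (rule represents1_start_step_eq[OF represents_17 represents_16], simp, simp, simp, code_simp, code_simp, code_simp)

schematic_goal starts_34: "represents1 34 ?S"
  by (rule represents1_start_step_eq[OF represents_17 represents_17], simp, simp, simp, code_simp, code_simp, code_simp)

schematic_goal starts_35: "represents1 35 ?S"
  by (rule represents1_start_step_eq[OF represents_18 represents_17], simp, simp, simp, code_simp, code_simp, code_simp)

schematic_goal starts_36: "represents1 36 ?S"
  by (rule represents1_start_step_eq[OF represents_18 represents_18], simp, simp, simp, code_simp, code_simp, code_simp)

\<comment> \<open>A value of \<open>theta\<close> needs only the initial types of the two halves, so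
  the lists up to length 36 reach as far as \<open>theta 71\<close>.\<close>
schematic_goal theta_36: "theta 36 = ?N"
  by (rule theta_from_starts[OF starts_18 starts_18], simp, simp, simp, code_simp)

schematic_goal theta_37: "theta 37 = ?N"
  by (rule theta_from_starts[OF starts_19 starts_18], simp, simp, simp, code_simp)

schematic_goal theta_38: "theta 38 = ?N"
  by (rule theta_from_starts[OF starts_19 starts_19], simp, simp, simp, code_simp)

schematic_goal theta_39: "theta 39 = ?N"
  by (rule theta_from_starts[OF starts_20 starts_19], simp, simp, simp, code_simp)

schematic_goal theta_40: "theta 40 = ?N"
  by (rule theta_from_starts[OF starts_20 starts_20], simp, simp, simp, code_simp)

schematic_goal theta_41: "theta 41 = ?N"
  by (rule theta_from_starts[OF starts_21 starts_20], simp, simp, simp, code_simp)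

schematic_goal theta_42: "theta 42 = ?N"
  by (rule theta_from_starts[OF starts_21 starts_21], simp, simp, simp, code_simp)

schematic_goal theta_43: "theta 43 = ?N"
  by (rule theta_from_starts[OF starts_22 starts_21], simp, simp, simp, code_simp)

schematic_goal theta_44: "theta 44 = ?N"
  by (rule theta_from_starts[OF starts_22 starts_22], simp, simp, simp, code_simp)

schematic_goal theta_45: "theta 45 = ?N"
  by (rule theta_from_starts[OF starts_23 starts_22], simp, simp, simp, code_simp)

schematic_goal theta_46: "theta 46 = ?N"
  by (rule theta_from_starts[OF starts_23 starts_23], simp, simp, simp, code_simp)

schematic_goal theta_47: "theta 47 = ?N"
  by (rule theta_from_starts[OF starts_24 starts_23], simp, simp, simp, code_simp)

schematic_goal theta_48: "theta 48 = ?N"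
  by (rule theta_from_starts[OF starts_24 starts_24], simp, simp, simp, code_simp)

schematic_goal theta_49: "theta 49 = ?N"
  by (rule theta_from_starts[OF starts_25 starts_24], simp, simp, simp, code_simp)

schematic_goal theta_50: "theta 50 = ?N"
  by (rule theta_from_starts[OF starts_25 starts_25], simp, simp, simp, code_simp)

schematic_goal theta_51: "theta 51 = ?N"
  by (rule theta_from_starts[OF starts_26 starts_25], simp, simp, simp, code_simp)

schematic_goal theta_52: "theta 52 = ?N"
  by (rule theta_from_starts[OF starts_26 starts_26], simp, simp, simp, code_simp)

schematic_goal theta_53: "theta 53 = ?N"
  by (rule theta_from_starts[OF starts_27 starts_26], simp, simp, simp, code_simp)

schematic_goal theta_54: "theta 54 = ?N"
  by (rule theta_from_starts[OF starts_27 starts_27], simp, simp, simp, code_simp)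

schematic_goal theta_55: "theta 55 = ?N"
  by (rule theta_from_starts[OF starts_28 starts_27], simp, simp, simp, code_simp)

schematic_goal theta_56: "theta 56 = ?N"
  by (rule theta_from_starts[OF starts_28 starts_28], simp, simp, simp, code_simp)

schematic_goal theta_57: "theta 57 = ?N"
  by (rule theta_from_starts[OF starts_29 starts_28], simp, simp, simp, code_simp)

schematic_goal theta_58: "theta 58 = ?N"
  by (rule theta_from_starts[OF starts_29 starts_29], simp, simp, simp, code_simp)

schematic_goal theta_59: "theta 59 = ?N"
  by (rule theta_from_starts[OF starts_30 starts_29], simp, simp, simp, code_simp)

schematic_goal theta_60: "theta 60 = ?N"
  by (rule theta_from_starts[OF starts_30 starts_30], simp, simp, simp, code_simp)

schematic_goal theta_61: "theta 61 = ?N"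
  by (rule theta_from_starts[OF starts_31 starts_30], simp, simp, simp, code_simp)

schematic_goal theta_62: "theta 62 = ?N"
  by (rule theta_from_starts[OF starts_31 starts_31], simp, simp, simp, code_simp)

schematic_goal theta_63: "theta 63 = ?N"
  by (rule theta_from_starts[OF starts_32 starts_31], simp, simp, simp, code_simp)

schematic_goal theta_64: "theta 64 = ?N"
  by (rule theta_from_starts[OF starts_32 starts_32], simp, simp, simp, code_simp)

schematic_goal theta_65: "theta 65 = ?N"
  by (rule theta_from_starts[OF starts_33 starts_32], simp, simp, simp, code_simp)

schematic_goal theta_66: "theta 66 = ?N"
  by (rule theta_from_starts[OF starts_33 starts_33], simp, simp, simp, code_simp)

schematic_goal theta_67: "theta 67 = ?N"
  by (rule theta_from_starts[OF starts_34 starts_33], simp, simp, simp, code_simp)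

schematic_goal theta_68: "theta 68 = ?N"
  by (rule theta_from_starts[OF starts_34 starts_34], simp, simp, simp, code_simp)

schematic_goal theta_69: "theta 69 = ?N"
  by (rule theta_from_starts[OF starts_35 starts_34], simp, simp, simp, code_simp)

schematic_goal theta_70: "theta 70 = ?N"
  by (rule theta_from_starts[OF starts_35 starts_35], simp, simp, simp, code_simp)

schematic_goal theta_71: "theta 71 = ?N"
  by (rule theta_from_starts[OF starts_36 starts_35], simp, simp, simp, code_simp)

section \<open>The bound for all lengths from 36 on\<close>

lemma few_ways_balanced:
  assumes "m1 \<ge> 9" "m2 \<ge> 9" "m1 \<le> m2 + 1" "m2 \<le> m1 + 1"
  shows "few_ways m1 m2"
proof (rule few_ways_induct[OF _ _ assms])
  fix m :: nat assume m: "9 \<le> m" "m \<le> 17"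
  then have "m = 9 \<or> m = 10 \<or> m = 11 \<or> m = 12 \<or> m = 13 \<or> m = 14 \<or> m = 15 \<or> m = 16 \<or> m = 17" by linarith
  then show "few_ways m m \<and> few_ways m (m + 1)"
    by (elim disjE) (simp_all add: few_ways_9 few_ways_9_10 few_ways_10 few_ways_10_11 few_ways_11 few_ways_11_12 few_ways_12 few_ways_12_13 few_ways_13 few_ways_13_14 few_ways_14 few_ways_14_15 few_ways_15 few_ways_15_16 few_ways_16 few_ways_16_17 few_ways_17 few_ways_17_18)
next
  fix m :: nat assume "m \<ge> 9"
  then show "short_runs m"
  proof (rule short_runs_induct[rotated])
    fix m :: nat assume "9 \<le> m" "m \<le> 17"
    then have "m = 9 \<or> m = 10 \<or> m = 11 \<or> m = 12 \<or> m = 13 \<or> m = 14 \<or> m = 15 \<or> m = 16 \<or> m = 17" by linarith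
    then show "short_runs m"
      by (elim disjE) (simp_all add: short_runs_9 short_runs_10 short_runs_11 short_runs_12 short_runs_13 short_runs_14 short_runs_15 short_runs_16 short_runs_17)
  qed
qed

lemma theta_halves:
  assumes "n \<ge> 18"
  shows "theta n \<le> 21 * (theta ((n + 1) div 2) * theta (n div 2))"
  by (rule theta_le_21) (use assms in \<open>auto intro!: few_ways_balanced\<close>)

text \<open>
  The list \<open>ts\<close> is compared with the powers of 591/250 = 2.364, of which \<open>M\<close> is a running
  lower bound in units of one millionth.
\<close>

fun below_powers :: "nat \<Rightarrow> nat list \<Rightarrow> bool" where
  "below_powers M [] \<longleftrightarrow> True"
| "below_powers M (t # ts) \<longleftrightarrow> 21000000 * t \<le> M \<and> below_powers (M * 591 div 250) ts"

lemma below_powersD: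
  assumes "below_powers M ts" "real M \<le> 1000000 * (591 / 250) ^ n" "i < length ts"
  shows "21 * real (ts ! i) \<le> (591 / 250) ^ (n + i)"
  using assms
proof (induction M ts arbitrary: n i rule: below_powers.induct)
  case (2 M t ts)
  show ?case
  proof (cases i)
    case 0
    have "real (21000000 * t) \<le> real M" using 2(2) by (simp only: of_nat_le_iff below_powers.simps)
    then show ?thesis using 2(3) 0 by simp
  next
    case (Suc k)
    have "real (M * 591 div 250) \<le> real (M * 591) / real 250" by (rule of_nat_div_le_of_nat)
    also have "\<dots> = real M * (591 / 250)" by simp
    also have "\<dots> \<le> 1000000 * (591 / 250) ^ n * (591 / 250)"
      using 2(3) by (intro mult_right_mono) auto
    finally have "real (M * 591 div 250) \<le> 1000000 * (591 / 250) ^ Suc n" by simp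
    then have "21 * real (ts ! k) \<le> (591 / 250) ^ (Suc n + k)"
      using 2 Suc by (intro "2.IH") auto
    then show ?thesis using Suc by simp
  qed
qed simp

lemma theta_base:
  assumes "36 \<le> n" "n \<le> 71" "n \<noteq> 64"
  shows "21 * real (theta n) \<le> (591 / 250) ^ n"
proof -
  \<comment> \<open>Length 64 defines \<open>c2\<close> and is treated separately; the 0 in its
    place keeps the list aligned with the exponents.\<close>
  let ?ts = "map (\<lambda>n. if n = 64 then 0 else theta n) [36..<72]"
  \<comment> \<open>The initial number is an integer lower bound of 2.364^36 in millionths.\<close>
  have "below_powers 28268905857528316375 ?ts" by (simp add: theta_36 theta_37 theta_38 theta_39 theta_40 theta_41 theta_42 theta_43 theta_44 theta_45 theta_46 theta_47 theta_48 theta_49 theta_50 theta_51 theta_52 theta_53 theta_54 theta_55 theta_56 theta_57 theta_58 theta_59 theta_60 theta_61 theta_62 theta_63 theta_65 theta_66 theta_67 theta_68 theta_69 theta_70 theta_71)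
  moreover have "real 28268905857528316375 \<le> 1000000 * (591 / 250) ^ 36" by (simp add: power_divide)
  moreover have "n - 36 < length ?ts" using assms by simp
  ultimately have "21 * real (?ts ! (n - 36)) \<le> (591 / 250) ^ (36 + (n - 36))"
    by (rule below_powersD)
  moreover have "?ts ! (n - 36) = (if [36..<72] ! (n - 36) = 64 then 0 else theta ([36..<72] ! (n - 36)))"
    by (rule nth_map) (use assms in simp)
  moreover have "[36..<72] ! (n - 36) = 36 + (n - 36)"
    by (rule nth_upt) (use assms in linarith)
  moreover have "36 + (n - 36) = n" using assms by simp
  ultimately show ?thesis using assms(3) by (simp only: if_False)
qed

lemma c2_pow_64: "c2 ^ 64 = 21 * real (theta 64)"
  by (simp add: c2_def)

lemma c2_bounds: "2.364 \<le> c2" "c2 < 2.365"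
proof -
  have c: "c2 ^ 64 = 838141760259573912802128" "c2 \<ge> 0"
    by (simp_all add: c2_pow_64 theta_64, simp add: c2_def)
  \<comment> \<open>The power 64 is reached by six squarings with a short decimal bound after each,
    which keeps the numbers small. The exponents stay nested so that the rule matches them
    literally.\<close>
  have sq: "x ^ (2 * k) \<le> b" if "x ^ k \<le> a" "0 \<le> x" "a ^ 2 \<le> b" for x a b :: real and k
    using power_mono[OF that(1), of 2] that(2,3) by (simp add: power_mult[symmetric] mult.commute)
  have sq': "b \<le> x ^ (2 * k)" if "a \<le> x ^ k" "0 \<le> a" "b \<le> a ^ 2" for x a b :: real and k
    using power_mono[OF that(1,2), of 2] that(3) by (simp add: power_mult[symmetric] mult.commute)
  let ?x = "2.364 :: real"
  have "?x ^ (2 * 1) \<le> 5.5885" by (simp add: power2_eq_square)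
  then have "?x ^ (2 * (2 * 1)) \<le> 31.2315" by (rule sq) (simp_all add: power2_eq_square)
  then have "?x ^ (2 * (2 * (2 * 1))) \<le> 975.41" by (rule sq) (simp_all add: power2_eq_square)
  then have "?x ^ (2 * (2 * (2 * (2 * 1)))) \<le> 951425" by (rule sq) (simp_all add: power2_eq_square)
  then have "?x ^ (2 * (2 * (2 * (2 * (2 * 1))))) \<le> 905210000000" by (rule sq) (simp_all add: power2_eq_square)
  then have "?x ^ (2 * (2 * (2 * (2 * (2 * (2 * 1)))))) \<le> c2 ^ 64"
    unfolding c(1) by (rule sq) (simp_all add: power2_eq_square)
  then have "?x ^ 64 \<le> c2 ^ 64" by simp
  then show "?x \<le> c2" using power_mono_iff[of ?x c2 64] c(2) by simp
  let ?y = "2.365 :: real"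
  have "5.593 \<le> ?y ^ (2 * 1)" by (simp add: power2_eq_square)
  then have "31.281 \<le> ?y ^ (2 * (2 * 1))" by (rule sq') (simp_all add: power2_eq_square)
  then have "978.5 \<le> ?y ^ (2 * (2 * (2 * 1)))" by (rule sq') (simp_all add: power2_eq_square)
  then have "957462 \<le> ?y ^ (2 * (2 * (2 * (2 * 1))))" by (rule sq') (simp_all add: power2_eq_square)
  then have "916700000000 \<le> ?y ^ (2 * (2 * (2 * (2 * (2 * 1)))))" by (rule sq') (simp_all add: power2_eq_square)
  \<comment> \<open>One more than \<open>21 * theta 64\<close>, to obtain the strict
    inequality.\<close>
  then have "838141760259573912802129 \<le> ?y ^ (2 * (2 * (2 * (2 * (2 * (2 * 1))))))"
    by (rule sq') (simp_all add: power2_eq_square)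
  then have "c2 ^ 64 < ?y ^ 64" unfolding c(1) by simp
  then show "c2 < ?y" using power_less_imp_less_base[of c2 64 ?y] by simp
qed

lemma theta_le_c2_pow:
  assumes "36 \<le> n"
  shows "21 * real (theta n) \<le> c2 ^ n"
  using assms
proof (induction n rule: less_induct)
  case (less n)
  consider "n = 64" | "n \<noteq> 64" "n \<le> 71" | "n \<ge> 72" by linarith
  then show ?case
  proof cases
    case 1
    then show ?thesis using c2_pow_64 by simp
  next
    case 2
    have "21 * real (theta n) \<le> (591 / 250) ^ n" by (rule theta_base) (use 2 less.prems in auto)
    also have "\<dots> \<le> c2 ^ n" using c2_bounds(1) by (intro power_mono) auto
    finally show ?thesis .
  next
    case 3
    let ?a = "(n + 1) div 2" and ?b = "n div 2"
    \<comment> \<open>Since \<open>n \<ge> 72\<close>, both halves are at least 36.\<close>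
    have IH: "21 * real (theta ?a) \<le> c2 ^ ?a" "21 * real (theta ?b) \<le> c2 ^ ?b"
      by (rule less.IH; use 3 in linarith)+
    have "theta n \<le> 21 * (theta ?a * theta ?b)" by (rule theta_halves) (use 3 in auto)
    then have "real (theta n) \<le> real (21 * (theta ?a * theta ?b))" by (simp only: of_nat_le_iff)
    \<comment> \<open>Multiplying by 21 once more gives each half a factor of its own:
      \<open>21 * theta\<close> is submultiplicative under halving, as is required for comparison
      with a pure power.\<close>
    then have "21 * real (theta n) \<le> (21 * real (theta ?a)) * (21 * real (theta ?b))" by (simp add: algebra_simps)
    also have "\<dots> \<le> c2 ^ ?a * c2 ^ ?b" using IH by (intro mult_mono) auto
    also have "\<dots> = c2 ^ n"
    proof -
      have "?a + ?b = n" by linarith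
      then show ?thesis by (simp add: power_add[symmetric])
    qed
    finally show ?thesis .
  qed
qed

theorem theorem2:
  shows "theta 64 = 39911512393313043466768 \<and>
         2.364 \<le> c2 \<and> c2 < 2.365 \<and>
         (\<forall>n::nat. 36 \<le> n \<longrightarrow> real (theta n) \<le> c2 ^ n / 21)"
  using theta_64 c2_bounds theta_le_c2_pow by (auto simp: field_simps)

end
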